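(* Let $\overline{p}(n)$ be the number of overpartitions of $n$, so that $\sum_{n\ge0}\overline{p}(n)q^n=\prod_{n\ge1}\frac{1-q^{2n}}{(1-q^n)^2}$, with $\overline{p}(x)=0$ unless $x$ is a nonnegative integer. Let $\ell$ be any odd prime. Then for every nonnegative integer $n$, $$\ell^3\,\overline{p}(\ell^2n)+\left(\frac{-n}{\ell}\right)\ell\,\overline{p}(n)+\overline{p}\!\left(\frac{n}{\ell^2}\right)\equiv(\ell^3+1)\,\overline{p}(n)\pmod{2^{12}}.$$
   Context: An overpartition of $n$ is a partition of $n$ in which the first occurrence of a part may be overlined. $\left(\frac{\cdot}{\ell}\right)$ is the Legendre symbol. *)

theory Defs
  imports "HOL-Number_Theory.Number_Theory" "HOL-Library.Multiset"
begin

text \<open>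
  A partition of \<open>n\<close> is a multiset \<open>M\<close> of positive integers with sum \<open>n\<close>. Since only the first
  occurrence of each part may be overlined, an overlining of \<open>M\<close> is a set \<open>S\<close> of part sizes of \<open>M\<close>.
\<close>

definition overpartitions :: "nat \<Rightarrow> (nat multiset \<times> nat set) set" where
  "overpartitions n = {(M, S). 0 \<notin># M \<and> sum_mset M = n \<and> S \<subseteq> set_mset M}"

text \<open>The counting function takes rational arguments, vanishing off the nonnegative integers.\<close>

definition pbar :: "rat \<Rightarrow> nat" where
  "pbar x = (if x \<in> \<nat> then card (overpartitions (nat \<lfloor>x\<rfloor>)) else 0)"

lemma pbar_of_nat: "pbar (of_nat n) = card (overpartitions n)"
  by (simp add: pbar_def)

lemma finite_overpartitions: "finite (overpartitions n)"
proof -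
  let ?A = "{M. set_mset M \<subseteq> {..n} \<and> size M \<le> n}"
  have "finite {xs. set xs \<subseteq> {..n} \<and> length xs \<le> n}"
    by (rule finite_lists_length_le) simp
  moreover have "?A \<subseteq> mset ` {xs. set xs \<subseteq> {..n} \<and> length xs \<le> n}"
  proof
    fix M assume M: "M \<in> ?A"
    obtain xs where "mset xs = M" using ex_mset by blast
    with M show "M \<in> mset ` {xs. set xs \<subseteq> {..n} \<and> length xs \<le> n}"
      by (intro image_eqI[of _ _ xs]) auto
  qed
  ultimately have A: "finite ?A" by (rule finite_surj)
  have size: "size M \<le> sum_mset M" if "0 \<notin># M" for M :: "nat multiset"
    using that by (induction M) auto
  have elem: "x \<le> sum_mset M" if "x \<in># M" for x and M :: "nat multiset"
    using that by (induction M) auto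
  have "overpartitions n \<subseteq> ?A \<times> Pow {..n}"
  proof
    fix p assume "p \<in> overpartitions n"
    then obtain M S where p: "p = (M, S)" and *: "0 \<notin># M" "sum_mset M = n" "S \<subseteq> set_mset M"
      by (auto simp: overpartitions_def)
    have "set_mset M \<subseteq> {..n}" using elem *(2) by blast
    then show "p \<in> ?A \<times> Pow {..n}" using p size[OF *(1)] *(2,3) by simp
  qed
  moreover have "finite (?A \<times> Pow {..n})" using A by simp
  ultimately show ?thesis by (rule finite_subset)
qed

end

theory Submission
  imports Defs "HOL-Complex_Analysis.Complex_Analysis" "HOL-Probability.Characteristic_Functions"
begin

text \<open>
  By Gauss, \<open>1 / \<theta> = \<Sum> (-1)\<^sup>n p(n) q\<^sup>n\<close> with \<open>\<theta> = \<Sum> q\<^bsup>n*n\<^esup>\<close>, \<open>q = exp (\<pi> \<i> \<tau>)\<close> and \<open>p(n)\<close>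
  the number of overpartitions of \<open>n\<close>. This is a form of weight \<open>-1/2\<close> for the theta group, which
  is generated by \<open>\<tau> \<mapsto> \<tau> + 2\<close> and \<open>\<tau> \<mapsto> -1/\<tau>\<close>. Up to sign, the left hand side of the congruence is
  the \<open>n\<close>-th coefficient of the image \<open>H\<close> of \<open>1 / \<theta>\<close> under the Hecke operator \<open>T(l\<^sup>2)\<close>, so that \<open>\<theta> H\<close>
  is a modular function. It is regular at \<open>\<infinity>\<close>, and at the other cusp \<open>1\<close> of the theta group it has
  an integral expansion with a pole of order at most \<open>(l\<^sup>2 - 1) / 8\<close>.

  The function \<open>G = 2\<^sup>8 \<theta>\<^sub>2\<^sup>4 \<theta>\<^sub>4\<^sup>4 / \<theta>\<^sup>8\<close> is a Hauptmodul: at the cusp \<open>1\<close> it has an integral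
  expansion with a simple pole and leading coefficient \<open>-1\<close>, while at \<open>\<infinity>\<close> it is \<open>2\<^sup>1\<^sup>2\<close> times an
  integral power series in \<open>q\<close> without constant term. Hence some integral polynomial \<open>Q\<close> in \<open>G\<close>
  cancels the polar part and the constant term of \<open>\<theta> H\<close> at the cusp \<open>1\<close>, and by the maximum principle
  \<open>\<theta> H = Q(G)\<close>. At \<open>\<infinity>\<close> this reads \<open>\<theta> H \<equiv> Q(0) = l\<^sup>3 + 1\<close> modulo \<open>2\<^sup>1\<^sup>2\<close>.
\<close>

section \<open>Gauss's identity for overpartitions\<close>

text \<open>The generating function itself is the reciprocal of theta with alternating signs. The
  signs \<open>(-1)\<^sup>n\<close> shift \<tau> by 1 and so produce a form on which \<tau>
  \<mapsto> -1/\<tau> acts by a scalar factor. As l is odd, n, l^2 n and n / l^2 have the same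
  parity, so the signs drop out of the congruence.

  Under a general element theta picks up a Gauss sum. These are carried along as sums: they are the
  weights in the middle part of the Hecke operator, and inversion pairs a residue c with a residue
  c', so that only the values \<open>gauss_sum l c * gauss_sum l c' = l\<close> and
  \<open>gauss_sum (l\<^sup>2) c = l\<close> enter. The Legendre symbol reappears when coefficients
  are read off.

  The modulus is 2^12 = 2^8 * 2^4. At the cusp 1 the denominator of G becomes the eighth power of
  \<open>theta2\<close>, whose factor 2^8 the normalisation cancels; the leading coefficient is then
  a unit, which keeps the coefficients of Q integral. At infinity the fourth power of
  \<open>theta2\<close> in the numerator supplies the remaining 2^4. The value Q(0) is found by
  comparing constant terms at infinity.\<close>

definition bounded_overpartitions :: "nat \<Rightarrow> nat \<Rightarrow> (nat multiset \<times> nat set) set" where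
  "bounded_overpartitions m n = {(M, S). set_mset M \<subseteq> {1..m} \<and> sum_mset M = n \<and> S \<subseteq> set_mset M}"

lemma member_le_sum_mset: "x \<in># M \<Longrightarrow> x \<le> sum_mset M" for x :: nat
  by (induction M) auto

lemma bounded_overpartitions_eq:
  assumes "n \<le> m"
  shows "bounded_overpartitions m n = overpartitions n"
proof -
  have "set_mset M \<subseteq> {1..m} \<longleftrightarrow> 0 \<notin># M" if "sum_mset M = n" for M :: "nat multiset"
    using that assms member_le_sum_mset[of _ M]
    by (force simp: Suc_le_eq intro: Nat.gr0I)
  then show ?thesis
    unfolding bounded_overpartitions_def overpartitions_def by blast
qed

lemma bounded_overpartitions_subset: "bounded_overpartitions m n \<subseteq> overpartitions n"
  unfolding bounded_overpartitions_def overpartitions_def by auto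

lemma finite_bounded_overpartitions [simp]: "finite (bounded_overpartitions m n)"
  using finite_subset[OF bounded_overpartitions_subset finite_overpartitions] .

lemma bounded_overpartitions_Suc_less:
  assumes "n < Suc m"
  shows "bounded_overpartitions (Suc m) n = bounded_overpartitions m n"
  using assms by (simp add: bounded_overpartitions_eq)

text \<open>Sorts by how \<open>k\<close> occurs: not at all; overlined and exactly once, where the
  copy and its mark are removed together; or otherwise, where one copy is removed and every mark
  stays legitimate. These are the terms of F_k = F_m + q^k F_k + q^k F_m, that is, of the factor (1
  + q^k) / (1 - q^k).\<close>

lemma bounded_overpartitions_Suc:
  fixes m :: nat
  defines "k \<equiv> Suc m"
  assumes "k \<le> n"
  shows "bounded_overpartitions k n = bounded_overpartitions m n
     \<union> ((\<lambda>(M, S). (add_mset k M, S)) ` bounded_overpartitions k (n - k)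
     \<union> (\<lambda>(M, S). (add_mset k M, insert k S)) ` bounded_overpartitions m (n - k))"
    (is "?L = ?A \<union> (?f ` ?B \<union> ?g ` ?C)")
proof (intro equalityI subsetI)
  fix p assume "p \<in> ?L"
  then obtain M S where p: "p = (M, S)" and M: "set_mset M \<subseteq> {1..k}" "sum_mset M = n" "S \<subseteq> set_mset M"
    by (auto simp: bounded_overpartitions_def)
  show "p \<in> ?A \<union> (?f ` ?B \<union> ?g ` ?C)"
  proof (cases "k \<in># M")
    case False
    then have "set_mset M \<subseteq> {1..m}" using M(1) unfolding k_def by (force simp: le_Suc_eq)
    then show ?thesis using M p by (auto simp: bounded_overpartitions_def)
  next
    case True
    then obtain M' where M': "M = add_mset k M'" by (metis multi_member_split)
    have sum': "sum_mset M' = n - k" using M(2) M' by simp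
    show ?thesis
    proof (cases "k \<in> S \<and> k \<notin># M'")
      case True
      have "(M', S - {k}) \<in> ?C"
        using True M M' sum' unfolding bounded_overpartitions_def k_def by (force simp: le_Suc_eq)
      moreover have "p = ?g (M', S - {k})" using True M' p by auto
      ultimately show ?thesis by blast
    next
      case False
      have "(M', S) \<in> ?B"
        using False M M' sum' unfolding bounded_overpartitions_def by auto
      moreover have "p = ?f (M', S)" using M' p by auto
      ultimately show ?thesis by blast
    qed
  qed
next
  fix p assume "p \<in> ?A \<union> (?f ` ?B \<union> ?g ` ?C)"
  then show "p \<in> ?L"
    using assms unfolding bounded_overpartitions_def by fastforce
qed

lemma card_bounded_overpartitions_Suc:
  assumes "Suc m \<le> n"
  shows "card (bounded_overpartitions (Suc m) n) = card (bounded_overpartitions m n)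
     + card (bounded_overpartitions (Suc m) (n - Suc m)) + card (bounded_overpartitions m (n - Suc m))"
proof -
  let ?k = "Suc m"
  let ?f = "\<lambda>(M, S). (add_mset ?k M, S)" and ?g = "\<lambda>(M, S). (add_mset ?k M, insert ?k S)"
  let ?A = "bounded_overpartitions m n" and ?B = "bounded_overpartitions ?k (n - ?k)"
    and ?C = "bounded_overpartitions m (n - ?k)"
  have "?k \<notin># fst p" if "p \<in> ?A" for p
    using that by (auto simp: bounded_overpartitions_def)
  moreover have "?k \<in># fst p" if "p \<in> ?f ` ?B \<union> ?g ` ?C" for p
    using that by auto
  ultimately have 1: "?A \<inter> (?f ` ?B \<union> ?g ` ?C) = {}"
    by blast
  \<comment> \<open>Being in the image of \<open>?g\<close> is visible on the pair:
    \<open>?k\<close> is overlined and occurs exactly once. After \<open>?f\<close>, an overlined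
    \<open>?k\<close> has at least two copies.\<close>
  have "?k \<in> snd p \<and> count (fst p) ?k = 1" if p: "p \<in> ?g ` ?C" for p
  proof -
    obtain x where x: "x \<in> ?C" "p = ?g x" using p by blast
    obtain M S where "x = (M, S)" by (cases x)
    then have M: "(M, S) \<in> ?C" "p = ?g (M, S)" using x by simp_all
    then have "?k \<notin># M" by (auto simp: bounded_overpartitions_def)
    then show ?thesis using M by (simp add: not_in_iff)
  qed
  moreover have "\<not> (?k \<in> snd p \<and> count (fst p) ?k = 1)" if p: "p \<in> ?f ` ?B" for p
  proof -
    obtain x where x: "x \<in> ?B" "p = ?f x" using p by blast
    obtain M S where "x = (M, S)" by (cases x)
    then have M: "(M, S) \<in> ?B" "p = ?f (M, S)" using x by simp_all
    then have "?k \<in> S \<Longrightarrow> ?k \<in># M" by (auto simp: bounded_overpartitions_def)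
    then show ?thesis using M by (auto simp: not_in_iff)
  qed
  ultimately have 2: "?f ` ?B \<inter> ?g ` ?C = {}"
    by blast
  have f: "card (?f ` ?B) = card ?B"
    by (intro card_image inj_onI) auto
  have g: "card (?g ` ?C) = card ?C"
  proof (intro card_image inj_onI)
    fix x y assume x: "x \<in> ?C" and y: "y \<in> ?C" and eq: "?g x = ?g y"
    have "snd z \<subseteq> {1..m}" if "z \<in> ?C" for z
      using that by (cases z) (simp add: bounded_overpartitions_def, blast)
    then have "?k \<notin> snd x" "?k \<notin> snd y"
      using x y by fastforce+
    then have "fst x = fst y" "snd x = snd y"
      using eq insert_ident[of ?k "snd x" "snd y"] by (simp_all add: case_prod_unfold)
    then show "x = y" by (rule prod_eqI)
  qed
  show ?thesis
    using bounded_overpartitions_Suc[OF assms] card_Un_disjoint[OF _ _ 1] card_Un_disjoint[OF _ _ 2] f g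
    by simp
qed

lemma bounded_overpartitions_0: "bounded_overpartitions 0 n = (if n = 0 then {({#}, {})} else {})"
  unfolding bounded_overpartitions_def by auto

section \<open>Generating functions and Shanks's finite identity\<close>

definition bounded_fps :: "nat \<Rightarrow> complex fps" where
  "bounded_fps m = Abs_fps (\<lambda>n. of_nat (card (bounded_overpartitions m n)))"

definition overpartition_fps :: "complex fps" where
  "overpartition_fps = Abs_fps (\<lambda>n. of_nat (card (overpartitions n)))"

lemma bounded_fps_0: "bounded_fps 0 = 1"
  by (rule fps_ext) (auto simp: bounded_fps_def bounded_overpartitions_0)

lemma bounded_fps_Suc:
  "(1 - fps_X ^ Suc m) * bounded_fps (Suc m) = (1 + fps_X ^ Suc m) * bounded_fps m"
proof (rule fps_ext)
  fix n
  show "fps_nth ((1 - fps_X ^ Suc m) * bounded_fps (Suc m)) n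
      = fps_nth ((1 + fps_X ^ Suc m) * bounded_fps m) n"
    using card_bounded_overpartitions_Suc[of m n] bounded_overpartitions_Suc_less[of n m]
    by (simp add: bounded_fps_def fps_X_power_mult_nth algebra_simps not_le del: power_Suc)
qed

text \<open>
  The finite form of Gauss's identity due to Shanks: the product of the truncated theta series with
  the generating function of overpartitions with parts at most \<open>n\<close> is a sum of \<open>n + 1\<close> terms,
  of which only the first one, namely \<open>1\<close>, has order at most \<open>n\<close>.
\<close>

definition alternating_squares :: "nat \<Rightarrow> complex fps" where
  "alternating_squares n = 1 + 2 * (\<Sum>j=1..n. (-1) ^ j * fps_X ^ (j\<^sup>2))"

text \<open>This is (-1; X)_s / (X; X)_s, the coefficient in the q-binomial theorem: the factor 1 +
  X^0 of the numerator is the 2, and \<open>s = 0\<close> is the empty product.\<close>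

definition shanks_coeff :: "nat \<Rightarrow> complex fps" where
  "shanks_coeff s = (if s = 0 then 1 else 2 * bounded_fps (s - 1) * inverse (1 - fps_X ^ s))"

definition shanks_sum :: "nat \<Rightarrow> complex fps" where
  "shanks_sum n = (\<Sum>s\<le>n. (-1) ^ s * shanks_coeff s * fps_X ^ (s * Suc n))"

lemma shanks_coeff_minus: "shanks_coeff (Suc s) * (1 - fps_X ^ Suc s) = 2 * bounded_fps s"
proof -
  have "inverse (1 - fps_X ^ Suc s) * (1 - fps_X ^ Suc s :: complex fps) = 1"
    by (rule inverse_mult_eq_1) simp
  then show ?thesis by (simp add: shanks_coeff_def mult.assoc del: power_Suc)
qed

lemma shanks_coeff_plus: "shanks_coeff s * (1 + fps_X ^ s) = 2 * bounded_fps s"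
proof (cases s)
  case 0
  then show ?thesis by (simp add: shanks_coeff_def bounded_fps_0)
next
  case (Suc r)
  let ?u = "1 - fps_X ^ Suc r :: complex fps"
  have u: "?u \<noteq> 0" by (metis fps_nonzero_nth fps_sub_nth fps_one_nth fps_X_power_nth diff_zero nat.distinct(1) zero_neq_one)
  have "?u * (shanks_coeff s * (1 + fps_X ^ s)) = (shanks_coeff s * ?u) * (1 + fps_X ^ s)"
    by (simp only: mult_ac)
  also have "\<dots> = 2 * ((1 + fps_X ^ s) * bounded_fps r)"
    unfolding Suc shanks_coeff_minus by (simp only: mult_ac)
  also have "\<dots> = ?u * (2 * bounded_fps s)"
    unfolding Suc bounded_fps_Suc[symmetric] by (simp only: mult_ac)
  finally show ?thesis using u by (metis mult_left_cancel)
qed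

text \<open>Since X^s (1 - X^n) - (1 + X^n) = -(1 - X^s) - X^n (1 + X^s), the summand for s > 0 is a
  multiple of \<open>bounded_fps (s - 1)\<close> plus a multiple of \<open>bounded_fps s\<close>.
  With the alternating sign the latter cancels against the next summand.\<close>

lemma shanks_telescope:
  "(\<Sum>s\<le>r. (-1) ^ s * shanks_coeff s * fps_X ^ (s * n) * (fps_X ^ s * (1 - fps_X ^ n) - (1 + fps_X ^ n)))
    = - 2 * (-1) ^ r * fps_X ^ (Suc r * n) * bounded_fps r"
proof (induction r)
  case 0
  then show ?case by (simp add: shanks_coeff_def bounded_fps_0)
next
  case (Suc r)
  let ?X = "fps_X :: complex fps"
  have "shanks_coeff (Suc r) * (?X ^ Suc r * (1 - ?X ^ n) - (1 + ?X ^ n))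
      = - (shanks_coeff (Suc r) * (1 - ?X ^ Suc r)) - ?X ^ n * (shanks_coeff (Suc r) * (1 + ?X ^ Suc r))"
    by (simp add: algebra_simps del: power_Suc)
  also have "\<dots> = - 2 * bounded_fps r - 2 * ?X ^ n * bounded_fps (Suc r)"
    by (simp only: shanks_coeff_minus shanks_coeff_plus) (simp add: algebra_simps)
  finally have e: "shanks_coeff (Suc r) * (?X ^ Suc r * (1 - ?X ^ n) - (1 + ?X ^ n))
      = - 2 * bounded_fps r - 2 * ?X ^ n * bounded_fps (Suc r)" .
  have "(-1) ^ Suc r * shanks_coeff (Suc r) * ?X ^ (Suc r * n) * (?X ^ Suc r * (1 - ?X ^ n) - (1 + ?X ^ n))
     = (-1) ^ Suc r * ?X ^ (Suc r * n) * (- 2 * bounded_fps r - 2 * ?X ^ n * bounded_fps (Suc r))"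
    unfolding e[symmetric] by (simp only: mult_ac)
  then show ?case
    unfolding sum.atMost_Suc Suc
    by (simp add: algebra_simps power_add)
qed

text \<open>The product of \<open>alternating_squares n\<close> and \<open>bounded_fps n\<close>
  obeys this same recursion: passing to n + 1 multiplies by (1 + X^(n+1)) / (1 - X^(n+1)) and adds
  one square to the theta factor.\<close>

lemma shanks_sum_Suc:
  defines "X \<equiv> fps_X :: complex fps"
  shows "(1 - X ^ Suc n) * shanks_sum (Suc n)
    = (1 + X ^ Suc n) * shanks_sum n + 2 * (-1) ^ Suc n * X ^ ((Suc n)\<^sup>2) * ((1 + X ^ Suc n) * bounded_fps n)"
proof -
  let ?m = "Suc n"
  let ?t = "\<lambda>s. (-1) ^ s * shanks_coeff s :: complex fps"
  have "shanks_sum ?m = (\<Sum>s\<le>n. ?t s * X ^ (s * Suc ?m)) + ?t ?m * X ^ (?m * Suc ?m)"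
    by (simp add: shanks_sum_def X_def)
  then have "(1 - X ^ ?m) * shanks_sum ?m - (1 + X ^ ?m) * shanks_sum n
     = (\<Sum>s\<le>n. ?t s * X ^ (s * ?m) * (X ^ s * (1 - X ^ ?m) - (1 + X ^ ?m)))
       + (-1) ^ ?m * (shanks_coeff ?m * (1 - X ^ ?m)) * X ^ (?m * Suc ?m)"
    unfolding shanks_sum_def X_def[symmetric]
    by (simp add: sum_distrib_left sum_subtractf[symmetric] sum.distrib[symmetric] power_add algebra_simps)
  also have "\<dots> = - 2 * (-1) ^ n * X ^ (?m * ?m) * bounded_fps n
       + (-1) ^ ?m * (2 * bounded_fps n) * X ^ (?m * Suc ?m)"
    unfolding X_def shanks_telescope shanks_coeff_minus ..
  also have "\<dots> = 2 * (-1) ^ ?m * X ^ (?m\<^sup>2) * ((1 + X ^ ?m) * bounded_fps n)"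
    by (simp add: power2_eq_square power_add algebra_simps)
  finally show ?thesis by (simp add: algebra_simps)
qed

lemma alternating_squares_mult_bounded_fps:
  "alternating_squares n * bounded_fps n = shanks_sum n"
proof (induction n)
  case 0
  then show ?case by (simp add: alternating_squares_def bounded_fps_0 shanks_sum_def shanks_coeff_def)
next
  case (Suc n)
  let ?X = "fps_X :: complex fps"
  let ?u = "1 - ?X ^ Suc n"
  have u: "?u \<noteq> 0" by (metis fps_nonzero_nth fps_sub_nth fps_one_nth fps_X_power_nth diff_zero nat.distinct(1) zero_neq_one)
  have S: "alternating_squares (Suc n) = alternating_squares n + 2 * (-1) ^ Suc n * ?X ^ ((Suc n)\<^sup>2)"
    by (simp add: alternating_squares_def algebra_simps)
  have "?u * (alternating_squares (Suc n) * bounded_fps (Suc n))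
      = alternating_squares (Suc n) * (?u * bounded_fps (Suc n))"
    by (simp only: mult_ac)
  also have "\<dots> = (1 + ?X ^ Suc n) * (alternating_squares n * bounded_fps n)
       + 2 * (-1) ^ Suc n * ?X ^ ((Suc n)\<^sup>2) * ((1 + ?X ^ Suc n) * bounded_fps n)"
    unfolding bounded_fps_Suc S by (simp add: algebra_simps del: power_Suc)
  also have "\<dots> = ?u * shanks_sum (Suc n)"
    unfolding Suc shanks_sum_Suc ..
  finally show ?case using u by (metis mult_left_cancel)
qed

text \<open>The number of integers with square \<open>n\<close>.\<close>

definition square_coeff :: "nat \<Rightarrow> int" where
  "square_coeff n = (if n = 0 then 1 else if \<exists>j. n = j\<^sup>2 then 2 else 0)"

definition theta4_fps :: "complex fps" where
  "theta4_fps = Abs_fps (\<lambda>n. of_int ((-1) ^ n * square_coeff n))"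

lemma alternating_squares_nth:
  assumes "i \<le> n"
  shows "fps_nth (alternating_squares n) i = fps_nth theta4_fps i"
proof -
  have m1: "(-1 :: complex fps) ^ j = fps_const ((-1) ^ j)" for j
    by (simp add: fps_const_power[symmetric] fps_const_neg[symmetric] del: fps_const_neg fps_const_power)
  have "fps_nth (alternating_squares n) i
      = (if i = 0 then 1 else 0) + 2 * (\<Sum>j=1..n. (-1) ^ j * (if i = j\<^sup>2 then 1 else 0))"
    by (simp add: alternating_squares_def numeral_fps_const fps_sum_nth m1 cong: if_cong)
  also have "\<dots> = of_int ((-1) ^ i * square_coeff i)"
  proof (cases "\<exists>j. i = j\<^sup>2")
    case False
    then have "i \<noteq> 0" by (metis zero_power2)
    then show ?thesis using False by (simp add: square_coeff_def)
  next
    case True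
    then obtain k where k: "i = k\<^sup>2" by blast
    have "k \<le> n" using assms k by (metis le_trans power2_nat_le_imp_le order_refl)
    show ?thesis
    proof (cases "k = 0")
      case True
      then have *: "(i = j\<^sup>2) = (j = 0)" for j using k by simp
      show ?thesis unfolding * using True k by (simp add: square_coeff_def)
    next
      case False
      have *: "(i = j\<^sup>2) = (j = k)" for j using k by auto
      have "(\<Sum>j=1..n. (-1) ^ j * (if i = j\<^sup>2 then 1 else 0)) = ((-1) ^ k :: complex)"
        unfolding * using False \<open>k \<le> n\<close> by (simp add: if_distrib sum.delta cong: if_cong)
      moreover have "(-1 :: complex) ^ (k\<^sup>2) = (-1) ^ k" by (simp add: minus_one_power_iff)
      ultimately show ?thesis using False k by (auto simp: square_coeff_def)
    qed
  qed
  finally show ?thesis by (simp add: theta4_fps_def)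
qed

text \<open>Coefficient \<open>n\<close> of the product involves only coefficients up to
  \<open>n\<close>, where both factors agree with their truncations at \<open>n\<close>. In
  \<open>shanks_sum n\<close> the terms with s \<ge> 1 are divisible by X^(n+1).\<close>

theorem theta4_mult_overpartition_fps: "theta4_fps * overpartition_fps = 1"
proof (rule fps_ext)
  fix n
  have "fps_nth (theta4_fps * overpartition_fps) n = fps_nth (alternating_squares n * bounded_fps n) n"
    unfolding fps_mult_nth
    by (intro sum.cong)
       (simp_all add: alternating_squares_nth bounded_fps_def overpartition_fps_def bounded_overpartitions_eq)
  also have "\<dots> = fps_nth (shanks_sum n) n"
    by (simp add: alternating_squares_mult_bounded_fps)
  also have "\<dots> = fps_nth 1 n"
  proof -
    have "fps_nth ((-1) ^ s * shanks_coeff s * fps_X ^ (s * Suc n)) n = (if s = 0 then fps_nth 1 n else 0)" for s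
      by (cases s) (auto simp: fps_X_power_mult_right_nth shanks_coeff_def simp del: power_Suc)
    then show ?thesis
      unfolding shanks_sum_def fps_sum_nth by (simp del: fps_one_nth)
  qed
  finally show "fps_nth (theta4_fps * overpartition_fps) n = fps_nth 1 n" .
qed

section \<open>Growth of the overpartition numbers\<close>

text \<open>The factor of part size k is 1 + 2 r^k / (1 - r^k), hence at most exp (2 r^k / (1 - r)),
  so the bound on the product stays finite as m grows. Cutting off at \<open>N\<close> keeps all
  sums finite before any convergence is known.\<close>

lemma bounded_overpartitions_growth:
  fixes r :: real
  assumes r: "0 < r" "r < 1"
  shows "(\<Sum>n\<le>N. card (bounded_overpartitions m n) * r ^ n) \<le> exp (\<Sum>k=1..m. 2 * r ^ k / (1 - r))"
proof (induction m)
  case 0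
  have "(\<Sum>n\<le>N. card (bounded_overpartitions 0 n) * r ^ n) = (\<Sum>n\<in>{0::nat}. 1)"
    by (rule sum.mono_neutral_cong_right) (auto simp: bounded_overpartitions_0)
  then show ?case by simp
next
  case (Suc m)
  let ?k = "Suc m"
  let ?c = "\<lambda>m n. real (card (bounded_overpartitions m n))"
  let ?A = "\<lambda>m. \<Sum>n\<le>N. ?c m n * r ^ n"
  \<comment> \<open>Shifting the index by \<open>?k\<close> under the cutoff at \<open>N\<close>
    only loses nonnegative terms.\<close>
  have shift: "(\<Sum>n\<in>{?k..N}. ?c j (n - ?k) * r ^ n) \<le> r ^ ?k * ?A j" for j
  proof -
    have "(\<Sum>n\<in>{?k..N}. ?c j (n - ?k) * r ^ n) = (\<Sum>n\<in>{?k..N}. r ^ ?k * (?c j (n - ?k) * r ^ (n - ?k)))"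
      by (intro sum.cong) (auto simp: power_add[symmetric] mult.left_commute simp del: power_Suc)
    also have "\<dots> = r ^ ?k * (\<Sum>i\<in>(\<lambda>n. n - ?k) ` {?k..N}. ?c j i * r ^ i)"
      by (subst sum.reindex) (auto simp: sum_distrib_left inj_on_def)
    also have "\<dots> \<le> r ^ ?k * ?A j"
      using r by (intro mult_left_mono sum_mono2) auto
    finally show ?thesis .
  qed
  have "?A ?k = (\<Sum>n\<le>N. ?c m n * r ^ n + (if ?k \<le> n then (?c ?k (n - ?k) + ?c m (n - ?k)) * r ^ n else 0))"
    by (intro sum.cong refl)
       (auto simp: card_bounded_overpartitions_Suc bounded_overpartitions_Suc_less algebra_simps not_le)
  also have "\<dots> = ?A m + (\<Sum>n\<le>N. if ?k \<le> n then (?c ?k (n - ?k) + ?c m (n - ?k)) * r ^ n else 0)"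
    by (rule sum.distrib)
  also have "(\<Sum>n\<le>N. if ?k \<le> n then (?c ?k (n - ?k) + ?c m (n - ?k)) * r ^ n else 0)
      = (\<Sum>n\<in>{?k..N}. ?c ?k (n - ?k) * r ^ n) + (\<Sum>n\<in>{?k..N}. ?c m (n - ?k) * r ^ n)"
    unfolding sum.distrib[symmetric]
    by (intro sum.mono_neutral_cong_right) (auto simp: algebra_simps)
  finally have "?A ?k \<le> ?A m + (r ^ ?k * ?A ?k + r ^ ?k * ?A m)"
    using shift[of ?k] shift[of m] by linarith
  then have "(1 - r ^ ?k) * ?A ?k \<le> (1 + r ^ ?k) * ?A m" by (simp add: algebra_simps)
  moreover have rk: "0 < r ^ ?k" "r ^ ?k \<le> r" "r ^ ?k < 1"
    using r power_decreasing[of 1 ?k r] power_Suc_less_one[of r m] by (auto simp del: power_Suc)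
  ultimately have "?A ?k \<le> (1 + r ^ ?k) / (1 - r ^ ?k) * ?A m"
    by (simp add: field_simps del: power_Suc)
  also have "(1 + r ^ ?k) / (1 - r ^ ?k) = 1 + 2 * r ^ ?k / (1 - r ^ ?k)"
    using rk by (simp add: field_simps del: power_Suc)
  also have "\<dots> \<le> exp (2 * r ^ ?k / (1 - r))"
  proof -
    have "2 * r ^ ?k / (1 - r ^ ?k) \<le> 2 * r ^ ?k / (1 - r)"
      using rk r by (intro divide_left_mono) auto
    then show ?thesis using exp_ge_add_one_self[of "2 * r ^ ?k / (1 - r)"] by linarith
  qed
  also have "exp (2 * r ^ ?k / (1 - r)) * ?A m \<le> exp (2 * r ^ ?k / (1 - r)) * exp (\<Sum>k=1..m. 2 * r ^ k / (1 - r))"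
    using Suc by (intro mult_left_mono) auto
  finally show ?case
    using r by (simp add: exp_add mult_ac sum_nonneg mult_right_mono del: power_Suc)
qed

lemma overpartition_fps_conv_radius: "fps_conv_radius overpartition_fps \<ge> 1"
  unfolding fps_conv_radius_def
proof (rule conv_radius_geI_ex')
  fix r :: real assume r: "0 < r" "ereal r < 1"
  then have r1: "r < 1" by simp
  have "(\<Sum>i<n. card (overpartitions i) * r ^ i) \<le> exp (2 / (1 - r) * (r / (1 - r)))" for n
  proof -
    \<comment> \<open>For i < n a bound \<open>n\<close> on the parts is no restriction, and the
      estimate obtained from it is independent of \<open>n\<close>.\<close>
    have "(\<Sum>i<n. card (overpartitions i) * r ^ i) = (\<Sum>i<n. card (bounded_overpartitions n i) * r ^ i)"
      by (intro sum.cong) (auto simp: bounded_overpartitions_eq)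
    also have "\<dots> \<le> (\<Sum>i\<le>n. card (bounded_overpartitions n i) * r ^ i)"
      using r by (intro sum_mono2) auto
    also have "\<dots> \<le> exp (\<Sum>k=1..n. 2 * r ^ k / (1 - r))"
      using bounded_overpartitions_growth[OF r(1) r1] .
    also have "(\<Sum>k=1..n. 2 * r ^ k / (1 - r)) = 2 / (1 - r) * (\<Sum>k=1..n. r ^ k)"
      by (simp add: sum_distrib_left)
    also have "exp (2 / (1 - r) * (\<Sum>k=1..n. r ^ k)) \<le> exp (2 / (1 - r) * (r / (1 - r)))"
    proof -
      have "(\<Sum>k=1..n. r ^ k) = r * (\<Sum>k<n. r ^ k)"
        unfolding sum_distrib_left
        by (rule sum.reindex_bij_witness[of _ Suc "\<lambda>k. k - 1"]) (auto simp flip: power_Suc)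
      also have "\<dots> \<le> r * (1 / (1 - r))"
        using r r1 by (intro mult_left_mono) (auto simp: sum_gp_strict field_simps)
      finally show ?thesis
        using r1 by (subst exp_le_cancel_iff, intro mult_left_mono) auto
    qed
    finally show ?thesis .
  qed
  then have "summable (\<lambda>n. card (overpartitions n) * r ^ n)"
    using r by (intro bounded_imp_summable) (auto simp: lessThan_Suc_atMost[symmetric] simp del: sum.lessThan_Suc)
  then have "summable (\<lambda>n. complex_of_real (card (overpartitions n) * r ^ n))"
    by (rule summable_of_real)
  then show "summable (\<lambda>n. fps_nth overpartition_fps n * of_real r ^ n)"
    by (simp add: overpartition_fps_def)
qed

section \<open>Poisson summation for Gaussians\<close>

text \<open>The integral is the real part of the characteristic function of the standard normal
  law.\<close>

lemma std_normal_cos_integral: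
  shows "integrable lborel (\<lambda>x. std_normal_density x * cos (s * x))"
    and "(LINT x|lborel. std_normal_density x * cos (s * x)) = exp (- s\<^sup>2 / 2)"
proof -
  have int: "integrable lborel (\<lambda>x. std_normal_density x)"
    using integrable_std_normal_moment[of 0] by simp
  show "integrable lborel (\<lambda>x. std_normal_density x * cos (s * x))"
    by (rule Bochner_Integration.integrable_bound[OF int])
       (auto simp: abs_mult intro!: AE_I2 mult_left_le)
  have cint: "integrable lborel (\<lambda>x. std_normal_density x *\<^sub>R iexp (s * x))"
    by (rule Bochner_Integration.integrable_bound[OF int])
       (auto simp: norm_mult simp del: of_real_mult intro!: AE_I2)
  have "exp (- s\<^sup>2 / 2) = Re (char std_normal_distribution s)"
    by (simp add: char_std_normal_distribution)
  also have "char std_normal_distribution s = (LINT x|lborel. std_normal_density x *\<^sub>R iexp (s * x))"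
    unfolding char_def by (subst integral_density) auto
  also have "Re \<dots> = (LINT x|lborel. Re (std_normal_density x *\<^sub>R iexp (s * x)))"
    using cint by (rule integral_Re[symmetric])
  also have "\<dots> = (LINT x|lborel. std_normal_density x * cos (s * x))"
    by (intro Bochner_Integration.integral_cong) (auto simp: Re_exp)
  finally show "(LINT x|lborel. std_normal_density x * cos (s * x)) = exp (- s\<^sup>2 / 2)" ..
qed

lemma gaussian_cos_integral:
  fixes t s :: real
  assumes t: "t > 0"
  shows "integrable lborel (\<lambda>x. exp (- pi * x\<^sup>2 / t) * cos (2 * pi * s * x))"
    and "(LINT x|lborel. exp (- pi * x\<^sup>2 / t) * cos (2 * pi * s * x)) = sqrt t * exp (- pi * s\<^sup>2 * t)"
proof -
  \<comment> \<open>Scaling by \<open>c\<close> turns the exponent x^2 / 2 of the normal density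
    into pi x^2 / t; \<open>r\<close> compensates the scaling in the frequency.\<close>
  define c where "c = sqrt (2 * pi / t)"
  define r where "r = 2 * pi * s / c"
  have c: "c > 0" "c\<^sup>2 = 2 * pi / t" using t by (auto simp: c_def)
  have rc: "r * c = 2 * pi * s" using c by (simp add: r_def)
  have r2: "r\<^sup>2 / 2 = pi * s\<^sup>2 * t"
    using t by (simp add: r_def power_divide c(2) power_mult_distrib field_simps) (simp add: power2_eq_square)
  have *: "std_normal_density (0 + c * x) * cos (r * (0 + c * x))
      = 1 / sqrt (2 * pi) * (exp (- pi * x\<^sup>2 / t) * cos (2 * pi * s * x))" for x
  proof -
    have "(c * x)\<^sup>2 / 2 = pi * x\<^sup>2 / t" using c t by (simp add: power_mult_distrib field_simps)
    moreover have "cos (r * (c * x)) = cos (2 * pi * s * x)" using rc by (simp only: mult.assoc[symmetric])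
    ultimately show ?thesis
      by (simp add: std_normal_density_def)
  qed
  have "integrable lborel (\<lambda>x. 1 / sqrt (2 * pi) * (exp (- pi * x\<^sup>2 / t) * cos (2 * pi * s * x)))"
    using lborel_integrable_real_affine[OF std_normal_cos_integral(1)[of r], of c 0] c
    unfolding * by simp
  then show "integrable lborel (\<lambda>x. exp (- pi * x\<^sup>2 / t) * cos (2 * pi * s * x))"
    using integrable_mult_right_iff[of lborel "\<lambda>x. exp (- pi * x\<^sup>2 / t) * cos (2 * pi * s * x)" "1 / sqrt (2 * pi)"]
    by simp
  have "exp (- r\<^sup>2 / 2) = c * (1 / sqrt (2 * pi) * (LINT x|lborel. exp (- pi * x\<^sup>2 / t) * cos (2 * pi * s * x)))"
    using lborel_integral_real_affine[of c "\<lambda>x. std_normal_density x * cos (r * x)" 0] c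
    unfolding * std_normal_cos_integral(2) by simp
  moreover have "c / sqrt (2 * pi) = 1 / sqrt t"
    by (simp add: c_def real_sqrt_divide)
  moreover have "- r\<^sup>2 / 2 = - pi * s\<^sup>2 * t" using r2 by simp
  ultimately have "exp (- pi * s\<^sup>2 * t) = 1 / sqrt t * (LINT x|lborel. exp (- pi * x\<^sup>2 / t) * cos (2 * pi * s * x))"
    by (metis (no_types, lifting) mult.assoc times_divide_eq_right mult.right_neutral)
  then show "(LINT x|lborel. exp (- pi * x\<^sup>2 / t) * cos (2 * pi * s * x)) = sqrt t * exp (- pi * s\<^sup>2 * t)"
    using t by (simp add: field_simps)
qed

section \<open>From the real line to periodic functions\<close>

lemma integral_symmetric_tendsto_lborel:
  fixes f :: "real \<Rightarrow> real"
  assumes f: "integrable lborel f"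
  shows "(\<lambda>N. integral {- real N..real N} f) \<longlonglongrightarrow> (LINT x|lborel. f x)"
proof -
  have "(\<lambda>N. LINT x|lborel. indicator {- real N..real N} x *\<^sub>R f x) \<longlonglongrightarrow> (LINT x|lborel. f x)"
  proof (rule integral_dominated_convergence[where w = "\<lambda>x. \<bar>f x\<bar>"])
    show "AE x in lborel. (\<lambda>N. indicator {- real N..real N} x *\<^sub>R f x) \<longlonglongrightarrow> f x"
    proof (rule AE_I2)
      fix x
      have "eventually (\<lambda>N. indicator {- real N..real N} x *\<^sub>R f x = f x) sequentially"
        using eventually_ge_at_top[of "nat \<lceil>\<bar>x\<bar>\<rceil>"]
        by eventually_elim (auto simp: indicator_def abs_le_iff)
      then show "(\<lambda>N. indicator {- real N..real N} x *\<^sub>R f x) \<longlonglongrightarrow> f x"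
        by (rule tendsto_eventually)
    qed
  qed (use f in \<open>auto intro!: AE_I2 simp: indicator_def\<close>)
  moreover have "(LINT x|lborel. indicator {- real N..real N} x *\<^sub>R f x) = integral {- real N..real N} f" for N
  proof -
    have "set_integrable lborel {- real N..real N} f"
      unfolding set_integrable_def using f by (intro integrable_mult_indicator) auto
    from set_borel_integral_eq_integral(2)[OF this] show ?thesis
      by (simp add: set_lebesgue_integral_def)
  qed
  ultimately show ?thesis by simp
qed

text \<open>Unfolding: translating each [k, k + 1] to [0, 1] turns the integral over the line into
  that of the periodisation. The pieces of [-N, N] are those with k from -N to N - 1, hence the
  half-open index set.\<close>

lemma integral_eq_sum_unit_intervals:
  fixes f :: "real \<Rightarrow> real"
  assumes f: "continuous_on UNIV f"
  shows "integral {- real N..real N} f = integral {0..1} (\<lambda>x. \<Sum>k\<in>{- int N..<int N}. f (of_int k + x))"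
proof -
  have shift: "integral {of_int k..of_int k + 1} f = integral {0..1} (\<lambda>x. f (of_int k + x))" for k :: int
    using integral_shift[of 0 "of_int k" 1 f] continuous_on_subset[OF f] by (simp add: add.commute o_def)
  have "integral {- real N..real N} f = (\<Sum>k\<in>{- int N..<int N}. integral {of_int k..of_int k + 1} f)"
  proof -
    have "integral {- real N..- real N + real M} f = (\<Sum>k\<in>{- int N..<- int N + int M}. integral {of_int k..of_int k + 1} f)" for M
    proof (induction M)
      case (Suc M)
      have "{- int N..<- int N + int (Suc M)} = insert (- int N + int M) {- int N..<- int N + int M}" by auto
      moreover have "integral {- real N..- real N + real (Suc M)} f
         = integral {- real N..- real N + real M} f + integral {- real N + real M..- real N + real M + 1} f"
        by (subst Henstock_Kurzweil_Integration.integral_combine)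
           (auto intro!: integrable_continuous_real continuous_on_subset[OF f] simp: add_ac)
      ultimately show ?case using Suc by simp
    qed simp
    from this[of "2 * N"] show ?thesis by simp
  qed
  also have "\<dots> = integral {0..1} (\<lambda>x. \<Sum>k\<in>{- int N..<int N}. f (of_int k + x))"
    unfolding shift
    by (rule integral_sum[symmetric])
       (auto intro!: integrable_continuous_real continuous_intros continuous_on_compose2[OF f])
  finally show ?thesis .
qed

text \<open>An even periodic function is a function of \<open>cos (2 \<pi> x)\<close>, to which Weierstrass's theorem applies.\<close>

lemma even_periodic_fourier_unique:
  fixes D :: "real \<Rightarrow> real"
  assumes cont: "continuous_on UNIV D" and per: "\<And>x. D (x + 1) = D x" and even: "\<And>x. D (- x) = D x"
    and zero: "\<And>m::nat. integral {0..1} (\<lambda>x. D x * cos (2 * pi * real m * x)) = 0"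
  shows "D x = 0"
proof -
  have contD [continuous_intros]: "continuous_on A (\<lambda>x. D (f x))" if "continuous_on A f" for A f
    using continuous_on_compose2[OF cont that] by auto
  \<comment> \<open>The product formula trades one factor cos (2 pi x) for the two neighbouring
    frequencies, so vanishing cosine coefficients make D orthogonal to every polynomial in cos (2 pi
    x).\<close>
  have pow: "integral {0..1} (\<lambda>x. D x * cos (2 * pi * x) ^ n * cos (2 * pi * real m * x)) = 0" for n m
  proof (induction n arbitrary: m)
    case 0
    then show ?case using zero by simp
  next
    case (Suc n)
    show ?case
    proof (cases m)
      case 0
      then show ?thesis using Suc[of 1] by (simp add: mult_ac)
    next
      case m: (Suc k)
      have "D x * cos (2 * pi * x) ^ Suc n * cos (2 * pi * real m * x)
        = (D x * cos (2 * pi * x) ^ n * cos (2 * pi * real k * x)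
           + D x * cos (2 * pi * x) ^ n * cos (2 * pi * real (Suc m) * x)) / 2" for x
      proof -
        have "cos (2 * pi * x) * cos (2 * pi * real m * x)
           = (cos (2 * pi * real m * x - 2 * pi * x) + cos (2 * pi * real m * x + 2 * pi * x)) / 2"
          by (simp add: cos_add cos_diff)
        also have "2 * pi * real m * x - 2 * pi * x = 2 * pi * real k * x" by (simp add: m algebra_simps)
        also have "2 * pi * real m * x + 2 * pi * x = 2 * pi * real (Suc m) * x" by (simp add: algebra_simps)
        finally have "cos (2 * pi * x) * cos (2 * pi * real m * x)
           = (cos (2 * pi * real k * x) + cos (2 * pi * real (Suc m) * x)) / 2" .
        then have "D x * cos (2 * pi * x) ^ n * (cos (2 * pi * x) * cos (2 * pi * real m * x))
           = D x * cos (2 * pi * x) ^ n * ((cos (2 * pi * real k * x) + cos (2 * pi * real (Suc m) * x)) / 2)"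
          by (rule arg_cong)
        then show ?thesis by (simp only: power_Suc2 ring_distribs mult.assoc add_divide_distrib times_divide_eq_right)
      qed
      then have "integral {0..1} (\<lambda>x. D x * cos (2 * pi * x) ^ Suc n * cos (2 * pi * real m * x))
        = integral {0..1} (\<lambda>x. (D x * cos (2 * pi * x) ^ n * cos (2 * pi * real k * x)
           + D x * cos (2 * pi * x) ^ n * cos (2 * pi * real (Suc m) * x)) / 2)"
        by (intro arg_cong[of _ _ "integral {0..1}"] ext)
      also have "\<dots> = (integral {0..1} (\<lambda>x. D x * cos (2 * pi * x) ^ n * cos (2 * pi * real k * x))
           + integral {0..1} (\<lambda>x. D x * cos (2 * pi * x) ^ n * cos (2 * pi * real (Suc m) * x))) / 2"
        unfolding integral_divide
        by (subst Henstock_Kurzweil_Integration.integral_add)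
           (auto intro!: integrable_continuous_real continuous_intros)
      also have "\<dots> = 0" unfolding Suc by simp
      finally show ?thesis .
    qed
  qed
  \<comment> \<open>D as a function of y = cos (2 pi x): \<open>arccos\<close> covers x in [0, 1/2],
    and the other half follows from D (1 - x) = D x.\<close>
  define E where "E = (\<lambda>y. D (arccos y / (2 * pi)))"
  have E: "E (cos (2 * pi * x)) = D x" if "x \<in> {0..1}" for x
  proof (cases "x \<le> 1 / 2")
    case True
    then have "arccos (cos (2 * pi * x)) = 2 * pi * x"
      using that by (intro arccos_cos) auto
    then show ?thesis by (simp add: E_def)
  next
    case False
    have "cos (2 * pi * x) = cos (2 * pi * (1 - x))"
      by (simp add: right_diff_distrib cos_diff)
    moreover have "arccos (cos (2 * pi * (1 - x))) = 2 * pi * (1 - x)"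
      using that False by (intro arccos_cos) (auto simp: field_simps)
    moreover have "D (1 - x) = D x" using per[of "- x"] even[of x] by (simp add: add.commute)
    ultimately show ?thesis by (simp add: E_def)
  qed
  have contE: "continuous_on {-1..1} E"
    unfolding E_def by (intro continuous_intros) auto
  obtain B where B: "\<And>x. x \<in> {0..1} \<Longrightarrow> \<bar>D x\<bar> \<le> B"
    using compact_imp_bounded[OF compact_continuous_image[OF continuous_on_subset[OF cont] compact_Icc, of 0 1]]
    unfolding bounded_iff by fastforce
  have B0: "B \<ge> 0" using B[of 0] by auto
  \<comment> \<open>For a polynomial \<open>p\<close> close to \<open>E\<close>, write D^2 = D (E -
    p) + D p; the last term integrates to 0.\<close>
  have le: "integral {0..1} (\<lambda>x. D x * D x) \<le> B * e" if e: "e > 0" for e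
  proof -
    obtain p where p: "real_polynomial_function p" "\<And>y. y \<in> {-1..1} \<Longrightarrow> \<bar>E y - p y\<bar> < e"
      using Stone_Weierstrass_real_polynomial_function[OF compact_Icc contE e] by blast
    then obtain a n where a: "p = (\<lambda>y. \<Sum>i\<le>n. a i * y ^ i)"
      by (auto simp: real_polynomial_function_iff_sum)
    have "integral {0..1} (\<lambda>x. D x * p (cos (2 * pi * x)))
       = integral {0..1} (\<lambda>x. \<Sum>i\<le>n. a i * (D x * cos (2 * pi * x) ^ i * cos (2 * pi * real 0 * x)))"
      by (simp add: a sum_distrib_left mult_ac)
    also have "\<dots> = (\<Sum>i\<le>n. a i * integral {0..1} (\<lambda>x. D x * cos (2 * pi * x) ^ i * cos (2 * pi * real 0 * x)))"
      by (subst integral_sum) (auto intro!: integrable_continuous_real continuous_intros)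
    also have "\<dots> = 0" unfolding pow by simp
    finally have 0: "integral {0..1} (\<lambda>x. D x * p (cos (2 * pi * x))) = 0" .
    have cp: "continuous_on {0..1} (\<lambda>x. p (cos (2 * pi * x)))"
      unfolding a by (intro continuous_intros)
    have "integral {0..1} (\<lambda>x. D x * D x) = integral {0..1} (\<lambda>x. D x * D x - D x * p (cos (2 * pi * x)))"
      using 0 by (subst Henstock_Kurzweil_Integration.integral_diff)
        (auto intro!: integrable_continuous_real continuous_intros cp)
    also have "\<dots> \<le> integral {0..1} (\<lambda>x::real. B * e)"
    proof (rule integral_le)
      fix x :: real assume x: "x \<in> {0..1}"
      have "D x * D x - D x * p (cos (2 * pi * x)) = D x * (E (cos (2 * pi * x)) - p (cos (2 * pi * x)))"
        unfolding E[OF x] by (simp add: algebra_simps)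
      also have "\<dots> \<le> \<bar>D x\<bar> * \<bar>E (cos (2 * pi * x)) - p (cos (2 * pi * x))\<bar>"
        by (metis abs_ge_self abs_mult)
      also have "\<dots> \<le> B * e"
        using B[OF x] B0 p(2)[of "cos (2 * pi * x)"] by (intro mult_mono) auto
      finally show "D x * D x - D x * p (cos (2 * pi * x)) \<le> B * e" .
    qed (auto intro!: integrable_continuous_real continuous_intros cp)
    finally show ?thesis by simp
  qed
  have int0: "integral {0..1} (\<lambda>x. D x * D x) \<le> 0"
  proof (rule field_le_epsilon)
    fix e :: real assume "e > 0"
    then have "B * (e / (B + 1)) \<le> e" using B0 by (simp add: field_simps)
    then show "integral {0..1} (\<lambda>x. D x * D x) \<le> 0 + e"
      using le[of "e / (B + 1)"] B0 \<open>e > 0\<close> by simp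
  qed
  have contDD: "continuous_on {0..1} (\<lambda>x. D x * D x)" by (intro continuous_intros)
  moreover have "integral {0..1} (\<lambda>x. D x * D x) \<ge> 0"
    using integrable_continuous_real[OF contDD] by (rule integral_nonneg) simp
  ultimately have "integral {0..1} (\<lambda>x. D x * D x) = 0" using int0 by linarith
  then have D0: "D x = 0" if "x \<in> {0..1}" for x
    using integral_eq_0_iff[of 0 1 "\<lambda>x. D x * D x"] that contDD by auto
  have per_nat: "D (x + real n) = D x" for x n
  proof (induction n)
    case (Suc n)
    have "x + real (Suc n) = x + real n + 1" by simp
    then show ?case using per[of "x + real n"] Suc by (simp only:)
  qed simp
  have per_int: "D (x + of_int k) = D x" for x k
  proof (cases "k \<ge> 0")
    case True
    then show ?thesis using per_nat[of x "nat k"] by simp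
  next
    case False
    then show ?thesis using per_nat[of "x + of_int k" "nat (- k)"] by simp
  qed
  have "D x = D (frac x + of_int \<lfloor>x\<rfloor>)" by (simp add: frac_def)
  also have "\<dots> = D (frac x)" by (rule per_int)
  also have "\<dots> = 0" using frac_lt_1[of x] by (intro D0) (auto intro: less_imp_le)
  finally show ?thesis .
qed

section \<open>Gaussian sums over the integers and Poisson summation\<close>

lemma summable_on_int_geometric:
  fixes r :: real
  assumes "0 \<le> r" "r < 1"
  shows "(\<lambda>k::int. r ^ nat \<bar>k\<bar>) summable_on UNIV"
proof -
  have "summable (\<lambda>n. norm (r ^ n))" using assms by (simp add: summable_geometric)
  then have geo: "(\<lambda>n::nat. r ^ n) summable_on UNIV"
    using norm_summable_imp_summable_on by blast
  have "(\<lambda>k::int. r ^ nat \<bar>k\<bar>) summable_on (int ` UNIV)"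
    by (subst summable_on_reindex) (use geo in \<open>auto simp: o_def\<close>)
  moreover have "(\<lambda>k::int. r ^ nat \<bar>k\<bar>) summable_on ((\<lambda>n. - int n) ` UNIV)"
    by (subst summable_on_reindex) (use geo in \<open>auto simp: o_def inj_on_def\<close>)
  ultimately have "(\<lambda>k::int. r ^ nat \<bar>k\<bar>) summable_on (int ` UNIV \<union> (\<lambda>n. - int n) ` UNIV)"
    by (rule summable_on_union)
  moreover have "int ` UNIV \<union> (\<lambda>n. - int n) ` UNIV = UNIV"
  proof -
    have "k \<in> int ` UNIV \<union> (\<lambda>n. - int n) ` UNIV" for k
      by (cases "k \<ge> 0") (auto intro: rev_image_eqI[of "nat k"] rev_image_eqI[of "nat (- k)"])
    then show ?thesis by blast
  qed
  ultimately show ?thesis by simp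
qed

text \<open>A geometric majorant in \<bar>k\<bar>, uniform for \<bar>x\<bar> \<le> R. It comes from
  y^2 \<ge> \<bar>y\<bar> - 1 at y = k + x together with \<bar>k\<bar> \<le> \<bar>k + x\<bar> +
  R.\<close>

definition gauss_bound :: "real \<Rightarrow> real \<Rightarrow> int \<Rightarrow> real" where
  "gauss_bound c R k = exp (c * (R + 1)) * exp (- c) ^ nat \<bar>k\<bar>"

lemma gauss_bound:
  fixes c R x :: real
  assumes "c \<ge> 0" "\<bar>x\<bar> \<le> R"
  shows "exp (- c * (of_int k + x)\<^sup>2) \<le> gauss_bound c R k"
proof -
  have sq: "y\<^sup>2 \<ge> \<bar>y\<bar> - 1" for y :: real
    using zero_le_power2[of "\<bar>y\<bar> - 1/2"] by (simp add: power2_eq_square algebra_simps)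
  have "real (nat \<bar>k\<bar>) = \<bar>of_int k\<bar>" by simp
  also have "\<dots> \<le> \<bar>of_int k + x\<bar> + R" using assms(2) by linarith
  also have "\<dots> \<le> (of_int k + x)\<^sup>2 + 1 + R" using sq[of "of_int k + x"] by linarith
  finally have "c * real (nat \<bar>k\<bar>) \<le> c * ((of_int k + x)\<^sup>2 + 1 + R)"
    using assms(1) by (rule mult_left_mono)
  then show ?thesis
    unfolding gauss_bound_def exp_of_nat_mult[symmetric] exp_add[symmetric] exp_le_cancel_iff
    by (simp add: algebra_simps)
qed

lemma summable_on_gauss_bound: "c > 0 \<Longrightarrow> gauss_bound c R summable_on UNIV"
  unfolding gauss_bound_def by (intro summable_on_cmult_right summable_on_int_geometric) auto

text \<open>Links unordered sums over the integers with the partial sums that match the 2 N unit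
  intervals of [-N, N].\<close>

lemma filterlim_symmetric_int_intervals:
  "filterlim (\<lambda>N. {- int N..<int N}) (finite_subsets_at_top UNIV) sequentially"
  unfolding filterlim_finite_subsets_at_top
proof (intro allI impI)
  fix X :: "int set" assume X: "finite X \<and> X \<subseteq> UNIV"
  obtain b where b: "\<And>x. x \<in> X \<Longrightarrow> \<bar>x\<bar> \<le> b"
    using X Max_ge[of "abs ` X"] by (metis finite_imageI imageI)
  show "\<forall>\<^sub>F N in sequentially. finite {- int N..<int N} \<and> X \<subseteq> {- int N..<int N} \<and> {- int N..<int N} \<subseteq> UNIV"
    using eventually_gt_at_top[of "nat b"]
  proof eventually_elim
    case (elim N)
    then show ?case using b by (fastforce simp: abs_le_iff)
  qed
qed

lemma has_integral_cos_int:
  "((\<lambda>x. cos (2 * pi * of_int i * x)) has_integral (if i = 0 then 1 else 0)) {0..1::real}"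
proof (cases "i = 0")
  case True
  then show ?thesis using has_integral_const_real[of 1 0 1] by simp
next
  case False
  let ?F = "\<lambda>x. sin (2 * pi * of_int i * x) / (2 * pi * of_int i)"
  have "((\<lambda>x. cos (2 * pi * of_int i * x)) has_integral (?F 1 - ?F 0)) {0..1}"
    using False
    by (intro fundamental_theorem_of_calculus)
       (auto intro!: derivative_eq_intros simp: has_real_derivative_iff_has_vector_derivative[symmetric])
  moreover have "sin (2 * pi * of_int i) = 0" by (metis sin_int_2pin mult.commute)
  ultimately show ?thesis using False by simp
qed

text \<open>By the product formula the frequencies j - m and j + m each contribute one half; for j =
  m = 0 both halves occur and add up to 1.\<close>

lemma has_integral_cos_mult_cos:
  fixes j :: int and m :: nat
  shows "((\<lambda>x. cos (2 * pi * of_int j * x) * cos (2 * pi * real m * x))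
     has_integral ((if j = int m then 1 / 2 else 0) + (if j = - int m then 1 / 2 else 0))) {0..1}"
proof -
  have "((\<lambda>x. (cos (2 * pi * of_int (j - int m) * x) + cos (2 * pi * of_int (j + int m) * x)) / 2)
     has_integral (((if j - int m = 0 then 1 else 0) + (if j + int m = 0 then 1 else 0)) / 2)) {0..1::real}"
    by (intro has_integral_divide has_integral_add has_integral_cos_int)
  moreover have "(cos (2 * pi * of_int (j - int m) * x) + cos (2 * pi * of_int (j + int m) * x)) / 2
      = cos (2 * pi * of_int j * x) * cos (2 * pi * real m * x)" for x
    by (simp add: ring_distribs cos_add cos_diff)
  moreover have "((if j - int m = 0 then 1 else 0) + (if j + int m = 0 then 1 else 0)) / 2
      = (if j = int m then 1 / 2 else 0) + (if j = - int m then 1 / 2 else (0::real))"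
    by auto
  ultimately show ?thesis by (simp only:)
qed

lemma uniform_limit_symmetric_int_sums:
  fixes f :: "int \<Rightarrow> real \<Rightarrow> real"
  assumes "\<And>k x. x \<in> A \<Longrightarrow> \<bar>f k x\<bar> \<le> M k" and "M summable_on UNIV"
  shows "uniform_limit A (\<lambda>N x. \<Sum>k\<in>{- int N..<int N}. f k x) (\<lambda>x. \<Sum>\<^sub>\<infinity>k. f k x) sequentially"
proof -
  have "uniform_limit A (\<lambda>X x. \<Sum>k\<in>X. f k x) (\<lambda>x. \<Sum>\<^sub>\<infinity>k. f k x) (finite_subsets_at_top UNIV)"
    using assms by (intro Weierstrass_m_test_general) auto
  then show ?thesis
    using filterlim_symmetric_int_intervals by (rule filterlim_compose)
qed

lemma continuous_on_infsum_int:
  fixes f :: "int \<Rightarrow> real \<Rightarrow> real"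
  assumes cont: "\<And>k. continuous_on UNIV (f k)"
    and bound: "\<And>k x R. \<bar>x\<bar> \<le> R \<Longrightarrow> \<bar>f k x\<bar> \<le> M R k" and sum: "\<And>R. M R summable_on UNIV"
  shows "continuous_on UNIV (\<lambda>x. \<Sum>\<^sub>\<infinity>k. f k x)"
proof (rule continuous_at_imp_continuous_on, rule ballI)
  fix x :: real
  define R where "R = \<bar>x\<bar> + 1"
  have "uniform_limit {-R..R} (\<lambda>N x. \<Sum>k\<in>{- int N..<int N}. f k x) (\<lambda>x. \<Sum>\<^sub>\<infinity>k. f k x) sequentially"
    using bound[of _ R] sum[of R] by (intro uniform_limit_symmetric_int_sums[of _ f "M R"]) auto
  then have "continuous_on {-R..R} (\<lambda>x. \<Sum>\<^sub>\<infinity>k. f k x)"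
    by (intro uniform_limit_theorem[of _ "\<lambda>N x. \<Sum>k\<in>{- int N..<int N}. f k x"])
       (auto intro!: always_eventually continuous_on_sum continuous_on_subset[OF cont])
  then show "isCont (\<lambda>x. \<Sum>\<^sub>\<infinity>k. f k x) x"
    by (rule continuous_on_interior) (auto simp: R_def)
qed

lemma integral_infsum_int_tendsto:
  fixes f :: "int \<Rightarrow> real \<Rightarrow> real"
  assumes "\<And>k. continuous_on {0..1} (f k)"
    and "\<And>k x. x \<in> {0..1} \<Longrightarrow> \<bar>f k x\<bar> \<le> M k" and "M summable_on UNIV"
  shows "(\<lambda>N. integral {0..1} (\<lambda>x. \<Sum>k\<in>{- int N..<int N}. f k x))
      \<longlonglongrightarrow> integral {0..1} (\<lambda>x. \<Sum>\<^sub>\<infinity>k. f k x)"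
proof -
  obtain I J where "\<And>N. ((\<lambda>x. \<Sum>k\<in>{- int N..<int N}. f k x) has_integral I N) {0..1}"
    "((\<lambda>x. \<Sum>\<^sub>\<infinity>k. f k x) has_integral J) {0..1}" "I \<longlonglongrightarrow> J"
  proof (rule uniform_limit_integral)
    show "uniform_limit {0..1} (\<lambda>N x. \<Sum>k\<in>{- int N..<int N}. f k x) (\<lambda>x. \<Sum>\<^sub>\<infinity>k. f k x) sequentially"
      by (rule uniform_limit_symmetric_int_sums[OF assms(2,3)])
    show "continuous_on {0..1} (\<lambda>x. \<Sum>k\<in>{- int N..<int N}. f k x)" for N
      by (intro continuous_on_sum assms(1))
  qed auto
  moreover from this have "I = (\<lambda>N. integral {0..1} (\<lambda>x. \<Sum>k\<in>{- int N..<int N}. f k x))"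
    by (intro ext) (metis integral_unique)
  ultimately show ?thesis by (simp add: integral_unique)
qed

text \<open>The difference D of the two sides is continuous, even and 1-periodic, so it suffices to
  compare cosine coefficients. On the left, unfolding gives the Fourier transform of the Gaussian;
  on the right, orthogonality leaves the frequencies m and -m.\<close>

theorem gauss_poisson_real:
  fixes t x :: real
  assumes t: "t > 0"
  shows "(\<Sum>\<^sub>\<infinity>k::int. exp (- pi * (of_int k + x)\<^sup>2 / t))
       = sqrt t * (\<Sum>\<^sub>\<infinity>m::int. exp (- pi * (of_int m)\<^sup>2 * t) * cos (2 * pi * of_int m * x))"
proof -
  define f where "f = (\<lambda>(k::int) x. exp (- pi * (of_int k + x)\<^sup>2 / t))"
  define h where "h = (\<lambda>(k::int) x. exp (- pi * (of_int k)\<^sup>2 * t) * cos (2 * pi * of_int k * x))"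
  define D where "D = (\<lambda>x. (\<Sum>\<^sub>\<infinity>k. f k x) - sqrt t * (\<Sum>\<^sub>\<infinity>k. h k x))"
  have f_le: "\<bar>f k x\<bar> \<le> gauss_bound (pi / t) R k" if "\<bar>x\<bar> \<le> R" for k x R
    using gauss_bound[of "pi / t" x R k] that t by (simp add: f_def)
  have h_le: "\<bar>h k x\<bar> \<le> gauss_bound (pi * t) 0 k" for k x
  proof -
    have "\<bar>h k x\<bar> \<le> exp (- (pi * t) * (of_int k + 0)\<^sup>2)"
      by (simp add: h_def abs_mult mult_ac mult_left_le_one_le)
    also have "\<dots> \<le> gauss_bound (pi * t) 0 k" using t by (intro gauss_bound) auto
    finally show ?thesis .
  qed
  have cf: "continuous_on A (f k)" and ch: "continuous_on A (h k)" for A k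
    unfolding f_def h_def using t by (auto intro!: continuous_intros)
  have sf: "gauss_bound (pi / t) R summable_on UNIV" and sh: "gauss_bound (pi * t) R summable_on UNIV" for R
    using t by (auto intro!: summable_on_gauss_bound)
  have Cf: "continuous_on UNIV (\<lambda>x. \<Sum>\<^sub>\<infinity>k. f k x)"
    by (rule continuous_on_infsum_int[OF cf f_le sf])
  have Ch: "continuous_on UNIV (\<lambda>x. \<Sum>\<^sub>\<infinity>k. h k x)"
    by (rule continuous_on_infsum_int[OF ch h_le sh])
  have cos_le: "\<bar>a * cos y\<bar> \<le> \<bar>a\<bar>" for a y :: real
    by (simp add: abs_mult mult_left_le)
  \<comment> \<open>Uniform convergence permits termwise integration. The cosine factor has period
    1, so the pieces assemble to one Gaussian integral over [-N, N].\<close>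
  have If: "integral {0..1} (\<lambda>x. (\<Sum>\<^sub>\<infinity>k. f k x) * cos (2 * pi * real m * x)) = sqrt t * exp (- pi * (real m)\<^sup>2 * t)" for m
  proof (rule LIMSEQ_unique)
    let ?G = "\<lambda>x. exp (- pi * x\<^sup>2 / t) * cos (2 * pi * real m * x)"
    have "(\<lambda>N. integral {0..1} (\<lambda>x. \<Sum>k\<in>{- int N..<int N}. f k x * cos (2 * pi * real m * x)))
      \<longlonglongrightarrow> integral {0..1} (\<lambda>x. \<Sum>\<^sub>\<infinity>k. f k x * cos (2 * pi * real m * x))"
      by (rule integral_infsum_int_tendsto[where M = "gauss_bound (pi / t) 1"])
         (auto intro!: continuous_intros cf sf order_trans[OF cos_le f_le])
    then show "(\<lambda>N. integral {0..1} (\<lambda>x. \<Sum>k\<in>{- int N..<int N}. f k x * cos (2 * pi * real m * x)))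
      \<longlonglongrightarrow> integral {0..1} (\<lambda>x. (\<Sum>\<^sub>\<infinity>k. f k x) * cos (2 * pi * real m * x))"
      by (simp add: infsum_cmult_left')
    have "f k x * cos (2 * pi * real m * x) = ?G (of_int k + x)" for k x
    proof -
      have "cos (2 * pi * real m * (of_int k + x)) = cos (2 * pi * real m * x + of_int (int m * k) * (2 * pi))"
        by (simp add: algebra_simps)
      also have "\<dots> = cos (2 * pi * real m * x)"
        unfolding cos_add using cos_int_2pin[of "int m * k"] sin_int_2pin[of "int m * k"]
        by (simp only: mult.commute[of "of_int _"])
      finally show ?thesis by (simp add: f_def)
    qed
    then have "integral {0..1} (\<lambda>x. \<Sum>k\<in>{- int N..<int N}. f k x * cos (2 * pi * real m * x))
        = integral {- real N..real N} ?G" for N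
      using t by (subst integral_eq_sum_unit_intervals) (auto intro!: continuous_intros)
    then show "(\<lambda>N. integral {0..1} (\<lambda>x. \<Sum>k\<in>{- int N..<int N}. f k x * cos (2 * pi * real m * x)))
      \<longlonglongrightarrow> sqrt t * exp (- pi * (real m)\<^sup>2 * t)"
      using integral_symmetric_tendsto_lborel[OF gaussian_cos_integral(1)[OF t, of "real m"]]
      unfolding gaussian_cos_integral(2)[OF t] by simp
  qed
  have Ih: "integral {0..1} (\<lambda>x. (\<Sum>\<^sub>\<infinity>k. h k x) * cos (2 * pi * real m * x)) = exp (- pi * (real m)\<^sup>2 * t)" for m
  proof (rule LIMSEQ_unique)
    have "(\<lambda>N. integral {0..1} (\<lambda>x. \<Sum>k\<in>{- int N..<int N}. h k x * cos (2 * pi * real m * x)))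
      \<longlonglongrightarrow> integral {0..1} (\<lambda>x. \<Sum>\<^sub>\<infinity>k. h k x * cos (2 * pi * real m * x))"
      by (rule integral_infsum_int_tendsto[where M = "gauss_bound (pi * t) 0"])
         (auto intro!: continuous_intros ch sh order_trans[OF cos_le h_le])
    then show "(\<lambda>N. integral {0..1} (\<lambda>x. \<Sum>k\<in>{- int N..<int N}. h k x * cos (2 * pi * real m * x)))
      \<longlonglongrightarrow> integral {0..1} (\<lambda>x. (\<Sum>\<^sub>\<infinity>k. h k x) * cos (2 * pi * real m * x))"
      by (simp add: infsum_cmult_left')
    \<comment> \<open>\<open>N > m\<close> puts both \<open>int m\<close> and \<open>- int m\<close>
      into the half-open interval; each contributes one half.\<close>
    have "integral {0..1} (\<lambda>x. \<Sum>k\<in>{- int N..<int N}. h k x * cos (2 * pi * real m * x)) = exp (- pi * (real m)\<^sup>2 * t)"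
      if N: "N > m" for N
    proof -
      have "((\<lambda>x. \<Sum>k\<in>{- int N..<int N}. exp (- pi * (of_int k)\<^sup>2 * t) * (cos (2 * pi * of_int k * x) * cos (2 * pi * real m * x)))
        has_integral (\<Sum>k\<in>{- int N..<int N}. exp (- pi * (of_int k)\<^sup>2 * t) *
           ((if k = int m then 1 / 2 else 0) + (if k = - int m then 1 / 2 else 0)))) {0..1}"
        by (intro has_integral_sum has_integral_mult_right has_integral_cos_mult_cos) auto
      then have "integral {0..1} (\<lambda>x. \<Sum>k\<in>{- int N..<int N}. h k x * cos (2 * pi * real m * x))
        = (\<Sum>k\<in>{- int N..<int N}. exp (- pi * (of_int k)\<^sup>2 * t) *
           ((if k = int m then 1 / 2 else 0) + (if k = - int m then 1 / 2 else 0)))"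
        by (simp add: h_def mult_ac integral_unique)
      also have "\<dots> = exp (- pi * (real m)\<^sup>2 * t) / 2 + exp (- pi * (real m)\<^sup>2 * t) / 2"
        unfolding ring_distribs sum.distrib if_distrib[of "\<lambda>y. exp _ * y"]
        using N by (simp add: sum.delta cong: if_cong)
      finally show ?thesis by simp
    qed
    then show "(\<lambda>N. integral {0..1} (\<lambda>x. \<Sum>k\<in>{- int N..<int N}. h k x * cos (2 * pi * real m * x)))
      \<longlonglongrightarrow> exp (- pi * (real m)\<^sup>2 * t)"
      by (intro tendsto_eventually eventually_mono[OF eventually_gt_at_top[of m]]) auto
  qed
  have "D x = 0"
  proof (rule even_periodic_fourier_unique[of D])
    show "continuous_on UNIV D" unfolding D_def by (intro continuous_intros Cf Ch)
    show "D (x + 1) = D x" for x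
    proof -
      have "(\<Sum>\<^sub>\<infinity>k. f k (x + 1)) = (\<Sum>\<^sub>\<infinity>k. f k x)"
        by (rule infsum_reindex_bij_witness[of UNIV "\<lambda>k. k - 1" "\<lambda>k. k + 1"]) (auto simp: f_def add_ac)
      moreover have "h k (x + 1) = h k x" for k
        unfolding h_def ring_distribs cos_add using cos_int_2pin[of k] sin_int_2pin[of k] by simp
      ultimately show ?thesis by (simp add: D_def)
    qed
    show "D (- x) = D x" for x
    proof -
      have "(of_int (- k) + x)\<^sup>2 = (of_int k - x)\<^sup>2" for k
        by (simp add: power2_eq_square algebra_simps)
      then have "(\<Sum>\<^sub>\<infinity>k. f k (- x)) = (\<Sum>\<^sub>\<infinity>k. f k x)"
        by (intro infsum_reindex_bij_witness[of UNIV "\<lambda>k. - k" "\<lambda>k. - k"]) (auto simp: f_def)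
      then show ?thesis by (simp add: D_def h_def)
    qed
    show "integral {0..1} (\<lambda>x. D x * cos (2 * pi * real m * x)) = 0" for m :: nat
    proof -
      have "integral {0..1} (\<lambda>x. D x * cos (2 * pi * real m * x))
         = integral {0..1} (\<lambda>x. (\<Sum>\<^sub>\<infinity>k. f k x) * cos (2 * pi * real m * x)
              - sqrt t * ((\<Sum>\<^sub>\<infinity>k. h k x) * cos (2 * pi * real m * x)))"
        by (simp add: D_def algebra_simps)
      also have "\<dots> = 0"
        by (subst Henstock_Kurzweil_Integration.integral_diff)
           (auto intro!: integrable_continuous_real continuous_intros continuous_on_subset[OF Cf] continuous_on_subset[OF Ch] simp: If Ih)
      finally show ?thesis .
    qed
  qed
  then show ?thesis by (simp add: D_def f_def h_def)
qed

section \<open>Gaussian series on the upper half-plane\<close>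

text \<open>Inversion exchanges a shift \<alpha> with the coefficients cis (2 pi m \<alpha>), so
  both are parameters.\<close>

definition gauss_series :: "(int \<Rightarrow> complex) \<Rightarrow> real \<Rightarrow> complex \<Rightarrow> complex" where
  "gauss_series c \<alpha> \<tau> = (\<Sum>\<^sub>\<infinity>k. c k * exp (pi * \<i> * (of_int k + of_real \<alpha>)\<^sup>2 * \<tau>))"

lemma norm_gauss_series_term:
  "norm (exp (pi * \<i> * (of_int k + of_real \<alpha>)\<^sup>2 * \<tau>)) = exp (- (pi * Im \<tau>) * (of_int k + \<alpha>)\<^sup>2)"
proof -
  have "complex_of_real pi * \<i> * (of_int k + of_real \<alpha>)\<^sup>2 * \<tau> = \<i> * (of_real (pi * (of_int k + \<alpha>)\<^sup>2) * \<tau>)"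
    by simp
  then have "Re (complex_of_real pi * \<i> * (of_int k + of_real \<alpha>)\<^sup>2 * \<tau>) = - (pi * (of_int k + \<alpha>)\<^sup>2 * Im \<tau>)"
    by (simp only: Re_i_times) (simp add: mult_ac flip: of_real_power of_real_add of_real_mult)
  then show ?thesis unfolding norm_exp_eq_Re by (simp add: mult_ac)
qed

lemma gauss_series_term_bound:
  assumes "norm (c k) \<le> 1" "0 \<le> y" "y \<le> Im \<tau>"
  shows "norm (c k * exp (pi * \<i> * (of_int k + of_real \<alpha>)\<^sup>2 * \<tau>)) \<le> gauss_bound (pi * y) \<bar>\<alpha>\<bar> k"
proof -
  have "norm (c k * exp (pi * \<i> * (of_int k + of_real \<alpha>)\<^sup>2 * \<tau>)) \<le> exp (- (pi * Im \<tau>) * (of_int k + \<alpha>)\<^sup>2)"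
    unfolding norm_mult norm_gauss_series_term using assms(1) by (simp add: mult_left_le_one_le)
  also have "\<dots> \<le> exp (- (pi * y) * (of_int k + \<alpha>)\<^sup>2)"
    using assms by (simp add: mult_right_mono)
  also have "\<dots> \<le> gauss_bound (pi * y) \<bar>\<alpha>\<bar> k"
    using assms by (intro gauss_bound) auto
  finally show ?thesis .
qed

lemma gauss_series_summable:
  assumes "\<And>k. norm (c k) \<le> 1" "Im \<tau> > 0"
  shows "(\<lambda>k. c k * exp (pi * \<i> * (of_int k + of_real \<alpha>)\<^sup>2 * \<tau>)) summable_on UNIV"
proof (rule abs_summable_summable)
  show "(\<lambda>k. norm (c k * exp (pi * \<i> * (of_int k + of_real \<alpha>)\<^sup>2 * \<tau>))) summable_on UNIV"
    by (rule summable_on_comparison_test[OF summable_on_gauss_bound[of "pi * Im \<tau>" "\<bar>\<alpha>\<bar>"]])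
       (use assms in \<open>auto intro!: gauss_series_term_bound\<close>)
qed

lemma gauss_series_holomorphic:
  assumes "\<And>k. norm (c k) \<le> 1"
  shows "gauss_series c \<alpha> holomorphic_on {\<tau>. Im \<tau> > 0}"
proof -
  have "\<exists>e>0. gauss_series c \<alpha> holomorphic_on ball z e" if "Im z > 0" for z
  proof -
    \<comment> \<open>On the closed disc of radius \<open>y\<close> about \<open>z\<close> imaginary
      parts stay at least \<open>y\<close>, so one \<open>gauss_bound\<close> dominates
      there.\<close>
    define y where "y = Im z / 2"
    have y: "y > 0" using that by (simp add: y_def)
    let ?f = "\<lambda>k \<tau>. c k * exp (pi * \<i> * (of_int k + of_real \<alpha>)\<^sup>2 * \<tau>)"
    have "y \<le> Im \<tau>" if "\<tau> \<in> cball z y" for \<tau>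
      using that abs_Im_le_cmod[of "z - \<tau>"] by (auto simp: y_def dist_norm)
    then have "uniform_limit (cball z y) (\<lambda>X \<tau>. \<Sum>k\<in>X. ?f k \<tau>) (\<lambda>\<tau>. \<Sum>\<^sub>\<infinity>k. ?f k \<tau>) (finite_subsets_at_top UNIV)"
      using y assms
      by (intro Weierstrass_m_test_general[where M = "gauss_bound (pi * y) \<bar>\<alpha>\<bar>"])
         (auto intro!: gauss_series_term_bound summable_on_gauss_bound)
    then have "(\<lambda>\<tau>. \<Sum>\<^sub>\<infinity>k. ?f k \<tau>) holomorphic_on ball z y"
      by (rule holomorphic_uniform_limit[rotated])
         (auto intro!: always_eventually continuous_intros holomorphic_intros)
    then show ?thesis using y unfolding gauss_series_def by blast
  qed
  then have "gauss_series c \<alpha> analytic_on {\<tau>. Im \<tau> > 0}"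
    by (auto simp: analytic_on_def)
  then show ?thesis by (rule analytic_imp_holomorphic)
qed

lemma infsum_of_real:
  fixes f :: "'a \<Rightarrow> real"
  shows "(\<Sum>\<^sub>\<infinity>x\<in>A. of_real (f x)) = (of_real (\<Sum>\<^sub>\<infinity>x\<in>A. f x) :: complex)"
proof (cases "f summable_on A")
  case True
  then show ?thesis by (intro infsumI has_sum_of_real has_sum_infsum)
next
  case False
  then have "\<not> (\<lambda>x. complex_of_real (f x)) summable_on A"
    using summable_on_Re by fastforce
  with False show ?thesis by (simp add: infsum_not_exists)
qed

lemma gauss_series_inversion_imag:
  fixes t \<alpha> :: real
  assumes t: "t > 0"
  shows "gauss_series (\<lambda>_. 1) \<alpha> (\<i> / t) = sqrt t * gauss_series (\<lambda>m. cis (2 * pi * of_int m * \<alpha>)) 0 (\<i> * t)"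
proof -
  let ?g = "\<lambda>m::int. exp (- pi * (of_int m)\<^sup>2 * t)"
  have L: "gauss_series (\<lambda>_. 1) \<alpha> (\<i> / t) = (\<Sum>\<^sub>\<infinity>k::int. of_real (exp (- pi * (of_int k + \<alpha>)\<^sup>2 / t)))"
  proof -
    have "complex_of_real pi * \<i> * (of_int k + of_real \<alpha>)\<^sup>2 * (\<i> / of_real t)
        = (\<i> * \<i>) * of_real (pi * (of_int k + \<alpha>)\<^sup>2 / t)" for k :: int
      by (simp add: mult_ac)
    then have "complex_of_real pi * \<i> * (of_int k + of_real \<alpha>)\<^sup>2 * (\<i> / of_real t)
        = of_real (- pi * (of_int k + \<alpha>)\<^sup>2 / t)" for k :: int
      by simp
    then show ?thesis unfolding gauss_series_def by (simp only: exp_of_real mult_1)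
  qed
  have trm: "cis (2 * pi * of_int m * \<alpha>) * exp (pi * \<i> * (of_int m + of_real 0)\<^sup>2 * (\<i> * t))
      = cis (2 * pi * of_int m * \<alpha>) * of_real (?g m)" for m
  proof -
    have "complex_of_real pi * \<i> * (of_int m + of_real 0)\<^sup>2 * (\<i> * of_real t)
        = (\<i> * \<i>) * of_real (pi * (of_int m)\<^sup>2 * t)"
      by (simp add: mult_ac)
    then have "complex_of_real pi * \<i> * (of_int m + of_real 0)\<^sup>2 * (\<i> * of_real t)
        = of_real (- pi * (of_int m)\<^sup>2 * t)"
      by simp
    then show ?thesis by (simp only: exp_of_real)
  qed
  let ?h = "\<lambda>m::int. cis (2 * pi * of_int m * \<alpha>) * of_real (?g m)"
  have sum: "?h summable_on UNIV"
    using gauss_series_summable[of "\<lambda>m. cis (2 * pi * of_int m * \<alpha>)" "\<i> * t" 0] t unfolding trm by simp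
  have sum': "(\<lambda>m. ?h (- m)) summable_on UNIV"
    using summable_on_reindex_bij_betw[of uminus UNIV UNIV ?h] sum by (simp add: bij_uminus)
  have "(\<Sum>\<^sub>\<infinity>m. ?h m) = (\<Sum>\<^sub>\<infinity>m. ?h (- m))"
    using infsum_reindex_bij_betw[of uminus UNIV UNIV ?h] by (simp add: bij_uminus)
  \<comment> \<open>Averaging over m and -m turns the characters into the cosines of the real
    formula.\<close>
  then have "2 * (\<Sum>\<^sub>\<infinity>m. ?h m) = (\<Sum>\<^sub>\<infinity>m. ?h m) + (\<Sum>\<^sub>\<infinity>m. ?h (- m))" by simp
  also have "\<dots> = (\<Sum>\<^sub>\<infinity>m. ?h m + ?h (- m))"
    by (rule infsum_add[symmetric, OF sum sum'])
  also have "\<dots> = (\<Sum>\<^sub>\<infinity>m. 2 * of_real (?g m * cos (2 * pi * of_int m * \<alpha>)))"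
    by (intro infsum_cong) (simp add: complex_eq_iff)
  also have "\<dots> = 2 * (\<Sum>\<^sub>\<infinity>m. of_real (?g m * cos (2 * pi * of_int m * \<alpha>)))"
    by (rule infsum_cmult_right')
  finally have "gauss_series (\<lambda>m. cis (2 * pi * of_int m * \<alpha>)) 0 (\<i> * t)
     = (\<Sum>\<^sub>\<infinity>m::int. of_real (?g m * cos (2 * pi * of_int m * \<alpha>)))"
    unfolding gauss_series_def trm by simp
  then show ?thesis
    unfolding L infsum_of_real gauss_poisson_real[OF t] by simp
qed

text \<open>The holomorphic square root of \<tau> / \<i> with positive real part, the automorphy
  factor of theta under inversion. On the half-plane the argument avoids the branch cut of
  \<open>csqrt\<close>.\<close>

definition csq :: "complex \<Rightarrow> complex" where "csq \<tau> = csqrt (- \<i> * \<tau>)"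

lemma csq_holomorphic: "csq holomorphic_on {\<tau>. Im \<tau> > 0}"
proof -
  have "- \<i> * \<tau> \<notin> \<real>\<^sub>\<le>\<^sub>0" if "Im \<tau> > 0" for \<tau>
    using that unfolding complex_nonpos_Reals_iff by simp
  then show ?thesis
    unfolding csq_def by (intro holomorphic_intros) auto
qed

text \<open>Both sides are holomorphic in \<sigma> and agree on the positive imaginary axis, where
  the formula is Poisson summation.\<close>

theorem gauss_series_inversion:
  assumes "Im \<sigma> > 0"
  shows "gauss_series (\<lambda>_. 1) \<alpha> (- 1 / \<sigma>) = csq \<sigma> * gauss_series (\<lambda>m. cis (2 * pi * of_int m * \<alpha>)) 0 \<sigma>"
proof -
  let ?H = "{\<tau>. Im \<tau> > 0}"
  let ?f = "\<lambda>\<sigma>. gauss_series (\<lambda>_. 1) \<alpha> (- 1 / \<sigma>) - csq \<sigma> * gauss_series (\<lambda>m. cis (2 * pi * of_int m * \<alpha>)) 0 \<sigma>"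
  have "?f \<sigma> = 0"
  proof (rule analytic_continuation[of ?f ?H "(\<lambda>t. \<i> * of_real t) ` {0<..}" \<i>])
    have "(gauss_series (\<lambda>_. 1) \<alpha> \<circ> (\<lambda>\<sigma>. - 1 / \<sigma>)) holomorphic_on ?H"
      by (rule holomorphic_on_compose_gen[OF _ gauss_series_holomorphic])
         (auto intro!: holomorphic_intros simp: Im_divide divide_neg_pos divide_pos_pos sum_power2_gt_zero_iff)
    then show "?f holomorphic_on ?H"
      unfolding o_def by (intro holomorphic_intros csq_holomorphic gauss_series_holomorphic) auto
    show "open ?H" by (rule open_halfspace_Im_gt)
    show "connected ?H" by (rule convex_connected[OF convex_halfspace_Im_gt])
    show "\<i> islimpt (\<lambda>t. \<i> * of_real t) ` {0<..}"
      unfolding islimpt_approachable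
    proof (intro allI impI)
      fix e :: real assume "e > 0"
      then show "\<exists>x'\<in>(\<lambda>t. \<i> * of_real t) ` {0<..}. x' \<noteq> \<i> \<and> dist x' \<i> < e"
        by (intro bexI[of _ "\<i> * of_real (1 + e / 2)"]) (auto simp: dist_norm ring_distribs norm_mult complex_eq_iff)
    qed
    fix z assume "z \<in> (\<lambda>t. \<i> * of_real t) ` {0<..}"
    then obtain t where t: "z = \<i> * of_real t" "t > 0" by auto
    have "- 1 / z = \<i> / t" using t by (simp add: field_simps)
    moreover have "csq z = sqrt t" 
    proof -
      have "- \<i> * z = of_real t" using t by (simp add: mult.assoc[symmetric])
      then show ?thesis unfolding csq_def using t by (simp only: of_real_sqrt less_imp_le)
    qed
    ultimately show "?f z = 0"
      using gauss_series_inversion_imag[OF t(2)] t by simp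
  qed (use assms in auto)
  then show ?thesis by simp
qed

lemma csq_unique: "b\<^sup>2 = - \<i> * \<tau> \<Longrightarrow> Re b > 0 \<Longrightarrow> csq \<tau> = b"
  unfolding csq_def by (intro csqrt_unique disjI1)

lemma csq_power2 [simp]: "(csq \<tau>)\<^sup>2 = - \<i> * \<tau>"
  unfolding csq_def by (rule power2_csqrt)

lemma Re_csq_pos: "Im \<tau> > 0 \<Longrightarrow> Re (csq \<tau>) > 0"
proof -
  assume "Im \<tau> > 0"
  then have "0 < cmod (- \<i> * \<tau>) + Re (- \<i> * \<tau>)"
    using norm_ge_zero[of "- \<i> * \<tau>"] by (simp add: add_nonneg_pos)
  then show ?thesis unfolding csq_def csqrt.sel by simp
qed

section \<open>Gauss sums and the theta function\<close>

definition unity_root :: "nat \<Rightarrow> int \<Rightarrow> complex" where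
  "unity_root N k = cis (2 * pi * of_int k / of_nat N)"

lemma norm_unity_root [simp]: "norm (unity_root N k) = 1"
  by (simp add: unity_root_def)

lemma unity_root_add: "unity_root N (j + k) = unity_root N j * unity_root N k"
  by (simp add: unity_root_def cis_mult add_divide_distrib ring_distribs)

lemma unity_root_0 [simp]: "unity_root N 0 = 1"
  by (simp add: unity_root_def)

lemma unity_root_eq_1_iff:
  assumes "N > 0"
  shows "unity_root N k = 1 \<longleftrightarrow> int N dvd k"
proof
  assume "unity_root N k = 1"
  then have "cos (2 * pi * of_int k / of_nat N) = 1"
    by (simp add: unity_root_def complex_eq_iff)
  then obtain n :: int where "2 * pi * of_int k / of_nat N = real_of_int n * 2 * pi"
    using cos_one_2pi_int by blast
  then have "2 * pi * of_int k = (2 * pi) * (of_int n * of_nat N)"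
    using assms by (simp add: field_simps)
  then have "real_of_int k = of_int n * of_nat N"
    by (subst (asm) mult_left_cancel) auto
  then have "real_of_int k = of_int (n * int N)" by simp
  then have "k = n * int N" by (simp only: of_int_eq_iff)
  then show "int N dvd k" by simp
next
  assume "int N dvd k"
  then obtain j where "k = int N * j" ..
  then have "2 * pi * of_int k / of_nat N = 2 * pi * of_int j" using assms by simp
  then show "unity_root N k = 1" by (simp only: unity_root_def) (simp add: cis_multiple_2pi)
qed

lemma unity_root_cong:
  assumes "N > 0" "[j = k] (mod int N)"
  shows "unity_root N j = unity_root N k"
proof -
  have "int N dvd j - k" using assms(2) by (simp add: cong_iff_dvd_diff)
  then have "unity_root N (j - k) = 1" using assms(1) by (simp add: unity_root_eq_1_iff)
  then show ?thesis using unity_root_add[of N "j - k" k] by simp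
qed

text \<open>A self-map of a finite residue system that is injective modulo N permutes it.\<close>

lemma sum_mod_reindex:
  fixes f :: "int \<Rightarrow> 'a::comm_monoid_add"
  assumes N: "N > 0" and per: "\<And>a. f (a mod N) = f a"
    and inj: "\<And>a b. [p a = p b] (mod N) \<Longrightarrow> [a = b] (mod N)"
  shows "(\<Sum>a\<in>{0..<N}. f (p a)) = (\<Sum>a\<in>{0..<N}. f a)"
proof -
  have "inj_on (\<lambda>a. p a mod N) {0..<N}"
  proof (rule inj_onI)
    fix a b assume ab: "a \<in> {0..<N}" "b \<in> {0..<N}" "p a mod N = p b mod N"
    then have "[p a = p b] (mod N)" unfolding cong_iff_dvd_diff by (simp add: mod_eq_dvd_iff)
    then have "[a = b] (mod N)" by (rule inj)
    then show "a = b" using ab by (intro cong_less_imp_eq_int[of a N b]) auto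
  qed
  moreover have "(\<lambda>a. p a mod N) ` {0..<N} \<subseteq> {0..<N}" using N by auto
  ultimately have "bij_betw (\<lambda>a. p a mod N) {0..<N} {0..<N}"
    by (simp add: bij_betw_def endo_inj_surj)
  from sum.reindex_bij_betw[OF this, of f] show ?thesis by (simp add: per)
qed

lemma sum_unity_root:
  assumes "N > 0"
  shows "(\<Sum>d\<in>{0..<int N}. unity_root N (d * k)) = (if int N dvd k then of_nat N else 0)"
proof (cases "int N dvd k")
  case True
  then have "unity_root N (d * k) = 1" for d using assms by (simp add: unity_root_eq_1_iff)
  then show ?thesis using True by simp
next
  case False
  let ?S = "\<Sum>d\<in>{0..<int N}. unity_root N (d * k)"
  have "(\<Sum>d\<in>{0..<int N}. unity_root N ((d + 1) * k)) = ?S"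
  proof (rule sum_mod_reindex[where p = "\<lambda>d. d + 1"])
    show "unity_root N (a mod int N * k) = unity_root N (a * k)" for a
      using assms by (intro unity_root_cong) (auto intro!: cong_mult simp: cong_def)
  qed (use assms in \<open>auto simp: cong_add_rcancel\<close>)
  moreover have "(\<Sum>d\<in>{0..<int N}. unity_root N ((d + 1) * k)) = unity_root N k * ?S"
    by (simp add: ring_distribs unity_root_add sum_distrib_left mult.commute)
  ultimately have "(unity_root N k - 1) * ?S = 0" by (simp add: algebra_simps)
  moreover have "unity_root N k - 1 \<noteq> 0" using False assms by (simp add: unity_root_eq_1_iff)
  ultimately show ?thesis using False by simp
qed

definition gauss_sum :: "nat \<Rightarrow> int \<Rightarrow> complex" where
  "gauss_sum N c = (\<Sum>a\<in>{0..<int N}. unity_root N (c * a\<^sup>2))"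

lemma gauss_sum_1 [simp]: "gauss_sum (Suc 0) c = 1"
proof -
  have "{0..<int (Suc 0)} = {0}" by auto
  then show ?thesis unfolding gauss_sum_def by simp
qed

lemma gauss_sum_complete_square:
  assumes N: "N > 0" and cc: "[4 * c * c' = -1] (mod int N)"
  shows "(\<Sum>a\<in>{0..<int N}. unity_root N (c * a\<^sup>2 + m * a)) = unity_root N (c' * m\<^sup>2) * gauss_sum N c"
proof -
  \<comment> \<open>As \<open>c'\<close> is -1 / (4 c) modulo \<open>N\<close>, this
    \<open>b\<close> satisfies 2 c b = m and c b^2 = - c' m^2 modulo \<open>N\<close>.\<close>
  define b where "b = - 2 * c' * m"
  obtain k where k: "4 * c * c' - -1 = int N * k"
    using cc unfolding cong_iff_dvd_diff dvd_def by blast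
  then have k': "4 * c * c' = int N * k - 1" by simp
  have eq: "unity_root N (c * a\<^sup>2 + m * a) = unity_root N (c' * m\<^sup>2) * unity_root N (c * (a + b)\<^sup>2)" for a
  proof -
    have "c' * m\<^sup>2 + c * (a + b)\<^sup>2 - (c * a\<^sup>2 + m * a)
       = (4 * c * c' + 1) * (c' * m\<^sup>2) - (4 * c * c' + 1) * (m * a)"
      unfolding b_def by (simp add: power2_eq_square algebra_simps)
    also have "\<dots> = int N * (k * (c' * m\<^sup>2) - k * (m * a))"
      unfolding k' by (simp add: algebra_simps)
    finally have "[c' * m\<^sup>2 + c * (a + b)\<^sup>2 = c * a\<^sup>2 + m * a] (mod int N)"
      unfolding cong_iff_dvd_diff by simp
    from unity_root_cong[OF N this] show ?thesis by (simp add: unity_root_add)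
  qed
  have "(\<Sum>a\<in>{0..<int N}. unity_root N (c * (a + b)\<^sup>2)) = gauss_sum N c"
    unfolding gauss_sum_def
  proof (rule sum_mod_reindex[where p = "\<lambda>a. a + b"])
    show "unity_root N (c * (a mod int N)\<^sup>2) = unity_root N (c * a\<^sup>2)" for a
      using N by (intro unity_root_cong cong_mult cong_pow) (auto simp: cong_def)
  qed (use N in \<open>auto simp: cong_add_rcancel\<close>)
  then show ?thesis unfolding eq sum_distrib_left[symmetric] by simp
qed

lemma gauss_sum_times_4:
  assumes "odd N"
  shows "gauss_sum N (4 * c) = gauss_sum N c"
proof -
  have N: "N > 0" using assms by (rule odd_pos)
  have "(\<Sum>a\<in>{0..<int N}. unity_root N (c * (2 * a)\<^sup>2)) = gauss_sum N c"
    unfolding gauss_sum_def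
  proof (rule sum_mod_reindex[where p = "\<lambda>a. 2 * a"])
    show "unity_root N (c * (a mod int N)\<^sup>2) = unity_root N (c * a\<^sup>2)" for a
      using N by (intro unity_root_cong cong_mult cong_pow) (auto simp: cong_def)
    show "[a = b] (mod int N)" if "[2 * a = 2 * b] (mod int N)" for a b
      using that assms by (subst (asm) cong_mult_lcancel) (auto simp: coprime_commute)
  qed (use N in auto)
  then show ?thesis by (simp add: gauss_sum_def power2_eq_square mult_ac)
qed

text \<open>Averaging over the shifts a \<mapsto> a + l b multiplies the term of a by a sum of l-th
  roots of unity, which vanishes unless l divides a. The l remaining residues contribute 1
  each.\<close>

lemma gauss_sum_square:
  assumes l: "odd l" and c: "coprime c (int l)"
  shows "gauss_sum (l\<^sup>2) c = of_nat l"
proof -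
  have l0: "l > 0" using l by (rule odd_pos)
  have N0: "l\<^sup>2 > 0" using l0 by simp
  let ?z = "unity_root (l\<^sup>2)"
  have shift: "(\<Sum>a\<in>{0..<int (l\<^sup>2)}. ?z (c * a\<^sup>2) * unity_root l (b * (2 * c * a))) = gauss_sum (l\<^sup>2) c" for b
  proof -
    have "(\<Sum>a\<in>{0..<int (l\<^sup>2)}. ?z (c * (a + int l * b)\<^sup>2)) = gauss_sum (l\<^sup>2) c"
      unfolding gauss_sum_def
    proof (rule sum_mod_reindex[where p = "\<lambda>a. a + int l * b"])
      show "?z (c * (a mod int (l\<^sup>2))\<^sup>2) = ?z (c * a\<^sup>2)" for a
        using N0 by (intro unity_root_cong cong_mult cong_pow) (auto simp: cong_def)
    qed (use l0 in \<open>auto simp: cong_add_rcancel\<close>)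
    moreover have "?z (c * (a + int l * b)\<^sup>2) = ?z (c * a\<^sup>2) * unity_root l (b * (2 * c * a))" for a
    proof -
      have "[c * (a + int l * b)\<^sup>2 = c * a\<^sup>2 + int l * (b * (2 * c * a))] (mod int (l\<^sup>2))"
      proof -
        have "c * (a + int l * b)\<^sup>2 - (c * a\<^sup>2 + int l * (b * (2 * c * a))) = int (l\<^sup>2) * (c * b\<^sup>2)"
          by (simp add: power2_eq_square algebra_simps)
        then show ?thesis unfolding cong_iff_dvd_diff by simp
      qed
      moreover have "?z (int l * k) = unity_root l k" for k
        using l0 by (simp add: unity_root_def power2_eq_square mult_ac)
      ultimately show ?thesis using unity_root_cong[OF N0] by (metis unity_root_add)
    qed
    ultimately show ?thesis by simp
  qed
  have dvd: "int l dvd 2 * c * a \<longleftrightarrow> int l dvd a" for a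
  proof -
    have "coprime (int l) (2 * c)" using l c by (simp add: coprime_commute)
    then show ?thesis by (simp add: coprime_dvd_mult_right_iff)
  qed
  have "of_nat l * gauss_sum (l\<^sup>2) c
     = (\<Sum>b\<in>{0..<int l}. \<Sum>a\<in>{0..<int (l\<^sup>2)}. ?z (c * a\<^sup>2) * unity_root l (b * (2 * c * a)))"
    unfolding shift by simp
  also have "\<dots> = (\<Sum>a\<in>{0..<int (l\<^sup>2)}. ?z (c * a\<^sup>2) * (\<Sum>b\<in>{0..<int l}. unity_root l (b * (2 * c * a))))"
    unfolding sum_distrib_left by (rule sum.swap)
  also have "\<dots> = (\<Sum>a\<in>{0..<int (l\<^sup>2)}. if int l dvd a then of_nat l else 0)"
  proof (intro sum.cong refl)
    fix a
    have "?z (c * a\<^sup>2) = 1" if "int l dvd a"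
      using that N0 by (subst unity_root_eq_1_iff) (auto simp: dvd_power_same)
    then show "?z (c * a\<^sup>2) * (\<Sum>b\<in>{0..<int l}. unity_root l (b * (2 * c * a))) = (if int l dvd a then of_nat l else 0)"
      unfolding sum_unity_root[OF l0] dvd by simp
  qed
  also have "\<dots> = of_nat l * of_nat (card {a \<in> {0..<int (l\<^sup>2)}. int l dvd a})"
    by (simp add: sum.If_cases Int_def mult.commute)
  also have "{a \<in> {0..<int (l\<^sup>2)}. int l dvd a} = (\<lambda>j. int l * j) ` {0..<int l}"
  proof (intro equalityI subsetI)
    fix a assume "a \<in> {a \<in> {0..<int (l\<^sup>2)}. int l dvd a}"
    then obtain j where j: "a = int l * j" "0 \<le> int l * j" "int l * j < int l * int l"
      by (auto simp: power2_eq_square elim!: dvdE)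
    then have "0 \<le> j" "j < int l" using l0 by (simp_all add: zero_le_mult_iff)
    then show "a \<in> (\<lambda>j. int l * j) ` {0..<int l}" using j by auto
  qed (use l0 in \<open>auto simp: power2_eq_square\<close>)
  also have "card \<dots> = l" using l0 by (subst card_image) (auto simp: inj_on_def)
  finally show ?thesis using l0 by simp
qed

section \<open>Theta near rational points\<close>

lemma infsum_finite_sum:
  fixes f :: "'a \<Rightarrow> 'b \<Rightarrow> complex"
  assumes "finite A" "\<And>a. a \<in> A \<Longrightarrow> f a summable_on X"
  shows "(\<Sum>\<^sub>\<infinity>m\<in>X. \<Sum>a\<in>A. f a m) = (\<Sum>a\<in>A. \<Sum>\<^sub>\<infinity>m\<in>X. f a m)"
proof -
  have "((\<lambda>m. \<Sum>a\<in>A. f a m) has_sum (\<Sum>a\<in>A. \<Sum>\<^sub>\<infinity>m\<in>X. f a m)) X"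
    using assms by (induction A rule: finite_induct) (auto intro!: has_sum_add)
  then show ?thesis by (rule infsumI)
qed

lemma infsum_int_residues:
  fixes f :: "int \<Rightarrow> complex"
  assumes N: "N > 0" and f: "f summable_on UNIV"
  shows "(\<Sum>\<^sub>\<infinity>n. f n) = (\<Sum>a\<in>{0..<int N}. \<Sum>\<^sub>\<infinity>k. f (a + int N * k))"
proof -
  let ?B = "\<lambda>a. (\<lambda>k. a + int N * k) ` UNIV"
  have "(\<Sum>a\<in>{0..<int N}. \<Sum>\<^sub>\<infinity>k. f (a + int N * k)) = (\<Sum>a\<in>{0..<int N}. infsum f (?B a))"
    using N by (intro sum.cong refl) (subst infsum_reindex, auto simp: inj_on_def o_def)
  also have "\<dots> = infsum f (\<Union>a\<in>{0..<int N}. ?B a)"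
  proof (rule sum_infsum)
    show "f summable_on ?B a" for a using f summable_on_subset_banach by blast
    fix a a' assume a: "a \<in> {0..<int N}" "a' \<in> {0..<int N}" "a \<noteq> a'"
    have "(a + int N * k) mod int N = a" if "a \<in> {0..<int N}" for a k using that by simp
    then show "?B a \<inter> ?B a' = {}" using a by (metis (no_types, lifting) disjoint_iff imageE)
  qed auto
  also have "(\<Union>a\<in>{0..<int N}. ?B a) = UNIV"
  proof -
    have "n \<in> ?B (n mod int N)" for n by (rule image_eqI[of _ _ "n div int N"]) auto
    moreover have "n mod int N \<in> {0..<int N}" for n using N by simp
    ultimately show ?thesis by blast
  qed
  finally show ?thesis ..
qed

definition theta :: "complex \<Rightarrow> complex" where
  "theta = gauss_series (\<lambda>_. 1) 0"

lemma gauss_series_term_shift: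
  "exp (pi * \<i> * (of_int n)\<^sup>2 * (\<tau> + of_int (2 * c) / of_nat N))
     = unity_root N (c * n\<^sup>2) * exp (pi * \<i> * (of_int n)\<^sup>2 * \<tau>)"
proof -
  have "complex_of_real pi * \<i> * (of_int n)\<^sup>2 * (\<tau> + of_int (2 * c) / of_nat N)
     = \<i> * of_real (2 * pi * of_int (c * n\<^sup>2) / of_nat N) + complex_of_real pi * \<i> * (of_int n)\<^sup>2 * \<tau>"
    by (simp add: algebra_simps)
  then show ?thesis by (simp only: exp_add cis_conv_exp unity_root_def)
qed

lemma theta_shift:
  "theta (\<tau> + of_int (2 * c) / of_nat N) = gauss_series (\<lambda>n. unity_root N (c * n\<^sup>2)) 0 \<tau>"
  unfolding theta_def gauss_series_def using gauss_series_term_shift by simp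

lemma Im_minus_inverse_pos: "Im \<sigma> > 0 \<Longrightarrow> Im (- 1 / \<sigma>) > 0"
  by (cases "\<sigma> = 0") (auto simp: Im_divide divide_pos_pos sum_power2_gt_zero_iff complex_eq_iff)

text \<open>On a residue class a mod N the root of unity is constant and the rest is a Gaussian
  series with shift a / N at -1 / \<sigma>. Inversion turns the shifts into characters in a, and
  completing the square in a produces \<open>gauss_sum N c\<close> and a theta series moved by 2 c'
  / N.\<close>

theorem theta_inversion:
  fixes N :: nat
  assumes N: "N > 0" and cc: "[4 * c * c' = -1] (mod int N)" and \<sigma>: "Im \<sigma> > 0"
  shows "theta (of_int (2 * c) / of_nat N - 1 / (of_nat N ^ 2 * \<sigma>))
       = csq \<sigma> * gauss_sum N c * theta (\<sigma> + of_int (2 * c') / of_nat N)"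
proof -
  define \<tau> where "\<tau> = - 1 / (of_nat (N\<^sup>2) * \<sigma>)"
  have \<tau>: "Im \<tau> > 0" unfolding \<tau>_def using \<sigma> N by (intro Im_minus_inverse_pos) (simp flip: of_nat_power)
  let ?f = "\<lambda>n. unity_root N (c * n\<^sup>2) * exp (pi * \<i> * (of_int n + of_real 0)\<^sup>2 * \<tau>)"
  let ?e = "\<lambda>m. exp (pi * \<i> * (of_int m + of_real 0)\<^sup>2 * \<sigma>)"
  have sum_f: "?f summable_on UNIV"
    using \<tau> by (intro gauss_series_summable) auto
  have inner: "(\<Sum>\<^sub>\<infinity>k. ?f (a + int N * k)) = csq \<sigma> * (\<Sum>\<^sub>\<infinity>m. unity_root N (c * a\<^sup>2 + m * a) * ?e m)" for a
  proof -
    have "?f (a + int N * k) = unity_root N (c * a\<^sup>2) * (1 * exp (pi * \<i> * (of_int k + of_real (of_int a / of_nat N))\<^sup>2 * (- 1 / \<sigma>)))" for k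
    proof -
      have "unity_root N (c * (a + int N * k)\<^sup>2) = unity_root N (c * a\<^sup>2)"
      proof (rule unity_root_cong[OF N])
        show "[c * (a + int N * k)\<^sup>2 = c * a\<^sup>2] (mod int N)"
          by (intro cong_mult cong_pow) (auto simp: cong_iff_dvd_diff)
      qed
      moreover have "complex_of_real pi * \<i> * (of_int (a + int N * k) + of_real 0)\<^sup>2 * \<tau>
          = complex_of_real pi * \<i> * (of_int k + of_real (of_int a / of_nat N))\<^sup>2 * (- 1 / \<sigma>)"
      proof -
        have "complex_of_int (a + int N * k) + of_real 0 = of_nat N * (of_int k + of_real (of_int a / of_nat N))"
          using N by (simp add: field_simps)
        then show ?thesis using N by (simp only: \<tau>_def power_mult_distrib) (simp add: field_simps)
      qed
      ultimately show ?thesis by simp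
    qed
    then have "(\<Sum>\<^sub>\<infinity>k. ?f (a + int N * k)) = unity_root N (c * a\<^sup>2) * gauss_series (\<lambda>_. 1) (of_int a / of_nat N) (- 1 / \<sigma>)"
      unfolding gauss_series_def by (simp only: infsum_cmult_right')
    also have "\<dots> = unity_root N (c * a\<^sup>2) * (csq \<sigma> * gauss_series (\<lambda>m. unity_root N (m * a)) 0 \<sigma>)"
      unfolding gauss_series_inversion[OF \<sigma>] unity_root_def by (simp add: mult.assoc)
    also have "\<dots> = csq \<sigma> * (unity_root N (c * a\<^sup>2) * (\<Sum>\<^sub>\<infinity>m. unity_root N (m * a) * ?e m))"
      by (simp add: gauss_series_def)
    also have "unity_root N (c * a\<^sup>2) * (\<Sum>\<^sub>\<infinity>m. unity_root N (m * a) * ?e m)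
        = (\<Sum>\<^sub>\<infinity>m. unity_root N (c * a\<^sup>2 + m * a) * ?e m)"
      by (subst infsum_cmult_right'[symmetric]) (simp add: unity_root_add mult.assoc)
    finally show ?thesis .
  qed
  have "theta (of_int (2 * c) / of_nat N - 1 / (of_nat N ^ 2 * \<sigma>)) = theta (\<tau> + of_int (2 * c) / of_nat N)"
    by (simp add: \<tau>_def add.commute)
  also have "\<dots> = (\<Sum>\<^sub>\<infinity>n. ?f n)"
    unfolding theta_shift gauss_series_def ..
  also have "\<dots> = (\<Sum>a\<in>{0..<int N}. csq \<sigma> * (\<Sum>\<^sub>\<infinity>m. unity_root N (c * a\<^sup>2 + m * a) * ?e m))"
    using infsum_int_residues[OF N sum_f] inner by simp
  also have "\<dots> = csq \<sigma> * (\<Sum>a\<in>{0..<int N}. \<Sum>\<^sub>\<infinity>m. unity_root N (c * a\<^sup>2 + m * a) * ?e m)"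
    by (simp add: sum_distrib_left)
  also have "(\<Sum>a\<in>{0..<int N}. \<Sum>\<^sub>\<infinity>m. unity_root N (c * a\<^sup>2 + m * a) * ?e m)
      = (\<Sum>\<^sub>\<infinity>m. \<Sum>a\<in>{0..<int N}. unity_root N (c * a\<^sup>2 + m * a) * ?e m)"
    using \<sigma> by (intro infsum_finite_sum[symmetric] gauss_series_summable) auto
  also have "\<dots> = (\<Sum>\<^sub>\<infinity>m. gauss_sum N c * (unity_root N (c' * m\<^sup>2) * ?e m))"
    unfolding sum_distrib_right[symmetric] gauss_sum_complete_square[OF N cc] by (simp add: mult_ac)
  also have "\<dots> = gauss_sum N c * theta (\<sigma> + of_int (2 * c') / of_nat N)"
    unfolding theta_shift gauss_series_def by (rule infsum_cmult_right')
  finally show ?thesis by (simp add: mult.assoc)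
qed

lemma theta_add_2: "theta (\<tau> + 2) = theta \<tau>"
  using theta_shift[of \<tau> 1 "Suc 0"] unity_root_eq_1_iff[of "Suc 0"] by (simp add: theta_def)

text \<open>Adding 1 changes the sign of the terms with odd n, and the terms with even n make up
  \<open>theta (4 * \<tau>)\<close>.\<close>

lemma theta_add_1:
  assumes "Im \<tau> > 0"
  shows "theta (\<tau> + 1) = 2 * theta (4 * \<tau>) - theta \<tau>"
proof -
  let ?e = "\<lambda>n. exp (pi * \<i> * (of_int n)\<^sup>2 * \<tau>)"
  let ?r = "\<lambda>n. unity_root 2 (1 * n\<^sup>2)"
  have s: "?e summable_on UNIV" "(\<lambda>n. ?r n * ?e n) summable_on UNIV"
    using gauss_series_summable[of "\<lambda>_. 1" \<tau> 0] gauss_series_summable[of ?r \<tau> 0] assms by simp_all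
  have iv: "{0..<int 2} = {0, 1}" by auto
  have m1: "unity_root 2 k = -1" if "odd k" for k
  proof -
    from that obtain j where "k = 2 * j + 1" by (elim oddE)
    then have "unity_root 2 k = unity_root 2 (2 * j) * unity_root 2 1" by (simp add: unity_root_add)
    moreover have "unity_root 2 (2 * j) = 1" by (subst unity_root_eq_1_iff) auto
    moreover have "unity_root 2 1 = -1" by (simp add: unity_root_def)
    ultimately show ?thesis by simp
  qed
  have p1: "unity_root 2 k = 1" if "even k" for k
    using that by (subst unity_root_eq_1_iff) auto
  have ev: "(\<Sum>\<^sub>\<infinity>k. ?e (0 + int 2 * k)) = theta (4 * \<tau>)"
    unfolding theta_def gauss_series_def by (simp add: power_mult_distrib mult_ac)
  have "theta \<tau> = (\<Sum>\<^sub>\<infinity>k. ?e (0 + int 2 * k)) + (\<Sum>\<^sub>\<infinity>k. ?e (1 + int 2 * k))"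
    using infsum_int_residues[OF _ s(1), of 2] unfolding theta_def gauss_series_def iv by simp
  moreover have "theta (\<tau> + 1) = (\<Sum>\<^sub>\<infinity>k. ?e (0 + int 2 * k)) - (\<Sum>\<^sub>\<infinity>k. ?e (1 + int 2 * k))"
    using infsum_int_residues[OF _ s(2), of 2] theta_shift[of \<tau> 1 2]
    unfolding gauss_series_def iv by (simp add: m1 p1 infsum_uminus)
  ultimately show ?thesis using ev by simp
qed

lemma csq_scale: "r > 0 \<Longrightarrow> Im \<tau> > 0 \<Longrightarrow> csq (of_real (r\<^sup>2) * \<tau>) = of_real r * csq \<tau>"
  by (rule csq_unique) (auto simp: power_mult_distrib Re_csq_pos)

lemma csq_nonzero: "Im \<tau> > 0 \<Longrightarrow> csq \<tau> \<noteq> 0"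
  using Re_csq_pos by fastforce

lemma csq_inverse:
  assumes "Im \<sigma> > 0" "r > 0"
  shows "csq \<sigma> * csq (- 1 / (of_real (r\<^sup>2) * \<sigma>)) = 1 / of_real r"
proof -
  have "\<sigma> \<noteq> 0" using assms by auto
  have "csq (- 1 / (of_real (r\<^sup>2) * \<sigma>)) = 1 / (of_real r * csq \<sigma>)"
  proof (rule csq_unique)
    show "(1 / (of_real r * csq \<sigma>))\<^sup>2 = - \<i> * (- 1 / (of_real (r\<^sup>2) * \<sigma>))"
      using assms \<open>\<sigma> \<noteq> 0\<close> by (simp add: power_divide power_mult_distrib field_simps)
    have "Re (of_real r * csq \<sigma>) > 0" using assms Re_csq_pos by simp
    then show "Re (1 / (of_real r * csq \<sigma>)) > 0"
      unfolding Re_divide by (intro divide_pos_pos) (auto simp: sum_power2_gt_zero_iff)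
  qed
  then show ?thesis using csq_nonzero[OF assms(1)] by simp
qed

text \<open>
  The classical \<open>\<theta>\<^sub>2 = \<Sum> q\<^bsup>(n + 1/2)*(n + 1/2)\<^esup>\<close>, written as a difference so that its behaviour
  follows from that of \<open>theta\<close>.
\<close>

definition theta2 :: "complex \<Rightarrow> complex" where
  "theta2 \<sigma> = theta (\<sigma> / 4) - theta \<sigma>"

text \<open>\<open>theta_add_1\<close> leads to theta at \<tau> and at 4 \<tau>. Both arguments fit
  \<open>theta_inversion\<close>, with numerators c and 4 c and partners 4 c' and c'; this is where
  the 16 comes from. The factor 2 is absorbed by csq (\<sigma> / 4) = csq \<sigma> / 2, and the
  Gauss sums for c and 4 c are equal, so the difference defining \<open>theta2\<close>
  remains.\<close>

theorem theta_one_inversion: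
  fixes N :: nat
  assumes N: "odd N" and cc: "[16 * c * c' = -1] (mod int N)" and \<sigma>: "Im \<sigma> > 0"
  shows "theta (of_int (2 * c) / of_nat N - 1 / (of_nat N ^ 2 * \<sigma>) + 1)
       = csq \<sigma> * gauss_sum N c * theta2 (\<sigma> + of_int (8 * c') / of_nat N)"
proof -
  have N0: "N > 0" using N by (rule odd_pos)
  define \<tau> where "\<tau> = of_int (2 * c) / of_nat N - 1 / (of_nat N ^ 2 * \<sigma>)"
  have "Im (- 1 / (of_nat (N\<^sup>2) * \<sigma>)) > 0"
    using \<sigma> N0 by (intro Im_minus_inverse_pos) (simp flip: of_nat_power)
  then have \<tau>: "Im \<tau> > 0" by (simp add: \<tau>_def)
  have 1: "theta \<tau> = csq \<sigma> * gauss_sum N c * theta (\<sigma> + of_int (2 * (4 * c')) / of_nat N)"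
    unfolding \<tau>_def using cc by (intro theta_inversion[OF N0 _ \<sigma>]) (simp add: mult_ac)
  have "4 * \<tau> = of_int (2 * (4 * c)) / of_nat N - 1 / (of_nat N ^ 2 * (\<sigma> / 4))"
    using N0 \<sigma> by (auto simp: \<tau>_def field_simps)
  then have 2: "theta (4 * \<tau>) = csq (\<sigma> / 4) * gauss_sum N (4 * c) * theta (\<sigma> / 4 + of_int (2 * c') / of_nat N)"
    using cc theta_inversion[OF N0, of "4 * c" c' "\<sigma> / 4"] \<sigma> by (simp add: mult_ac)
  have 3: "csq (\<sigma> / 4) = csq \<sigma> / 2"
    using csq_scale[of 2 "\<sigma> / 4"] \<sigma> by simp
  have "theta (\<tau> + 1) = 2 * theta (4 * \<tau>) - theta \<tau>" by (rule theta_add_1[OF \<tau>])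
  also have "\<dots> = csq \<sigma> * gauss_sum N c
     * (theta (\<sigma> / 4 + of_int (2 * c') / of_nat N) - theta (\<sigma> + of_int (2 * (4 * c')) / of_nat N))"
    unfolding 1 2 3 gauss_sum_times_4[OF N] by (simp add: algebra_simps)
  also have "theta (\<sigma> / 4 + of_int (2 * c') / of_nat N) - theta (\<sigma> + of_int (2 * (4 * c')) / of_nat N)
     = theta2 (\<sigma> + of_int (8 * c') / of_nat N)"
    by (simp add: theta2_def add_divide_distrib)
  finally show ?thesis unfolding \<tau>_def .
qed

section \<open>Power series expansions\<close>

lemma fps_conv_radius_ge_1_bounded:
  fixes f :: "complex fps"
  assumes "\<And>n. norm (fps_nth f n) \<le> C"
  shows "fps_conv_radius f \<ge> 1"
  unfolding fps_conv_radius_def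
proof (rule conv_radius_geI_ex')
  fix r :: real assume r: "0 < r" "ereal r < 1"
  have "summable (\<lambda>n. C * r ^ n)" using r by (intro summable_mult summable_geometric) auto
  then show "summable (\<lambda>n. fps_nth f n * of_real r ^ n)"
    by (rule summable_comparison_test'[where N = 0])
       (use r assms in \<open>auto simp: norm_mult norm_power mult_right_mono\<close>)
qed

text \<open>Groups the terms by exponent; the fibres of \<open>h\<close> are finite, and summability
  justifies the rearrangement.\<close>

lemma infsum_powers_eq_eval_fps:
  fixes q :: complex and h :: "int \<Rightarrow> nat"
  assumes fin: "\<And>m. finite {n\<in>X. h n = m}" and sum: "(\<lambda>n. q ^ h n) summable_on X"
  shows "(\<Sum>\<^sub>\<infinity>n\<in>X. q ^ h n) = eval_fps (Abs_fps (\<lambda>m. of_nat (card {n\<in>X. h n = m}))) q"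
proof -
  define S where "S = Sigma UNIV (\<lambda>m. {n\<in>X. h n = m})"
  let ?g = "\<lambda>(m, n::int). q ^ m"
  let ?c = "\<lambda>m. of_nat (card {n\<in>X. h n = m}) * q ^ m"
  have bij: "bij_betw snd S X"
    by (rule bij_betwI[of _ _ _ "\<lambda>n. (h n, n)"]) (auto simp: S_def)
  have g: "?g x = q ^ h (snd x)" if "x \<in> S" for x
    using that by (auto simp: S_def)
  have sumS: "?g summable_on S"
    by (rule iffD2[OF summable_on_cong[OF g]], assumption)
       (rule iffD2[OF summable_on_reindex_bij_betw[OF bij, of "\<lambda>n. q ^ h n"] sum])
  have inner: "(\<Sum>\<^sub>\<infinity>n\<in>{n\<in>X. h n = m}. ?g (m, n)) = ?c m" for m
    using fin[of m] by simp
  have "(\<Sum>\<^sub>\<infinity>n\<in>X. q ^ h n) = infsum ?g S"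
    unfolding infsum_reindex_bij_betw[OF bij, of "\<lambda>n. q ^ h n", symmetric]
    by (rule infsum_cong) (simp add: g)
  also have "\<dots> = (\<Sum>\<^sub>\<infinity>m. ?c m)"
    using infsum_Sigma_banach[of ?g UNIV "\<lambda>m. {n\<in>X. h n = m}"] sumS unfolding S_def inner by simp
  finally have eq: "(\<Sum>\<^sub>\<infinity>n\<in>X. q ^ h n) = (\<Sum>\<^sub>\<infinity>m. ?c m)" .
  have "?c summable_on UNIV"
    using summable_on_Sigma_banach[of "\<lambda>m n. q ^ m" UNIV "\<lambda>m. {n\<in>X. h n = m}"] sumS inner
    unfolding S_def by simp
  then have "(?c has_sum (\<Sum>\<^sub>\<infinity>n\<in>X. q ^ h n)) UNIV" unfolding eq by (rule has_sum_infsum)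
  then have "?c sums (\<Sum>\<^sub>\<infinity>n\<in>X. q ^ h n)" by (rule has_sum_imp_sums)
  then show ?thesis by (simp add: eval_fps_def sums_iff)
qed

section \<open>The nome and the expansions of theta and its reciprocal\<close>

definition nome :: "complex \<Rightarrow> complex" where "nome \<tau> = exp (pi * \<i> * \<tau>)"

lemma norm_nome: "norm (nome \<tau>) = exp (- pi * Im \<tau>)"
  by (simp add: nome_def)

lemma norm_nome_less_1: "Im \<tau> > 0 \<Longrightarrow> norm (nome \<tau>) < 1"
  by (simp add: norm_nome)

lemma nome_nonzero [simp]: "nome \<tau> \<noteq> 0"
  by (simp add: nome_def)

lemma nome_mult_nat: "nome (of_nat n * \<tau>) = nome \<tau> ^ n"
  unfolding nome_def exp_of_nat_mult[symmetric] by (simp add: mult_ac)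

lemma nome_power: "nome \<tau> ^ n = exp (pi * \<i> * (of_nat n * \<tau>))"
  using nome_mult_nat[of n \<tau>] by (simp add: nome_def)

lemma nome_add: "nome (\<sigma> + \<tau>) = nome \<sigma> * nome \<tau>"
  by (simp add: nome_def exp_add ring_distribs)

text \<open>Carries identities from the half-plane over to the punctured unit disc.\<close>

lemma nome_surj:
  assumes "q \<noteq> 0" "norm q < 1"
  obtains \<tau> where "Im \<tau> > 0" "nome \<tau> = q"
proof
  let ?t = "Ln q / (pi * \<i>)"
  show "nome ?t = q" using assms by (simp add: nome_def)
  have "ln (norm q) < 0" using assms by simp
  then show "Im ?t > 0" using assms by (simp add: Im_divide Re_Ln field_simps power2_eq_square)
qed

definition theta_fps :: "complex fps" where
  "theta_fps = Abs_fps (\<lambda>n. of_int (square_coeff n))"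

lemma card_int_squares: "of_nat (card {n::int. nat (n\<^sup>2) = m}) = square_coeff m"
proof (cases "\<exists>j. m = j\<^sup>2")
  case True
  then obtain j where j: "m = j\<^sup>2" by blast
  have "nat (n\<^sup>2) = j\<^sup>2 \<longleftrightarrow> n = int j \<or> n = - int j" for n
    by (metis nat_int of_nat_power power2_eq_iff zero_le_power2 nat_eq_iff)
  then have "{n::int. nat (n\<^sup>2) = m} = {int j, - int j}" unfolding j by auto
  then show ?thesis using j by (cases "j = 0") (auto simp: square_coeff_def)
next
  case False
  have "nat (n\<^sup>2) = (nat \<bar>n\<bar>)\<^sup>2" for n :: int by (simp add: nat_power_eq[symmetric])
  then have "{n::int. nat (n\<^sup>2) = m} = {}" using False by auto
  moreover have "m \<noteq> 0" using False by (metis zero_power2)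
  ultimately show ?thesis using False by (simp add: square_coeff_def)
qed

lemma theta_eq_eval_fps:
  assumes "Im \<tau> > 0"
  shows "theta \<tau> = eval_fps theta_fps (nome \<tau>)"
proof -
  have t: "1 * exp (pi * \<i> * (of_int n + of_real 0)\<^sup>2 * \<tau>) = nome \<tau> ^ nat (n\<^sup>2)" for n
    unfolding nome_power by (simp add: mult_ac)
  have "(\<lambda>n. nome \<tau> ^ nat (n\<^sup>2)) summable_on UNIV"
    using gauss_series_summable[of "\<lambda>_. 1" \<tau> 0] assms unfolding t by simp
  moreover have "finite {n::int \<in> UNIV. nat (n\<^sup>2) = m}" for m
  proof (rule finite_subset)
    show "{n::int \<in> UNIV. nat (n\<^sup>2) = m} \<subseteq> {- int m..int m}"
    proof
      fix n :: int assume "n \<in> {n::int \<in> UNIV. nat (n\<^sup>2) = m}"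
      then have "n\<^sup>2 = int m" by auto
      moreover have "\<bar>n\<bar> * 1 \<le> \<bar>n\<bar> * \<bar>n\<bar>"
        by (cases "n = 0") (simp, intro mult_left_mono, auto)
      ultimately have "\<bar>n\<bar> \<le> int m" by (simp add: power2_eq_square)
      then show "n \<in> {- int m..int m}" by auto
    qed
  qed simp
  ultimately have "(\<Sum>\<^sub>\<infinity>n\<in>UNIV. nome \<tau> ^ nat (n\<^sup>2))
      = eval_fps (Abs_fps (\<lambda>m. of_nat (card {n::int \<in> UNIV. nat (n\<^sup>2) = m}))) (nome \<tau>)"
    by (intro infsum_powers_eq_eval_fps)
  also have "Abs_fps (\<lambda>m. of_nat (card {n::int \<in> UNIV. nat (n\<^sup>2) = m})) = theta_fps"
    unfolding theta_fps_def card_int_squares[symmetric] by simp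
  finally show ?thesis unfolding theta_def gauss_series_def t .
qed

lemma theta_fps_conv_radius: "fps_conv_radius theta_fps \<ge> 1"
  by (rule fps_conv_radius_ge_1_bounded[of _ 2]) (auto simp: theta_fps_def square_coeff_def)

text \<open>The substitution of -X for X, which in terms of the nome is \<tau> \<mapsto> \<tau> +
  1.\<close>

definition fps_twist :: "complex fps \<Rightarrow> complex fps" where
  "fps_twist f = Abs_fps (\<lambda>n. (-1) ^ n * fps_nth f n)"

lemma fps_twist_mult: "fps_twist (f * g) = fps_twist f * fps_twist g"
proof (rule fps_ext)
  fix n
  show "fps_nth (fps_twist (f * g)) n = fps_nth (fps_twist f * fps_twist g) n"
    unfolding fps_twist_def fps_mult_nth fps_nth_Abs_fps sum_distrib_left
  proof (intro sum.cong refl)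
    fix i assume "i \<in> {0..n}"
    then have "(-1 :: complex) ^ n = (-1) ^ i * (-1) ^ (n - i)" by (simp flip: power_add)
    then show "(-1) ^ n * (fps_nth f i * fps_nth g (n - i))
        = (-1) ^ i * fps_nth f i * ((-1) ^ (n - i) * fps_nth g (n - i))" by simp
  qed
qed

lemma fps_conv_radius_twist: "fps_conv_radius (fps_twist f) = fps_conv_radius f"
proof -
  have "fps_conv_radius (fps_twist f) = fps_conv_radius (Abs_fps (\<lambda>n. norm (fps_nth (fps_twist f) n)))"
    by simp
  also have "\<dots> = fps_conv_radius f"
    by (simp add: fps_twist_def norm_mult norm_power)
  finally show ?thesis .
qed

lemma eval_fps_twist: "eval_fps (fps_twist f) q = eval_fps f (- q)"
  unfolding eval_fps_def fps_twist_def by (rule suminf_cong) (simp add: power_minus[of q] mult_ac)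

definition invtheta_fps :: "complex fps" where
  "invtheta_fps = fps_twist overpartition_fps"

lemma theta_mult_invtheta_fps: "theta_fps * invtheta_fps = 1"
proof -
  have "fps_twist theta4_fps = theta_fps"
    by (rule fps_ext) (simp add: fps_twist_def theta4_fps_def theta_fps_def flip: power_mult_distrib mult.assoc)
  moreover have "fps_twist 1 = 1" by (rule fps_ext) (simp add: fps_twist_def)
  ultimately show ?thesis
    using arg_cong[OF theta4_mult_overpartition_fps, of fps_twist]
    unfolding invtheta_fps_def fps_twist_mult by simp
qed

lemma invtheta_fps_conv_radius: "fps_conv_radius invtheta_fps \<ge> 1"
  unfolding invtheta_fps_def fps_conv_radius_twist by (rule overpartition_fps_conv_radius)

lemma less_conv_radius: "norm q < 1 \<Longrightarrow> fps_conv_radius f \<ge> 1 \<Longrightarrow> ereal (norm q) < fps_conv_radius f"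
  by (metis ereal_less(3) less_le_trans)

lemma theta_mult_invtheta:
  assumes "Im \<tau> > 0"
  shows "theta \<tau> * eval_fps invtheta_fps (nome \<tau>) = 1"
  unfolding theta_eq_eval_fps[OF assms]
  using norm_nome_less_1[OF assms] theta_fps_conv_radius invtheta_fps_conv_radius
  by (subst eval_fps_mult[symmetric]) (auto simp: less_conv_radius theta_mult_invtheta_fps)

text \<open>By Gauss's identity theta has a reciprocal given by a series that converges in the whole
  unit disc; this is what the growth bound on overpartitions provides.\<close>

lemma theta_nonzero: "Im \<tau> > 0 \<Longrightarrow> theta \<tau> \<noteq> 0"
  using theta_mult_invtheta by fastforce

lemma inverse_theta_eq_eval_fps: "Im \<tau> > 0 \<Longrightarrow> inverse (theta \<tau>) = eval_fps invtheta_fps (nome \<tau>)"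
  using theta_mult_invtheta by (metis inverse_unique)

section \<open>Triangular numbers and the expansion at the other cusp\<close>

text \<open>Defined on all integers to match the odd numbers n = 2 k + 1, for which n^2 = 8
  \<open>tri k\<close> + 1; the symmetry n \<mapsto> -n becomes k \<mapsto> -1 - k.\<close>

definition tri :: "int \<Rightarrow> nat" where "tri k = nat ((k\<^sup>2 + k) div 2)"

lemma tri_reflect: "tri (- 1 - k) = tri k"
  by (simp add: tri_def power2_eq_square algebra_simps)

lemma two_times_tri: "2 * int (tri k) = k\<^sup>2 + k"
proof -
  have "even (k\<^sup>2 + k)" by simp
  moreover have "k\<^sup>2 + k \<ge> 0"
  proof -
    have "k * (k + 1) \<ge> 0" by (cases "k \<ge> 0") (auto simp: zero_le_mult_iff)
    then show ?thesis by (simp add: power2_eq_square ring_distribs)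
  qed
  ultimately show ?thesis by (simp add: tri_def)
qed

lemma tri_inj: "inj_on tri {0..}"
proof (rule inj_onI)
  fix j k assume jk: "j \<in> {0..}" "k \<in> {0..}" "tri j = tri k"
  then have "j\<^sup>2 + j = k\<^sup>2 + k" using two_times_tri by metis
  then have "(j - k) * (j + k + 1) = 0" by (simp add: power2_eq_square algebra_simps)
  then show "j = k" using jk by auto
qed

text \<open>Gauss's psi, the sum of X^(k (k + 1) / 2) over k \<ge> 0.\<close>

definition psi_fps :: "complex fps" where
  "psi_fps = Abs_fps (\<lambda>m. of_nat (card {k\<in>{0..}. tri k = m}))"

lemma finite_tri_fiber: "finite {k\<in>{0..}. tri k = m}" and card_tri_fiber: "card {k\<in>{0..}. tri k = m} \<le> 1"
proof -
  have *: "x = y" if "x \<in> {k\<in>{0..}. tri k = m}" "y \<in> {k\<in>{0..}. tri k = m}" for x y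
    using that tri_inj by (auto simp: inj_on_def)
  show fin: "finite {k\<in>{0..}. tri k = m}"
  proof (cases "{k\<in>{0..}. tri k = m} = {}")
    case False
    then obtain x where "x \<in> {k\<in>{0..}. tri k = m}" by blast
    then have "{k\<in>{0..}. tri k = m} \<subseteq> {x}" using * by blast
    then show ?thesis by (rule finite_subset) simp
  next
    case True
    then show ?thesis by (metis finite.emptyI)
  qed
  show "card {k\<in>{0..}. tri k = m} \<le> 1"
    using card_le_Suc0_iff_eq[OF fin] * by auto
qed

lemma psi_fps_conv_radius: "fps_conv_radius psi_fps \<ge> 1"
  by (rule fps_conv_radius_ge_1_bounded[of _ 1]) (use card_tri_fiber in \<open>auto simp: psi_fps_def\<close>)

lemma psi_fps_0: "fps_nth psi_fps 0 = 1"
proof -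
  have "tri k = 0 \<longleftrightarrow> k = 0" if "k \<ge> 0" for k
    using two_times_tri[of k] that by (auto simp: power2_eq_square) (metis add_nonneg_eq_0_iff mult_nonneg_nonneg)
  then have "{k\<in>{0..}. tri k = 0} = {0}" by auto
  then show ?thesis by (simp add: psi_fps_def)
qed

text \<open>The odd terms of \<open>theta (\<sigma> / 4)\<close> have exponents (8
  \<open>tri k\<close> + 1) / 4. Each triangular number arises from k and from -1 - k, whence the 2,
  and apart from the factor q^(1/4) only powers of q^2 = \<open>nome (2 * \<sigma>)\<close>
  remain.\<close>

lemma theta2_eq_eval_fps:
  assumes \<sigma>: "Im \<sigma> > 0"
  shows "theta2 \<sigma> = 2 * nome (\<sigma> / 4) * eval_fps psi_fps (nome (2 * \<sigma>))"
proof -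
  let ?e = "\<lambda>n. exp (pi * \<i> * (of_int n)\<^sup>2 * (\<sigma> / 4))"
  have s: "?e summable_on UNIV"
    using gauss_series_summable[of "\<lambda>_. 1" "\<sigma> / 4" 0] \<sigma> by simp
  have iv: "{0..<int 2} = {0, 1}" by auto
  have "theta (\<sigma> / 4) = (\<Sum>\<^sub>\<infinity>k. ?e (0 + int 2 * k)) + (\<Sum>\<^sub>\<infinity>k. ?e (1 + int 2 * k))"
    using infsum_int_residues[OF _ s, of 2] unfolding theta_def gauss_series_def iv by simp
  moreover have "(\<Sum>\<^sub>\<infinity>k. ?e (0 + int 2 * k)) = theta \<sigma>"
    unfolding theta_def gauss_series_def by (simp add: power_mult_distrib mult_ac)
  ultimately have eq: "theta2 \<sigma> = (\<Sum>\<^sub>\<infinity>k. ?e (1 + int 2 * k))" by (simp add: theta2_def)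
  have e: "?e (1 + int 2 * k) = nome (\<sigma> / 4) * nome (2 * \<sigma>) ^ tri k" for k
  proof -
    have "(complex_of_int (1 + int 2 * k))\<^sup>2 = of_int (1 + 4 * (k\<^sup>2 + k))" by (simp add: power2_eq_square algebra_simps)
    also have "\<dots> = 1 + 8 * of_nat (tri k)" unfolding two_times_tri[symmetric] by simp
    finally have "pi * \<i> * (complex_of_int (1 + int 2 * k))\<^sup>2 * (\<sigma> / 4)
       = pi * \<i> * (\<sigma> / 4) + pi * \<i> * (of_nat (tri k) * (2 * \<sigma>))"
      by (simp add: algebra_simps)
    then show ?thesis unfolding nome_power by (simp only: nome_def exp_add)
  qed
  let ?h = "\<lambda>k. nome (2 * \<sigma>) ^ tri k"
  have "inj (\<lambda>k. 1 + 2 * k :: int)" by (simp add: inj_on_def)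
  then have "(?e \<circ> (\<lambda>k. 1 + 2 * k)) summable_on UNIV"
    using s summable_on_subset_banach[OF s, of "range (\<lambda>k. 1 + 2 * k)"] summable_on_reindex by blast
  then have "(\<lambda>k. nome (\<sigma> / 4) * ?h k) summable_on UNIV"
    using e by (simp add: o_def)
  then have sh: "?h summable_on UNIV"
    using summable_on_cmult_right'[of "nome (\<sigma> / 4)" ?h UNIV] by simp
  have sh0: "?h summable_on X" for X by (rule summable_on_subset_banach[OF sh]) simp
  have "(\<Sum>\<^sub>\<infinity>k\<in>{..<0}. ?h k) = (\<Sum>\<^sub>\<infinity>k\<in>{0..}. ?h k)"
    by (rule infsum_reindex_bij_witness[of _ "\<lambda>k. - 1 - k" "\<lambda>k. - 1 - k"]) (auto simp: tri_reflect)
  moreover have "(\<Sum>\<^sub>\<infinity>k. ?h k) = (\<Sum>\<^sub>\<infinity>k\<in>{..<0}. ?h k) + (\<Sum>\<^sub>\<infinity>k\<in>{0..}. ?h k)"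
  proof -
    have "(UNIV :: int set) = {..<0} \<union> {0..}" by auto
    then show ?thesis using infsum_Un_disjoint[OF sh0 sh0, of "{..<0}" "{0..}"] by (metis (no_types, lifting) disjoint_iff lessThan_iff atLeast_iff linorder_not_less)
  qed
  moreover have "(\<Sum>\<^sub>\<infinity>k\<in>{0..}. ?h k) = eval_fps psi_fps (nome (2 * \<sigma>))"
    unfolding psi_fps_def by (rule infsum_powers_eq_eval_fps[OF finite_tri_fiber sh0])
  ultimately show ?thesis unfolding eq e infsum_cmult_right' by simp
qed

lemma theta_one_minus_inverse:
  assumes "Im \<sigma> > 0"
  shows "theta (1 - 1 / \<sigma>) = csq \<sigma> * theta2 \<sigma>"
  using theta_one_inversion[of 1 0 0 \<sigma>] assms by (simp add: add.commute)

lemma theta2_nonzero: 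
  assumes "Im \<sigma> > 0"
  shows "theta2 \<sigma> \<noteq> 0"
proof -
  have "Im (1 - 1 / \<sigma>) > 0" using Im_minus_inverse_pos[OF assms] by simp
  then show ?thesis using theta_nonzero theta_one_minus_inverse[OF assms] by force
qed

text \<open>Away from 0 it is \<open>theta2\<close> up to nonzero factors, and \<open>theta2\<close>
  is theta seen from the cusp 1. So 1 / psi is holomorphic in the whole unit disc.\<close>

lemma psi_nonzero:
  assumes "norm p < 1"
  shows "eval_fps psi_fps p \<noteq> 0"
proof (cases "p = 0")
  case True
  then show ?thesis by (simp add: eval_fps_at_0 psi_fps_0)
next
  case False
  then obtain \<tau> where \<tau>: "Im \<tau> > 0" "nome \<tau> = p" using assms nome_surj by blast
  then show ?thesis using theta2_nonzero[of "\<tau> / 2"] theta2_eq_eval_fps[of "\<tau> / 2"] by auto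
qed

lemma inverse_psi_fps_conv_radius: "fps_conv_radius (inverse psi_fps) \<ge> 1"
  and eval_inverse_psi_fps: "norm p < 1 \<Longrightarrow> eval_fps (inverse psi_fps) p = inverse (eval_fps psi_fps p)"
proof -
  have "eval_fps psi_fps has_fps_expansion psi_fps"
    using psi_fps_conv_radius by (intro eval_fps_has_fps_expansion) (auto intro: less_le_trans[of _ 1])
  then have exp: "(\<lambda>p. inverse (eval_fps psi_fps p)) has_fps_expansion inverse psi_fps"
    by (rule has_fps_expansion_inverse) (simp add: psi_fps_0)
  have hol: "(\<lambda>p. inverse (eval_fps psi_fps p)) holomorphic_on ball 0 1"
    using psi_nonzero psi_fps_conv_radius by (intro holomorphic_intros) (auto simp: less_conv_radius)
  then show "fps_conv_radius (inverse psi_fps) \<ge> 1"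
    using holomorphic_on_imp_fps_conv_radius_ge[OF exp, of 1] by (simp add: one_ereal_def)
  show "eval_fps (inverse psi_fps) p = inverse (eval_fps psi_fps p)" if "norm p < 1"
    using has_fps_expansion_imp_eval_fps_eq[OF exp that hol] .
qed

section \<open>Power series with integer coefficients\<close>

definition int_fps :: "complex fps \<Rightarrow> bool" where
  "int_fps f \<longleftrightarrow> (\<forall>n. fps_nth f n \<in> \<int>)"

lemma int_fps_mult: "int_fps f \<Longrightarrow> int_fps g \<Longrightarrow> int_fps (f * g)"
  unfolding int_fps_def fps_mult_nth by (auto intro!: Ints_sum)

lemma int_fps_1: "int_fps 1"
  by (simp add: int_fps_def)

lemma int_fps_power: "int_fps f \<Longrightarrow> int_fps (f ^ n)"
  by (induction n) (auto simp: int_fps_1 int_fps_mult)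

lemma int_fps_inverse:
  assumes "int_fps f" "fps_nth f 0 = 1"
  shows "int_fps (inverse f)"
  unfolding int_fps_def
proof
  fix n
  show "fps_nth (inverse f) n \<in> \<int>"
  proof (induction n rule: less_induct)
    case (less n)
    show ?case
    proof (cases "n = 0")
      case True
      then show ?thesis using assms by simp
    next
      case False
      have "f * inverse f = 1" using assms(2) by (metis inverse_mult_eq_1 mult.commute zero_neq_one)
      then have "0 = (\<Sum>i\<in>{0..n}. fps_nth f i * fps_nth (inverse f) (n - i))"
        using False by (metis fps_mult_nth fps_one_nth)
      also have "\<dots> = fps_nth (inverse f) n + (\<Sum>i\<in>{1..n}. fps_nth f i * fps_nth (inverse f) (n - i))"
        using assms(2) by (simp add: sum.atLeast_Suc_atMost)
      finally have "fps_nth (inverse f) n = - (\<Sum>i\<in>{1..n}. fps_nth f i * fps_nth (inverse f) (n - i))"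
        by (simp add: eq_neg_iff_add_eq_0)
      also have "\<dots> \<in> \<int>"
        using less assms(1) False by (intro Ints_minus Ints_sum Ints_mult) (auto simp: int_fps_def)
      finally show ?thesis .
    qed
  qed
qed

lemma int_fps_theta: "int_fps theta_fps" and int_fps_invtheta: "int_fps invtheta_fps"
  and int_fps_psi: "int_fps psi_fps"
  by (auto simp: int_fps_def theta_fps_def invtheta_fps_def fps_twist_def overpartition_fps_def psi_fps_def
      intro!: Ints_mult)

section \<open>The Hecke operator\<close>

lemma card_sqrt_mod_prime:
  fixes l :: nat and k :: int
  assumes l: "prime l" "odd l"
  shows "int (card {a\<in>{0..<int l}. int l dvd a\<^sup>2 - k}) = 1 + Legendre k (int l)"
proof -
  let ?p = "int l"
  have p: "prime ?p" using l by simp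
  have l1: "?p > 1" using l(1) prime_gt_1_nat by force
  let ?A = "{a\<in>{0..<?p}. ?p dvd a\<^sup>2 - k}"
  show ?thesis
  proof (cases "[k = 0] (mod ?p)")
    case True
    then have pk: "?p dvd k" by (simp add: cong_0_iff)
    have "a \<in> ?A \<longleftrightarrow> a = 0" for a
    proof
      assume a: "a \<in> ?A"
      then have "?p dvd (a\<^sup>2 - k) + k" using pk by (intro dvd_add) auto
      then have "?p dvd a\<^sup>2" by simp
      then have "?p dvd a" using p prime_dvd_power by blast
      then show "a = 0" using a zdvd_not_zless[of a ?p] by fastforce
    qed (use pk l1 in auto)
    then have "?A = {0}" by blast
    then show ?thesis using True by (simp add: Legendre_def)
  next
    case False
    then have pk: "\<not> ?p dvd k" by (simp add: cong_0_iff)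
    show ?thesis
    proof (cases "QuadRes ?p k")
      case True
      then obtain y where y: "[y\<^sup>2 = k] (mod ?p)" by (auto simp: QuadRes_def)
      then have yk: "?p dvd y\<^sup>2 - k" by (simp add: cong_iff_dvd_diff)
      have py: "\<not> ?p dvd y"
      proof
        assume "?p dvd y"
        then have "?p dvd y\<^sup>2" by (simp add: power2_eq_square)
        then have "?p dvd y\<^sup>2 - (y\<^sup>2 - k)" using yk by (rule dvd_diff)
        then show False using pk by simp
      qed
      have "a \<in> ?A \<longleftrightarrow> a = y mod ?p \<or> a = (- y) mod ?p" for a
      proof
        assume a: "a \<in> ?A"
        then have "?p dvd (a\<^sup>2 - k) - (y\<^sup>2 - k)" using dvd_diff[OF _ yk, of "a\<^sup>2 - k"] by simp
        then have "?p dvd (a - y) * (a + y)" by (simp add: power2_eq_square algebra_simps)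
        from prime_dvd_multD[OF p this] have "?p dvd a - y \<or> ?p dvd a - (- y)" by simp
        then have "a mod ?p = y mod ?p \<or> a mod ?p = (- y) mod ?p"
          by (simp add: mod_eq_dvd_iff)
        then show "a = y mod ?p \<or> a = (- y) mod ?p" using a by simp
      next
        assume "a = y mod ?p \<or> a = (- y) mod ?p"
        moreover have "?p dvd (z mod ?p)\<^sup>2 - k" if "z\<^sup>2 = y\<^sup>2" for z
        proof -
          have "(z mod ?p)\<^sup>2 mod ?p = k mod ?p"
            using yk that by (simp add: power_mod mod_eq_dvd_iff)
          then show ?thesis by (simp add: mod_eq_dvd_iff)
        qed
        ultimately show "a \<in> ?A" using l1 by auto
      qed
      then have "?A = {y mod ?p, (- y) mod ?p}" by blast
      moreover have "y mod ?p \<noteq> (- y) mod ?p"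
      proof
        assume "y mod ?p = (- y) mod ?p"
        then have "?p dvd 2 * y" by (simp add: mod_eq_dvd_iff)
        from prime_dvd_multD[OF p this] have "?p dvd 2" using py by simp
        then have "?p \<le> 2" by (rule zdvd_imp_le) simp
        then have "l = 2" using l1 by simp
        then show False using l by simp
      qed
      ultimately show ?thesis using False True by (simp add: Legendre_def)
    next
      case nq: False
      have A0: "?A = {}"
      proof -
        have False if "a \<in> ?A" for a
          using that nq by (auto simp: QuadRes_def cong_iff_dvd_diff)
        then show ?thesis by blast
      qed
      show ?thesis unfolding A0 using False nq by (simp add: Legendre_def)
    qed
  qed
qed

text \<open>Summed over all d, 0 included, it is l times the number of square roots of -m modulo l,
  that is l (1 + \<open>Legendre (- m) l\<close>); the term d = 0 accounts for l. Hence the weights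
  \<open>gauss_sum l d\<close> turn shifts of the argument into a Legendre twist.\<close>

lemma sum_gauss_sum_unity_root:
  fixes l :: nat and m :: int
  assumes l: "prime l" "odd l"
  shows "(\<Sum>d\<in>{1..<int l}. gauss_sum l d * unity_root l (d * m)) = of_int (int l * Legendre (- m) (int l))"
proof -
  have l0: "l > 0" using l(1) by (rule prime_gt_0_nat)
  have "(\<Sum>d\<in>{0..<int l}. gauss_sum l d * unity_root l (d * m))
      = (\<Sum>d\<in>{0..<int l}. \<Sum>a\<in>{0..<int l}. unity_root l (d * (a\<^sup>2 - (- m))))"
    by (simp add: gauss_sum_def sum_distrib_right unity_root_add ring_distribs)
  also have "\<dots> = (\<Sum>a\<in>{0..<int l}. if int l dvd a\<^sup>2 - (- m) then of_nat l else 0)"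
    unfolding sum_unity_root[OF l0, symmetric] by (rule sum.swap)
  also have "\<dots> = of_nat l * of_nat (card {a\<in>{0..<int l}. int l dvd a\<^sup>2 - (- m)})"
    by (simp add: sum.If_cases Int_def mult.commute)
  also have "of_nat (card {a\<in>{0..<int l}. int l dvd a\<^sup>2 - (- m)}) = (of_int (1 + Legendre (- m) (int l)) :: complex)"
    unfolding card_sqrt_mod_prime[OF l, symmetric] by simp
  finally have "(\<Sum>d\<in>{0..<int l}. gauss_sum l d * unity_root l (d * m)) = of_nat l * of_int (1 + Legendre (- m) (int l))" .
  moreover have "{0..<int l} = insert 0 {1..<int l}" using l0 by auto
  ultimately have "gauss_sum l 0 + (\<Sum>d\<in>{1..<int l}. gauss_sum l d * unity_root l (d * m))
     = of_nat l + of_int (int l * Legendre (- m) (int l))"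
    by (simp add: ring_distribs)
  moreover have "gauss_sum l 0 = of_nat l" by (simp add: gauss_sum_def)
  ultimately show ?thesis by simp
qed

text \<open>
  The coset form of \<open>T(l\<^sup>2)\<close> in weight \<open>-1/2\<close>, multiplied by \<open>l\<^sup>3\<close>. The weights in the middle sum
  make it the twist by the Legendre symbol.
\<close>

definition hecke :: "nat \<Rightarrow> (complex \<Rightarrow> complex) \<Rightarrow> complex \<Rightarrow> complex" where
  "hecke l E \<tau> = of_nat l * (\<Sum>c\<in>{0..<int (l\<^sup>2)}. E ((\<tau> + of_int (2 * c)) / of_nat (l\<^sup>2)))
     + (\<Sum>d\<in>{1..<int l}. gauss_sum l d * E (\<tau> + of_int (2 * d) / of_nat l))
     + E (of_nat (l\<^sup>2) * \<tau>)"

text \<open>With an integer index the same formula serves at the cusp 1, where negative exponents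
  occur.\<close>

definition hecke_coeff :: "nat \<Rightarrow> (int \<Rightarrow> complex) \<Rightarrow> int \<Rightarrow> complex" where
  "hecke_coeff l c m = of_nat (l ^ 3) * c (int (l\<^sup>2) * m) + of_int (Legendre (- m) (int l) * int l) * c m
     + (if int (l\<^sup>2) dvd m then c (m div int (l\<^sup>2)) else 0)"

lemma nome_of_int: "nome (of_int m * (of_int (2 * c) / of_nat N)) = unity_root N (c * m)"
  unfolding nome_def unity_root_def cis_conv_exp by (simp add: mult_ac)

lemma has_sum_finite_sum:
  fixes f :: "'a \<Rightarrow> 'b \<Rightarrow> complex"
  assumes "finite A" "\<And>a. a \<in> A \<Longrightarrow> (f a has_sum S a) X"
  shows "((\<lambda>m. \<Sum>a\<in>A. f a m) has_sum (\<Sum>a\<in>A. S a)) X"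
  using assms by (induction A rule: finite_induct) (auto intro!: has_sum_add)

lemma has_sum_multiples:
  fixes f :: "int \<Rightarrow> complex"
  assumes N: "N \<noteq> 0" and f: "\<And>m. \<not> N dvd m \<Longrightarrow> f m = 0"
  shows "(f has_sum S) UNIV \<longleftrightarrow> ((\<lambda>m. f (N * m)) has_sum S) UNIV"
proof -
  have "(f has_sum S) UNIV \<longleftrightarrow> (f has_sum S) (range ((*) N))"
    using f by (intro has_sum_cong_neutral) (auto simp: dvd_def)
  also have "\<dots> \<longleftrightarrow> ((\<lambda>m. f (N * m)) has_sum S) UNIV"
    using N by (subst has_sum_reindex) (auto simp: inj_on_def o_def)
  finally show ?thesis .
qed

text \<open>The sum over residues mod l^2 keeps the exponents divisible by l^2 with weight l^2,
  which with the factor l gives l^3. The middle sum is the Legendre twist by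
  \<open>sum_gauss_sum_unity_root\<close>, and the last term moves the coefficients to the multiples
  of l^2.\<close>

theorem hecke_has_sum:
  fixes l :: nat
  assumes l: "prime l" "odd l" and \<tau>: "Im \<tau> > 0"
    and E: "\<And>\<tau>. Im \<tau> > 0 \<Longrightarrow> ((\<lambda>m. c m * nome (of_int m * \<tau>)) has_sum E \<tau>) UNIV"
  shows "((\<lambda>m. hecke_coeff l c m * nome (of_int m * \<tau>)) has_sum hecke l E \<tau>) UNIV"
proof -
  let ?N = "l\<^sup>2"
  have l0: "l > 0" using l(1) by (rule prime_gt_0_nat)
  have N0: "?N > 0" using l0 by simp
  have U: "((\<lambda>m. of_nat (l ^ 3) * c (int ?N * m) * nome (of_int m * \<tau>))
     has_sum (of_nat l * (\<Sum>j\<in>{0..<int ?N}. E ((\<tau> + of_int (2 * j)) / of_nat ?N)))) UNIV"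
  proof -
    let ?f = "\<lambda>m. (if int ?N dvd m then of_nat ?N else 0) * (c m * nome (of_int m * (\<tau> / of_nat ?N)))"
    have eq: "(\<Sum>j\<in>{0..<int ?N}. c m * nome (of_int m * ((\<tau> + of_int (2 * j)) / of_nat ?N))) = ?f m" for m
    proof -
      have "nome (of_int m * ((\<tau> + of_int (2 * j)) / of_nat ?N))
          = nome (of_int m * (\<tau> / of_nat ?N)) * unity_root ?N (j * m)" for j
        unfolding nome_of_int[symmetric] nome_add[symmetric] by (simp add: add_divide_distrib ring_distribs)
      then show ?thesis
        unfolding sum_unity_root[OF N0, symmetric] by (simp add: sum_distrib_left sum_distrib_right mult_ac)
    qed
    have "((\<lambda>m. \<Sum>j\<in>{0..<int ?N}. c m * nome (of_int m * ((\<tau> + of_int (2 * j)) / of_nat ?N)))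
      has_sum (\<Sum>j\<in>{0..<int ?N}. E ((\<tau> + of_int (2 * j)) / of_nat ?N))) UNIV"
      using \<tau> l0 by (intro has_sum_finite_sum E) (auto simp: Im_divide_of_nat zero_less_divide_iff simp del: of_nat_power)
    then have "(?f has_sum (\<Sum>j\<in>{0..<int ?N}. E ((\<tau> + of_int (2 * j)) / of_nat ?N))) UNIV"
      unfolding eq .
    then have "((\<lambda>m. ?f (int ?N * m)) has_sum (\<Sum>j\<in>{0..<int ?N}. E ((\<tau> + of_int (2 * j)) / of_nat ?N))) UNIV"
      using N0 by (subst (asm) has_sum_multiples[of "int ?N"]) auto
    then have "((\<lambda>m. of_nat l * ?f (int ?N * m)) has_sum (of_nat l * (\<Sum>j\<in>{0..<int ?N}. E ((\<tau> + of_int (2 * j)) / of_nat ?N)))) UNIV"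
      by (rule has_sum_cmult_right)
    moreover have "of_nat l * ?f (int ?N * m) = of_nat (l ^ 3) * c (int ?N * m) * nome (of_int m * \<tau>)" for m
    proof -
      have "of_int (int ?N * m) * (\<tau> / of_nat ?N) = of_int m * \<tau>" using N0 by simp
      then show ?thesis by (simp only:) (simp add: power2_eq_square power3_eq_cube mult_ac)
    qed
    ultimately show ?thesis by (simp only:)
  qed
  have W: "((\<lambda>m. of_int (Legendre (- m) (int l) * int l) * c m * nome (of_int m * \<tau>))
     has_sum (\<Sum>d\<in>{1..<int l}. gauss_sum l d * E (\<tau> + of_int (2 * d) / of_nat l))) UNIV"
  proof -
    have "((\<lambda>m. \<Sum>d\<in>{1..<int l}. gauss_sum l d * (c m * nome (of_int m * (\<tau> + of_int (2 * d) / of_nat l))))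
      has_sum (\<Sum>d\<in>{1..<int l}. gauss_sum l d * E (\<tau> + of_int (2 * d) / of_nat l))) UNIV"
      using \<tau> by (intro has_sum_finite_sum has_sum_cmult_right E) auto
    moreover have "(\<Sum>d\<in>{1..<int l}. gauss_sum l d * (c m * nome (of_int m * (\<tau> + of_int (2 * d) / of_nat l))))
        = of_int (Legendre (- m) (int l) * int l) * c m * nome (of_int m * \<tau>)" for m
    proof -
      have "nome (of_int m * (\<tau> + of_int (2 * d) / of_nat l)) = nome (of_int m * \<tau>) * unity_root l (d * m)" for d
        unfolding nome_of_int[symmetric] nome_add[symmetric] by (simp add: ring_distribs)
      then have "(\<Sum>d\<in>{1..<int l}. gauss_sum l d * (c m * nome (of_int m * (\<tau> + of_int (2 * d) / of_nat l))))
         = c m * nome (of_int m * \<tau>) * (\<Sum>d\<in>{1..<int l}. gauss_sum l d * unity_root l (d * m))"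
        by (simp add: sum_distrib_left mult_ac)
      then show ?thesis unfolding sum_gauss_sum_unity_root[OF l] by (simp add: mult_ac)
    qed
    ultimately show ?thesis by simp
  qed
  have V: "((\<lambda>m. (if int ?N dvd m then c (m div int ?N) else 0) * nome (of_int m * \<tau>)) has_sum E (of_nat ?N * \<tau>)) UNIV"
  proof (subst has_sum_multiples[of "int ?N"])
    have "((\<lambda>m. c m * nome (of_int m * (of_nat ?N * \<tau>))) has_sum E (of_nat ?N * \<tau>)) UNIV"
      using \<tau> N0 by (intro E) (simp flip: of_nat_power)
    then show "((\<lambda>m. (if int ?N dvd int ?N * m then c (int ?N * m div int ?N) else 0) * nome (of_int (int ?N * m) * \<tau>))
       has_sum E (of_nat ?N * \<tau>)) UNIV"
      using N0 by (simp add: mult_ac)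
  qed (use N0 in auto)
  show ?thesis
    using has_sum_add[OF has_sum_add[OF U W] V]
    unfolding hecke_def hecke_coeff_def by (simp add: ring_distribs)
qed

section \<open>The Hecke sum under inversion\<close>

text \<open>The partner of \<open>c\<close> under inversion, taken in \<open>{0..<N}\<close> so that
  it is an involution of the units there and can reindex sums over them.\<close>

definition neg_inv :: "int \<Rightarrow> int \<Rightarrow> int \<Rightarrow> int" where
  "neg_inv N k c = (SOME c'. c' \<in> {0..<N} \<and> [k * c * c' = -1] (mod N))"

lemma neg_inv:
  assumes N: "N > 0" and "coprime k N" "coprime c N"
  shows "neg_inv N k c \<in> {0..<N}" "[k * c * neg_inv N k c = -1] (mod N)"
proof -
  have "coprime (k * c) N" using assms by simp
  then obtain x where x: "[k * c * x = 1] (mod N)" using cong_solve_coprime_int by blast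
  have "[k * c * ((- x) mod N) = k * c * (- x)] (mod N)"
    by (intro cong_mult cong_refl) simp
  also have "k * c * (- x) = - (k * c * x)" by simp
  also have "[\<dots> = -1] (mod N)" using x by (rule cong_minus_minus_iff[THEN iffD2])
  finally have "\<exists>c'. c' \<in> {0..<N} \<and> [k * c * c' = -1] (mod N)" using N by (intro exI[of _ "(- x) mod N"]) auto
  from someI_ex[OF this] show "neg_inv N k c \<in> {0..<N}" "[k * c * neg_inv N k c = -1] (mod N)"
    unfolding neg_inv_def by blast+
qed

lemma coprime_if_cong_minus_1: "[x * y = -1] (mod N) \<Longrightarrow> coprime y (N::int)"
proof -
  assume "[x * y = -1] (mod N)"
  then have "[x * y = -1] (mod N)" "coprime (-1) N" by simp_all
  then have "coprime (x * y) N" by (metis cong_imp_coprime cong_sym)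
  then show ?thesis by simp
qed

lemma neg_inv_involution:
  assumes N: "N > 0" and k: "coprime k N" and c: "c \<in> {0..<N}" "coprime c N"
  shows "coprime (neg_inv N k c) N" "neg_inv N k (neg_inv N k c) = c"
proof -
  let ?c = "neg_inv N k c"
  note c' = neg_inv[OF N k c(2)]
  show cop: "coprime ?c N" by (rule coprime_if_cong_minus_1[OF c'(2)])
  note c'' = neg_inv[OF N k cop]
  have "[k * ?c * neg_inv N k ?c = k * ?c * c] (mod N)"
    using c''(2) c'(2) by (metis cong_sym cong_trans mult.assoc mult.commute)
  then have "[neg_inv N k ?c = c] (mod N)"
    using k cop by (subst (asm) cong_mult_lcancel) auto
  then show "neg_inv N k ?c = c" using c''(1) c(1) by (intro cong_less_imp_eq_int[of _ N]) auto
qed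

lemma sum_units_neg_inv:
  fixes f :: "int \<Rightarrow> complex"
  assumes "N > 0" "coprime k N"
  shows "(\<Sum>c\<in>{c\<in>{0..<N}. coprime c N}. f (neg_inv N k c)) = (\<Sum>c\<in>{c\<in>{0..<N}. coprime c N}. f c)"
  using assms by (intro sum.reindex_bij_witness[of _ "neg_inv N k" "neg_inv N k"])
    (use neg_inv(1)[of N k] in \<open>auto simp: neg_inv_involution\<close>)

text \<open>Two applications of the inversion formula return to the same value of \<open>theta\<close>.\<close>

lemma gauss_sum_mult_neg_inv:
  fixes N :: nat
  assumes N: "N > 0" and cc: "[4 * c * c' = -1] (mod int N)"
  shows "gauss_sum N c * gauss_sum N c' = of_nat N"
proof -
  \<comment> \<open>Chosen so that -1 / (N^2 \<sigma>) is \<i>: inverting from \<open>?x\<close>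
    leads to \<sigma> + 2 c' / N, and the inversion formula at \<i> leads back. The two automorphy
    factors multiply to 1 / N, and \<open>theta ?x\<close> cancels as it is nonzero.\<close>
  define \<sigma> where "\<sigma> = - 1 / (of_nat (N\<^sup>2) * \<i>)"
  have \<sigma>: "Im \<sigma> > 0" unfolding \<sigma>_def using N by (intro Im_minus_inverse_pos) (simp flip: of_nat_power)
  have inv: "- 1 / (of_nat N ^ 2 * \<sigma>) = \<i>" using N by (simp add: \<sigma>_def)
  let ?x = "\<i> + of_int (2 * c) / of_nat N"
  have "of_int (2 * c) / of_nat N - 1 / (of_nat N ^ 2 * \<sigma>) = ?x" using inv by (simp add: diff_conv_add_uminus add.commute)
  then have "theta ?x = csq \<sigma> * gauss_sum N c * theta (\<sigma> + of_int (2 * c') / of_nat N)"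
    using theta_inversion[OF N cc \<sigma>] by (simp only:)
  also have "theta (\<sigma> + of_int (2 * c') / of_nat N) = csq \<i> * gauss_sum N c' * theta ?x"
  proof -
    have "\<sigma> + of_int (2 * c') / of_nat N = of_int (2 * c') / of_nat N - 1 / (of_nat N ^ 2 * \<i>)"
      by (simp add: \<sigma>_def)
    then show ?thesis using theta_inversion[OF N, of c' c \<i>] cc by (simp only: mult_ac) simp
  qed
  also have "csq \<sigma> * gauss_sum N c * \<dots> = (csq \<i> * csq \<sigma>) * (gauss_sum N c * gauss_sum N c') * theta ?x"
    by (simp add: mult_ac)
  also have "csq \<i> * csq \<sigma> = 1 / of_nat N"
    using csq_inverse[of \<i> "of_nat N"] N by (simp add: \<sigma>_def)
  finally have "1 * theta ?x = 1 / of_nat N * (gauss_sum N c * gauss_sum N c') * theta ?x"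
    by (simp only: mult_1)
  then have "1 = 1 / of_nat N * (gauss_sum N c * gauss_sum N c')"
    by (subst (asm) mult_right_cancel) (auto simp: theta_nonzero)
  then show ?thesis using N by (simp add: field_simps)
qed

text \<open>Inversion permutes the terms of the Hecke sum: the units mod l^2 stay among themselves,
  the nonzero multiples of l in the first sum are exchanged with the middle sum, and residue 0 is
  exchanged with the last term. A pair \<open>A\<close>, \<open>B\<close> covers both uses:
  \<open>invtheta\<close> with itself (k = 4) and the passage to the cusp 1 (k = 16, \<kappa> = 1 /
  4).\<close>

theorem hecke_inversion:
  fixes l :: nat and A B :: "complex \<Rightarrow> complex" and \<kappa> :: complex and k :: int
  assumes l: "prime l" "odd l" and k: "coprime k (int l)" and \<sigma>: "Im \<sigma> > 0"
    and AB: "\<And>N c c' \<sigma>. \<lbrakk>odd N; [k * c * c' = -1] (mod int N); Im \<sigma> > 0\<rbrakk> \<Longrightarrow>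
      A (of_int (2 * c) / of_nat N - 1 / (of_nat N ^ 2 * \<sigma>)) * (csq \<sigma> * gauss_sum N c)
        = B (\<kappa> * \<sigma> + of_int (2 * c') / of_nat N)"
    and GG: "\<And>c c'. [k * c * c' = -1] (mod int l) \<Longrightarrow> gauss_sum l c * gauss_sum l c' = of_nat l"
  shows "hecke l A (- 1 / \<sigma>) * csq \<sigma> = hecke l B (\<kappa> * \<sigma>)"
proof -
  let ?l = "of_nat l :: complex" and ?n = "int l"
  let ?a = "\<lambda>c::int. A ((- 1 / \<sigma> + of_int (2 * c)) / of_nat (l\<^sup>2))"
    and ?b = "\<lambda>c::int. B ((\<kappa> * \<sigma> + of_int (2 * c)) / of_nat (l\<^sup>2))"
    and ?a' = "\<lambda>d::int. A (- 1 / \<sigma> + of_int (2 * d) / ?l)"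
    and ?b' = "\<lambda>d::int. B (\<kappa> * \<sigma> + of_int (2 * d) / ?l)"
  have l0: "l > 0" using l(1) by (rule prime_gt_0_nat)
  have lz: "?l \<noteq> 0" "\<sigma> \<noteq> 0" using l0 \<sigma> by auto
  define U where "U = {c\<in>{0..<int (l\<^sup>2)}. coprime c (int (l\<^sup>2))}"
  have units: "{c\<in>{0..<?n}. coprime c ?n} = {1..<?n}"
  proof (intro equalityI subsetI)
    fix c assume "c \<in> {c\<in>{0..<?n}. coprime c ?n}"
    then have c: "0 \<le> c" "c < ?n" "coprime c ?n" by auto
    moreover have "c \<noteq> 0" using c l by auto
    ultimately show "c \<in> {1..<?n}" by simp
  next
    fix c assume c: "c \<in> {1..<?n}"
    then have "\<not> ?n dvd c" using zdvd_not_zless by auto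
    then have "coprime c ?n" using l by (metis coprime_commute prime_imp_coprime prime_nat_int_transfer)
    then show "c \<in> {c\<in>{0..<?n}. coprime c ?n}" using c by auto
  qed
  have split: "(\<Sum>c\<in>{0..<int (l\<^sup>2)}. f c) = (\<Sum>c\<in>U. f c) + (\<Sum>c\<in>{1..<?n}. f (?n * c)) + f 0" for f :: "int \<Rightarrow> complex"
  proof -
    have "{0..<int (l\<^sup>2)} = U \<union> (insert 0 ((\<lambda>c. ?n * c) ` {1..<?n}))"
    proof (intro equalityI subsetI)
      fix c assume c: "c \<in> {0..<int (l\<^sup>2)}"
      show "c \<in> U \<union> (insert 0 ((\<lambda>c. ?n * c) ` {1..<?n}))"
      proof (cases "?n dvd c")
        case True
        then obtain j where j: "c = ?n * j" ..
        have "0 \<le> ?n * j" "?n * j < ?n * ?n" using c unfolding j by (simp_all add: power2_eq_square)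
        then have "0 \<le> j" "j < ?n" using l0 by (simp_all add: zero_le_mult_iff)
        then have "j = 0 \<or> j \<in> {1..<?n}" by auto
        then show ?thesis using j by auto
      next
        case False
        then have "coprime c ?n" using l by (metis coprime_commute prime_imp_coprime prime_nat_int_transfer)
        then show ?thesis using c by (auto simp: U_def)
      qed
    next
      fix c assume "c \<in> U \<union> (insert 0 ((\<lambda>c. ?n * c) ` {1..<?n}))"
      then show "c \<in> {0..<int (l\<^sup>2)}" using l0 by (auto simp: U_def power2_eq_square)
    qed
    moreover have "U \<inter> (insert 0 ((\<lambda>c. ?n * c) ` {1..<?n})) = {}"
      using l by (auto simp: U_def)
    moreover have "inj_on (\<lambda>c. ?n * c) {1..<?n}" using l0 by (simp add: inj_on_def)
    moreover have "0 \<notin> (\<lambda>c. ?n * c) ` {1..<?n}" using l0 by auto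
    moreover have "finite U" unfolding U_def by (rule finite_subset[of _ "{0..<int (l\<^sup>2)}"]) auto
    ultimately show ?thesis by (simp add: sum.union_disjoint sum.reindex)
  qed
  \<comment> \<open>\<open>AB\<close> will be used with N = l^2 at \<sigma> / l^2 for the units,
    with N = l at \<sigma> for the multiples of l and at \<sigma> / l^2 for the middle sum, and with
    N = 1 at l^2 \<sigma> and \<sigma> / l^2 for the two single terms.\<close>
  have csq_div: "csq (\<sigma> / ?l\<^sup>2) = csq \<sigma> / ?l" and csq_mult: "csq (?l\<^sup>2 * \<sigma>) = ?l * csq \<sigma>"
    using csq_scale[of "of_nat l" "\<sigma> / ?l\<^sup>2"] csq_scale[of "of_nat l" \<sigma>] l0 \<sigma> lz
    by (simp_all add: field_simps Im_divide_of_nat flip: of_nat_power)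
  have Im_div: "Im (\<sigma> / ?l\<^sup>2) > 0" and Im_mult: "Im (?l\<^sup>2 * \<sigma>) > 0"
    using \<sigma> l0 by (simp_all add: Im_divide_of_nat flip: of_nat_power)
  have a: "(\<Sum>c\<in>U. ?a c) * csq \<sigma>
      = (\<Sum>c\<in>U. ?b c)"
  proof -
    have "?a c * csq \<sigma>
       = ?b (neg_inv (int (l\<^sup>2)) k c)" if c: "c \<in> U" for c
    proof -
      have "[k * c * neg_inv (int (l\<^sup>2)) k c = -1] (mod int (l\<^sup>2))"
        using c k l0 by (intro neg_inv) (auto simp: U_def)
      from AB[OF _ this Im_div] have "A (of_int (2 * c) / of_nat (l\<^sup>2) - 1 / (of_nat (l\<^sup>2) ^ 2 * (\<sigma> / ?l\<^sup>2)))
          * (csq (\<sigma> / ?l\<^sup>2) * gauss_sum (l\<^sup>2) c)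
        = B (\<kappa> * (\<sigma> / ?l\<^sup>2) + of_int (2 * neg_inv (int (l\<^sup>2)) k c) / of_nat (l\<^sup>2))"
        using l by simp
      moreover have "gauss_sum (l\<^sup>2) c = ?l"
        using c l by (intro gauss_sum_square) (auto simp: U_def)
      moreover have "of_int (2 * c) / of_nat (l\<^sup>2) - 1 / (of_nat (l\<^sup>2) ^ 2 * (\<sigma> / ?l\<^sup>2))
          = (- 1 / \<sigma> + of_int (2 * c)) / of_nat (l\<^sup>2)"
        using lz by (simp add: field_simps power2_eq_square)
      moreover have "\<kappa> * (\<sigma> / ?l\<^sup>2) + of_int (2 * neg_inv (int (l\<^sup>2)) k c) / of_nat (l\<^sup>2)
          = (\<kappa> * \<sigma> + of_int (2 * neg_inv (int (l\<^sup>2)) k c)) / of_nat (l\<^sup>2)"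
        by (simp add: add_divide_distrib)
      ultimately show ?thesis using lz by (simp only: csq_div) simp
    qed
    then have "(\<Sum>c\<in>U. ?a c) * csq \<sigma>
       = (\<Sum>c\<in>U. ?b (neg_inv (int (l\<^sup>2)) k c))"
      unfolding sum_distrib_right by (intro sum.cong refl)
    also have "\<dots> = (\<Sum>c\<in>U. ?b c)"
      unfolding U_def using k l0
      by (intro sum_units_neg_inv[where f = "\<lambda>c. ?b c"]) auto
    finally show ?thesis .
  qed
  have nl: "[k * c * neg_inv ?n k c = -1] (mod ?n)" if "c \<in> {1..<?n}" for c
    using that k l0 by (intro neg_inv) (auto simp flip: units)
  have b: "?l * (\<Sum>c\<in>{1..<?n}. ?a (?n * c)) * csq \<sigma>
      = (\<Sum>d\<in>{1..<?n}. gauss_sum l d * ?b' d)"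
  proof -
    have "?l * ?a (?n * c) * csq \<sigma>
       = gauss_sum l (neg_inv ?n k c) * ?b' (neg_inv ?n k c)" if c: "c \<in> {1..<?n}" for c
    proof -
      have "of_int (2 * c) / ?l - 1 / (?l ^ 2 * \<sigma>) = (- 1 / \<sigma> + of_int (2 * (?n * c))) / of_nat (l\<^sup>2)"
        using lz by (simp add: field_simps power2_eq_square)
      then have "?a (?n * c) * (csq \<sigma> * gauss_sum l c)
         = ?b' (neg_inv ?n k c)"
        using AB[OF l(2) nl[OF c] \<sigma>] by simp
      \<comment> \<open>Multiplying by the Gauss sum of the partner makes the product of the two
        available, which is the factor l standing before the first sum.\<close>
      then have "gauss_sum l (neg_inv ?n k c) * ?b' (neg_inv ?n k c)
         = ?a (?n * c) * csq \<sigma> * (gauss_sum l c * gauss_sum l (neg_inv ?n k c))"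
        by (metis mult.assoc mult.commute)
      then show ?thesis unfolding GG[OF nl[OF c]] by (simp add: mult_ac)
    qed
    then have "?l * (\<Sum>c\<in>{1..<?n}. ?a (?n * c)) * csq \<sigma>
       = (\<Sum>c\<in>{1..<?n}. gauss_sum l (neg_inv ?n k c) * ?b' (neg_inv ?n k c))"
      unfolding sum_distrib_left sum_distrib_right by (intro sum.cong refl)
    also have "\<dots> = (\<Sum>d\<in>{1..<?n}. gauss_sum l d * ?b' d)"
      unfolding units[symmetric] using k l0
      by (intro sum_units_neg_inv[where f = "\<lambda>d. gauss_sum l d * ?b' d"]) auto
    finally show ?thesis .
  qed
  have c: "?l * ?a 0 * csq \<sigma> = B (of_nat (l\<^sup>2) * (\<kappa> * \<sigma>))"
  proof -
    \<comment> \<open>Modulo N = 1 the congruence holds for c = c' = 0, so \<open>AB\<close> is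
      plain inversion there.\<close>
    have "A (- 1 / (?l\<^sup>2 * \<sigma>)) * csq (?l\<^sup>2 * \<sigma>) = B (\<kappa> * (?l\<^sup>2 * \<sigma>))"
      using AB[of 1 0 0, OF _ _ Im_mult] by simp
    moreover have "- 1 / (?l\<^sup>2 * \<sigma>) = (- 1 / \<sigma> + of_int (2 * 0)) / of_nat (l\<^sup>2)"
      using lz by (simp add: field_simps)
    ultimately show ?thesis unfolding csq_mult by (simp add: mult_ac)
  qed
  have d: "(\<Sum>d\<in>{1..<?n}. gauss_sum l d * ?a' d) * csq \<sigma>
      = ?l * (\<Sum>c\<in>{1..<?n}. ?b (?n * c))"
  proof -
    have "gauss_sum l d * ?a' d * csq \<sigma>
       = ?l * ?b (?n * neg_inv ?n k d)" if d: "d \<in> {1..<?n}" for d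
    proof -
      have "of_int (2 * d) / ?l - 1 / (?l ^ 2 * (\<sigma> / ?l\<^sup>2)) = - 1 / \<sigma> + of_int (2 * d) / ?l"
        using lz by simp
      moreover have "\<kappa> * (\<sigma> / ?l\<^sup>2) + of_int (2 * neg_inv ?n k d) / ?l
         = (\<kappa> * \<sigma> + of_int (2 * (?n * neg_inv ?n k d))) / of_nat (l\<^sup>2)"
        using lz by (simp add: field_simps power2_eq_square)
      ultimately have "?a' d * (csq \<sigma> / ?l * gauss_sum l d)
         = ?b (?n * neg_inv ?n k d)"
        using AB[OF l(2) nl[OF d] Im_div] by (simp only: csq_div)
      then show ?thesis using lz by (simp add: field_simps)
    qed
    then have "(\<Sum>d\<in>{1..<?n}. gauss_sum l d * ?a' d) * csq \<sigma>
       = (\<Sum>d\<in>{1..<?n}. ?l * ?b (?n * neg_inv ?n k d))"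
      unfolding sum_distrib_right by (intro sum.cong refl)
    also have "\<dots> = (\<Sum>d\<in>{1..<?n}. ?l * ?b (?n * d))"
      unfolding units[symmetric] using k l0
      by (intro sum_units_neg_inv[where f = "\<lambda>d. ?l * ?b (?n * d)"]) auto
    finally show ?thesis by (simp add: sum_distrib_left)
  qed
  have e: "A (of_nat (l\<^sup>2) * (- 1 / \<sigma>)) * csq \<sigma> = ?l * ?b 0"
  proof -
    have "A (- 1 / (\<sigma> / ?l\<^sup>2)) * csq (\<sigma> / ?l\<^sup>2) = B (\<kappa> * (\<sigma> / ?l\<^sup>2))"
      using AB[of 1 0 0, OF _ _ Im_div] by simp
    then show ?thesis using lz unfolding csq_div by (simp add: field_simps)
  qed
  have "hecke l A (- 1 / \<sigma>) * csq \<sigma>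
     = ?l * ((\<Sum>c\<in>U. ?a c) * csq \<sigma>)
       + ?l * (\<Sum>c\<in>{1..<?n}. ?a (?n * c)) * csq \<sigma>
       + ?l * ?a 0 * csq \<sigma>
       + (\<Sum>d\<in>{1..<?n}. gauss_sum l d * ?a' d) * csq \<sigma>
       + A (of_nat (l\<^sup>2) * (- 1 / \<sigma>)) * csq \<sigma>"
    unfolding hecke_def split by (simp only: ring_distribs mult_ac)
  also have "\<dots> = hecke l B (\<kappa> * \<sigma>)"
    unfolding a b c d e unfolding hecke_def split by (simp only: ring_distribs mult_ac add_ac)
  finally show ?thesis .
qed

section \<open>The Hecke operator on the reciprocal of theta\<close>

definition invtheta :: "complex \<Rightarrow> complex" where "invtheta \<tau> = inverse (theta \<tau>)"

text \<open>The factor \<open>4\<close> makes all exponents integral, so that the same Hecke operator applies at both cusps.\<close>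

definition invtheta2 :: "complex \<Rightarrow> complex" where "invtheta2 \<tau> = inverse (theta2 (4 * \<tau>))"

lemma Im_theta_argument:
  assumes "N > 0" "Im \<sigma> > 0"
  shows "Im (of_int (2 * c) / of_nat N - 1 / (of_nat N ^ 2 * \<sigma>)) > 0"
proof -
  have "Im (- 1 / (of_nat (N\<^sup>2) * \<sigma>)) > 0"
    using assms by (intro Im_minus_inverse_pos) (simp flip: of_nat_power)
  then show ?thesis by simp
qed

lemma inverse_mult_cancel: "x = a * y \<Longrightarrow> x \<noteq> 0 \<Longrightarrow> inverse x * a = inverse (y :: complex)"
  by (auto simp: field_simps)

lemma hecke_invtheta_inversion:
  assumes l: "prime l" "odd l" and \<sigma>: "Im \<sigma> > 0"
  shows "hecke l invtheta (- 1 / \<sigma>) * csq \<sigma> = hecke l invtheta \<sigma>"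
proof -
  have "hecke l invtheta (- 1 / \<sigma>) * csq \<sigma> = hecke l invtheta (1 * \<sigma>)"
  proof (rule hecke_inversion[OF l _ \<sigma>, where k = 4])
    show "coprime 4 (int l)" using l(2) by (simp add: coprime_left_2_iff_odd flip: power2_eq_square
        add: coprime_power_left_iff[of 2 2, simplified])
    show "gauss_sum l c * gauss_sum l c' = of_nat l" if "[4 * c * c' = -1] (mod int l)" for c c'
      using that prime_gt_0_nat[OF l(1)] by (intro gauss_sum_mult_neg_inv)
    fix N :: nat and c c' :: int and \<sigma> :: complex
    assume N: "odd N" and cc: "[4 * c * c' = -1] (mod int N)" and \<sigma>: "Im \<sigma> > 0"
    have N0: "N > 0" using N by (rule odd_pos)
    show "invtheta (of_int (2 * c) / of_nat N - 1 / (of_nat N ^ 2 * \<sigma>)) * (csq \<sigma> * gauss_sum N c)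
        = invtheta (1 * \<sigma> + of_int (2 * c') / of_nat N)"
      unfolding invtheta_def mult_1
      by (rule inverse_mult_cancel[OF theta_inversion[OF N0 cc \<sigma>] theta_nonzero[OF Im_theta_argument[OF N0 \<sigma>]]])
  qed
  then show ?thesis by simp
qed

lemma hecke_invtheta_one_inversion:
  assumes l: "prime l" "odd l" and \<sigma>: "Im \<sigma> > 0"
  shows "hecke l (\<lambda>\<tau>. invtheta (\<tau> + 1)) (- 1 / \<sigma>) * csq \<sigma> = hecke l invtheta2 (\<sigma> / 4)"
proof -
  have "hecke l (\<lambda>\<tau>. invtheta (\<tau> + 1)) (- 1 / \<sigma>) * csq \<sigma> = hecke l invtheta2 (1 / 4 * \<sigma>)"
  proof (rule hecke_inversion[OF l _ \<sigma>, where k = 16])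
    show "coprime 16 (int l)" using l(2) coprime_power_left_iff[of 2 4 "int l"] by simp
    \<comment> \<open>Reads 16 c c' as 4 c (4 c'); for odd l a factor 4 does not change the Gauss
      sum.\<close>
    show "gauss_sum l c * gauss_sum l c' = of_nat l" if "[16 * c * c' = -1] (mod int l)" for c c'
      using that prime_gt_0_nat[OF l(1)] gauss_sum_mult_neg_inv[of l c "4 * c'"]
      unfolding gauss_sum_times_4[OF l(2)] by (simp add: mult_ac)
    fix N :: nat and c c' :: int and \<sigma> :: complex
    assume N: "odd N" and cc: "[16 * c * c' = -1] (mod int N)" and \<sigma>: "Im \<sigma> > 0"
    have N0: "N > 0" using N by (rule odd_pos)
    let ?x = "of_int (2 * c) / of_nat N - 1 / (of_nat N ^ 2 * \<sigma>)"
    have "theta (?x + 1) \<noteq> 0" using Im_theta_argument[OF N0 \<sigma>, of c] by (intro theta_nonzero) simp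
    from inverse_mult_cancel[OF theta_one_inversion[OF N cc \<sigma>] this]
    have "invtheta (?x + 1) * (csq \<sigma> * gauss_sum N c) = inverse (theta2 (\<sigma> + of_int (8 * c') / of_nat N))"
      unfolding invtheta_def .
    also have "\<sigma> + of_int (8 * c') / of_nat N = 4 * (1 / 4 * \<sigma> + of_int (2 * c') / of_nat N)" by simp
    finally show "invtheta (?x + 1) * (csq \<sigma> * gauss_sum N c) = invtheta2 (1 / 4 * \<sigma> + of_int (2 * c') / of_nat N)"
      unfolding invtheta2_def .
  qed
  then show ?thesis by simp
qed

section \<open>Expansions of the Hecke image at both cusps\<close>

lemma eval_fps_has_sum:
  fixes f :: "complex fps"
  assumes "fps_conv_radius f \<ge> 1" "norm q < 1"
  shows "((\<lambda>n. fps_nth f n * q ^ n) has_sum eval_fps f q) UNIV"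
proof (rule norm_summable_imp_has_sum)
  show "summable (\<lambda>n. norm (fps_nth f n * q ^ n))"
    using assms by (intro norm_summable_fps) (auto simp: less_conv_radius)
  show "(\<lambda>n. fps_nth f n * q ^ n) sums eval_fps f q"
    using assms by (intro sums_eval_fps) (auto simp: less_conv_radius)
qed

text \<open>The nome takes every value r with 0 < r < 1, so convergence on the half-plane settles
  the radius.\<close>

lemma has_sum_imp_eval_fps:
  assumes "\<And>\<tau>. Im \<tau> > 0 \<Longrightarrow> ((\<lambda>n::nat. f n * nome \<tau> ^ n) has_sum S \<tau>) UNIV"
  shows "fps_conv_radius (Abs_fps f) \<ge> 1"
    and "Im \<tau> > 0 \<Longrightarrow> S \<tau> = eval_fps (Abs_fps f) (nome \<tau>)"
proof -
  show "fps_conv_radius (Abs_fps f) \<ge> 1"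
    unfolding fps_conv_radius_def fps_nth_Abs_fps
  proof (rule conv_radius_geI_ex')
    fix r :: real assume r: "0 < r" "ereal r < 1"
    obtain \<tau> where "Im \<tau> > 0" "nome \<tau> = of_real r"
      using nome_surj[of "of_real r"] r by auto
    then show "summable (\<lambda>n. f n * of_real r ^ n)"
      using has_sum_imp_sums[OF assms] sums_summable by metis
  qed
  show "S \<tau> = eval_fps (Abs_fps f) (nome \<tau>)" if "Im \<tau> > 0"
    using has_sum_imp_sums[OF assms[OF that]] by (simp add: eval_fps_def sums_iff)
qed

lemma has_sum_int_reindex_nat:
  fixes g :: "int \<Rightarrow> complex" and h :: "nat \<Rightarrow> int"
  assumes "inj h" "\<And>m. m \<notin> range h \<Longrightarrow> g m = 0"
  shows "(g has_sum S) UNIV \<longleftrightarrow> ((\<lambda>n. g (h n)) has_sum S) UNIV"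
proof -
  have "(g has_sum S) UNIV \<longleftrightarrow> (g has_sum S) (range h)"
    using assms(2) by (intro has_sum_cong_neutral) auto
  also have "\<dots> \<longleftrightarrow> ((\<lambda>n. g (h n)) has_sum S) UNIV"
    using assms(1) by (subst has_sum_reindex) (auto simp: o_def)
  finally show ?thesis .
qed

definition invtheta_coeff :: "int \<Rightarrow> complex" where
  "invtheta_coeff m = (if m \<ge> 0 then fps_nth invtheta_fps (nat m) else 0)"

lemma nome_int_nat: "nome (of_int (int n) * \<tau>) = nome \<tau> ^ n"
  using nome_mult_nat[of n \<tau>] by simp

lemma not_in_range_int: "m \<notin> range int \<Longrightarrow> m < 0"
  by (metis int_nat_eq linorder_not_less rangeI)

lemma invtheta_has_sum:
  assumes "Im \<tau> > 0"
  shows "((\<lambda>m. invtheta_coeff m * nome (of_int m * \<tau>)) has_sum invtheta \<tau>) UNIV"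
proof (subst has_sum_int_reindex_nat[of int])
  show "((\<lambda>n. invtheta_coeff (int n) * nome (of_int (int n) * \<tau>)) has_sum invtheta \<tau>) UNIV"
    using eval_fps_has_sum[OF invtheta_fps_conv_radius norm_nome_less_1[OF assms]]
    unfolding nome_int_nat invtheta_coeff_def invtheta_def inverse_theta_eq_eval_fps[OF assms] by simp
qed (auto simp: invtheta_coeff_def dest: not_in_range_int)

text \<open>Since \<open>theta2 (4 * \<tau>)\<close> is 2 \<open>nome \<tau>\<close> times psi at
  \<open>nome (8 * \<tau>)\<close>, the exponents start at -1 in steps of 8, and the 2 leaves
  halves.\<close>

definition invtheta2_coeff :: "int \<Rightarrow> complex" where
  "invtheta2_coeff m = (if m \<ge> -1 \<and> 8 dvd m + 1 then fps_nth (inverse psi_fps) (nat ((m + 1) div 8)) / 2 else 0)"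

lemma invtheta2_has_sum:
  assumes "Im \<tau> > 0"
  shows "((\<lambda>m. invtheta2_coeff m * nome (of_int m * \<tau>)) has_sum invtheta2 \<tau>) UNIV"
proof (subst has_sum_int_reindex_nat[of "\<lambda>n. 8 * int n - 1"])
  have Im4: "Im (4 * \<tau>) > 0" "Im (8 * \<tau>) > 0" using assms by simp_all
  have "((\<lambda>n. (inverse (nome \<tau>) / 2) * (fps_nth (inverse psi_fps) n * nome (8 * \<tau>) ^ n))
     has_sum ((inverse (nome \<tau>) / 2) * eval_fps (inverse psi_fps) (nome (8 * \<tau>)))) UNIV"
    by (intro has_sum_cmult_right eval_fps_has_sum inverse_psi_fps_conv_radius norm_nome_less_1[OF Im4(2)])
  moreover have "(inverse (nome \<tau>) / 2) * eval_fps (inverse psi_fps) (nome (8 * \<tau>)) = invtheta2 \<tau>"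
    unfolding invtheta2_def theta2_eq_eval_fps[OF Im4(1)] eval_inverse_psi_fps[OF norm_nome_less_1[OF Im4(2)]]
    by simp
  moreover have "(inverse (nome \<tau>) / 2) * (fps_nth (inverse psi_fps) n * nome (8 * \<tau>) ^ n)
      = invtheta2_coeff (8 * int n - 1) * nome (of_int (8 * int n - 1) * \<tau>)" for n
  proof -
    have "nome (of_int (8 * int n - 1) * \<tau>) * nome \<tau> = nome (8 * \<tau>) ^ n"
      unfolding nome_add[symmetric] nome_mult_nat[symmetric] by (simp add: algebra_simps)
    then have "nome (of_int (8 * int n - 1) * \<tau>) = nome (8 * \<tau>) ^ n * inverse (nome \<tau>)"
      by (simp add: field_simps)
    then show ?thesis by (simp add: invtheta2_coeff_def)
  qed
  ultimately show "((\<lambda>n. invtheta2_coeff (8 * int n - 1) * nome (of_int (8 * int n - 1) * \<tau>)) has_sum invtheta2 \<tau>) UNIV"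
    by simp
  show "invtheta2_coeff m * nome (of_int m * \<tau>) = 0" if "m \<notin> range (\<lambda>n. 8 * int n - 1)" for m
  proof -
    have "\<not> (m \<ge> -1 \<and> 8 dvd m + 1)"
    proof
      assume m: "m \<ge> -1 \<and> 8 dvd m + 1"
      then have "m = 8 * int (nat ((m + 1) div 8)) - 1" by auto
      then show False using that by blast
    qed
    then show ?thesis unfolding invtheta2_coeff_def by (simp only: if_False mult_zero_left)
  qed
qed (auto simp: inj_on_def)

text \<open>As l^2 is odd, multiplying or dividing an index by it preserves the parity.\<close>

lemma hecke_coeff_twist:
  assumes "odd l"
  shows "hecke_coeff l (\<lambda>m. unity_root 2 m * c m) m = unity_root 2 m * hecke_coeff l c m"
proof -
  have *: "unity_root 2 (int (l\<^sup>2) * m) = unity_root 2 m" for m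
    using assms by (intro unity_root_cong) (auto simp: cong_iff_dvd_diff)
  have "unity_root 2 (m div int (l\<^sup>2)) = unity_root 2 m" if "int (l\<^sup>2) dvd m"
    using *[of "m div int (l\<^sup>2)"] that by simp
  then show ?thesis unfolding hecke_coeff_def * by (simp add: algebra_simps)
qed

text \<open>On expansions, \<tau> \<mapsto> \<tau> + 1 multiplies coefficient m by (-1)^m, which
  commutes with \<open>hecke_coeff\<close> by \<open>hecke_coeff_twist\<close>. Both sides are
  therefore sums of the same series.\<close>

lemma hecke_invtheta_add_1:
  assumes l: "prime l" "odd l" and \<tau>: "Im \<tau> > 0"
  shows "hecke l invtheta (\<tau> + 1) = hecke l (\<lambda>\<tau>. invtheta (\<tau> + 1)) \<tau>"
proof -
  have n1: "nome (of_int m * (\<tau> + 1)) = unity_root 2 m * nome (of_int m * \<tau>)" for m \<tau>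
    using nome_of_int[of m 1 2] nome_add[of "of_int m * \<tau>" "of_int m"] by (simp add: algebra_simps)
  have "((\<lambda>m. hecke_coeff l invtheta_coeff m * nome (of_int m * (\<tau> + 1))) has_sum hecke l invtheta (\<tau> + 1)) UNIV"
    using l \<tau> by (intro hecke_has_sum invtheta_has_sum) auto
  moreover have "((\<lambda>m. hecke_coeff l (\<lambda>m. unity_root 2 m * invtheta_coeff m) m * nome (of_int m * \<tau>))
      has_sum hecke l (\<lambda>\<tau>. invtheta (\<tau> + 1)) \<tau>) UNIV"
  proof (intro hecke_has_sum l \<tau>)
    fix \<tau> :: complex assume "Im \<tau> > 0"
    then have "((\<lambda>m. invtheta_coeff m * nome (of_int m * (\<tau> + 1))) has_sum invtheta (\<tau> + 1)) UNIV"
      by (intro invtheta_has_sum) simp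
    then show "((\<lambda>m. unity_root 2 m * invtheta_coeff m * nome (of_int m * \<tau>)) has_sum invtheta (\<tau> + 1)) UNIV"
      unfolding n1 by (simp add: mult_ac)
  qed
  ultimately show ?thesis
    unfolding n1 hecke_coeff_twist[OF l(2)] by (auto simp: mult_ac intro: has_sum_unique)
qed

theorem hecke_invtheta_cusp:
  assumes l: "prime l" "odd l" and \<sigma>: "Im \<sigma> > 0"
  shows "hecke l invtheta (1 - 1 / \<sigma>) * csq \<sigma> = hecke l invtheta2 (\<sigma> / 4)"
  using hecke_invtheta_add_1[OF l Im_minus_inverse_pos[OF \<sigma>]] hecke_invtheta_one_inversion[OF l \<sigma>]
  by (simp add: add.commute)

definition hecke_fps :: "nat \<Rightarrow> complex fps" where
  "hecke_fps l = Abs_fps (\<lambda>n. hecke_coeff l invtheta_coeff (int n))"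

lemma hecke_fps_conv_radius: "prime l \<Longrightarrow> odd l \<Longrightarrow> fps_conv_radius (hecke_fps l) \<ge> 1"
  and hecke_invtheta_eq_eval_fps:
    "prime l \<Longrightarrow> odd l \<Longrightarrow> Im \<tau> > 0 \<Longrightarrow> hecke l invtheta \<tau> = eval_fps (hecke_fps l) (nome \<tau>)"
proof -
  assume l: "prime l" "odd l"
  have l2: "int (l\<^sup>2) > 0" using prime_gt_0_nat[OF l(1)] by simp
  have neg: "hecke_coeff l invtheta_coeff m = 0" if "m < 0" for m
  proof -
    have "int (l\<^sup>2) * m < 0" using that l2 by (simp add: mult_pos_neg)
    moreover have "m div int (l\<^sup>2) < 0" using that pos_imp_zdiv_neg_iff[OF l2] by (simp only:)
    ultimately show ?thesis using that by (simp add: hecke_coeff_def invtheta_coeff_def)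
  qed
  have *: "((\<lambda>n::nat. hecke_coeff l invtheta_coeff (int n) * nome \<tau> ^ n) has_sum hecke l invtheta \<tau>) UNIV"
    if "Im \<tau> > 0" for \<tau>
  proof -
    have "((\<lambda>m. hecke_coeff l invtheta_coeff m * nome (of_int m * \<tau>)) has_sum hecke l invtheta \<tau>) UNIV"
      using that by (intro hecke_has_sum l invtheta_has_sum)
    then show ?thesis
      by (subst (asm) has_sum_int_reindex_nat[of int]) (auto simp: neg nome_int_nat simp del: of_int_of_nat_eq dest: not_in_range_int)
  qed
  show "fps_conv_radius (hecke_fps l) \<ge> 1"
    unfolding hecke_fps_def by (rule has_sum_imp_eval_fps(1)[OF *])
  show "hecke l invtheta \<tau> = eval_fps (hecke_fps l) (nome \<tau>)" if "Im \<tau> > 0"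
    unfolding hecke_fps_def by (rule has_sum_imp_eval_fps(2)[OF * that])
qed

text \<open>The last Hecke term moves the polar exponent -1 of \<open>invtheta2\<close> to -l^2,
  which lies (l^2 - 1) / 8 steps of length 8 lower.\<close>

definition cusp_order :: "nat \<Rightarrow> nat" where "cusp_order l = (l\<^sup>2 - 1) div 8"

lemma square_eq_cusp_order:
  assumes "odd l"
  shows "l\<^sup>2 = 8 * cusp_order l + 1"
proof -
  obtain k where k: "l = 2 * k + 1" using assms by (elim oddE)
  have "even (k * (k + 1))" by simp
  then obtain j where j: "k * (k + 1) = 2 * j" by (elim evenE)
  have "l\<^sup>2 = 4 * (k * (k + 1)) + 1" by (simp add: k power2_eq_square algebra_simps)
  then have "l\<^sup>2 = 8 * j + 1" unfolding j by simp
  then show ?thesis by (simp add: cusp_order_def)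
qed

text \<open>Shifted by the pole order, so that for odd l index 0 belongs to the exponent -l^2. The 2
  clears the halves in \<open>invtheta2_coeff\<close> and makes the series integral.\<close>

definition cusp_fps :: "nat \<Rightarrow> complex fps" where
  "cusp_fps l = Abs_fps (\<lambda>n. 2 * hecke_coeff l invtheta2_coeff (8 * (int n - int (cusp_order l)) - 1))"

text \<open>As l^2 is 1 modulo 8, all three Hecke terms keep the exponents in the class of -1 modulo
  8. The first two vanish below -1, and only the last reaches down to -l^2.\<close>

lemma hecke_coeff_invtheta2_support:
  assumes l: "prime l" "odd l"
    and m: "m \<notin> range (\<lambda>n. 8 * (int n - int (cusp_order l)) - 1)"
  shows "hecke_coeff l invtheta2_coeff m = 0"
proof (rule ccontr)
  let ?J = "int (cusp_order l)"
  let ?P = "\<lambda>m::int. m \<ge> -1 \<and> 8 dvd m + 1"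
  have sq: "int (l\<^sup>2) = 8 * ?J + 1" using square_eq_cusp_order[OF l(2)] by simp
  have J0: "?J \<ge> 1"
  proof -
    have "l > 1" using l(1) by (rule prime_gt_1_nat)
    then have "1 < l\<^sup>2" by (rule one_less_power) simp
    then have "1 < int (l\<^sup>2)" by linarith
    then show ?thesis unfolding sq by linarith
  qed
  assume "hecke_coeff l invtheta2_coeff m \<noteq> 0"
  then have "?P (int (l\<^sup>2) * m) \<or> ?P m \<or> (int (l\<^sup>2) dvd m \<and> ?P (m div int (l\<^sup>2)))"
    unfolding hecke_coeff_def invtheta2_coeff_def by (auto split: if_splits)
  then have "8 dvd m + 1 \<and> m \<ge> - (8 * ?J + 1)"
  proof (elim disjE)
    assume P: "?P (int (l\<^sup>2) * m)"
    then have "8 dvd (8 * ?J + 1) * m + 1 - 8 * (?J * m)" unfolding sq by (intro dvd_diff) auto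
    then have "8 dvd m + 1" by (simp add: algebra_simps)
    moreover have "m \<ge> 0"
    proof (rule ccontr)
      assume "\<not> m \<ge> 0"
      then have "(8 * ?J + 1) * m \<le> (8 * ?J + 1) * (-1)" using J0 by (intro mult_left_mono) auto
      moreover have "-1 \<le> (8 * ?J + 1) * m" using P unfolding sq by (rule conjunct1)
      ultimately have "-1 \<le> (8 * ?J + 1) * (-1)" by (rule order_trans[rotated])
      then show False using J0 by simp
    qed
    ultimately show ?thesis using J0 by simp
  next
    assume "?P m" then show ?thesis using J0 by auto
  next
    assume P: "int (l\<^sup>2) dvd m \<and> ?P (m div int (l\<^sup>2))"
    define j where "j = m div int (l\<^sup>2)"
    have mj: "m = (8 * ?J + 1) * j" using P by (simp add: j_def flip: sq)
    have j: "j \<ge> -1" "8 dvd j + 1" using P by (simp_all add: j_def)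
    have "8 dvd 8 * (?J * j) + (j + 1)" by (rule dvd_add[OF _ j(2)]) simp
    then have "8 dvd m + 1" unfolding mj by (simp add: algebra_simps)
    moreover have "m \<ge> (8 * ?J + 1) * (-1)" unfolding mj using j J0 by (intro mult_left_mono) auto
    ultimately show ?thesis by simp
  qed
  then obtain i where i: "m + 1 = 8 * i" "m \<ge> - (8 * ?J + 1)" by (auto elim: dvdE)
  then have "m = 8 * (int (nat (i + ?J)) - ?J) - 1" by simp
  then show False using m by blast
qed

lemma cusp_fps_conv_radius: "prime l \<Longrightarrow> odd l \<Longrightarrow> fps_conv_radius (cusp_fps l) \<ge> 1"
  and hecke_invtheta2_eq_eval_fps: "prime l \<Longrightarrow> odd l \<Longrightarrow> Im \<sigma> > 0 \<Longrightarrow>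
    2 * nome (\<sigma> / 4) * nome (2 * \<sigma>) ^ cusp_order l * hecke l invtheta2 (\<sigma> / 4) = eval_fps (cusp_fps l) (nome (2 * \<sigma>))"
proof -
  assume l: "prime l" "odd l"
  let ?J = "cusp_order l"
  let ?h = "\<lambda>n::nat. 8 * (int n - int ?J) - 1"
  let ?S = "\<lambda>\<tau>. 2 * nome (\<tau> / 8) * nome \<tau> ^ ?J * hecke l invtheta2 (\<tau> / 8)"
  have *: "((\<lambda>n::nat. 2 * hecke_coeff l invtheta2_coeff (?h n) * nome \<tau> ^ n) has_sum ?S \<tau>) UNIV"
    if "Im \<tau> > 0" for \<tau>
  proof -
    have "((\<lambda>m. hecke_coeff l invtheta2_coeff m * nome (of_int m * (\<tau> / 8))) has_sum hecke l invtheta2 (\<tau> / 8)) UNIV"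
      using that by (intro hecke_has_sum l invtheta2_has_sum) auto
    then have "((\<lambda>n. hecke_coeff l invtheta2_coeff (?h n) * nome (of_int (?h n) * (\<tau> / 8))) has_sum hecke l invtheta2 (\<tau> / 8)) UNIV"
      by (subst (asm) has_sum_int_reindex_nat[of ?h]) (auto simp: inj_on_def hecke_coeff_invtheta2_support[OF l])
    then have "((\<lambda>n. (2 * nome (\<tau> / 8) * nome \<tau> ^ ?J) * (hecke_coeff l invtheta2_coeff (?h n) * nome (of_int (?h n) * (\<tau> / 8))))
       has_sum ?S \<tau>) UNIV"
      by (rule has_sum_cmult_right)
    moreover have eq: "nome (\<tau> / 8) * nome \<tau> ^ ?J * nome (of_int (?h n) * (\<tau> / 8)) = nome \<tau> ^ n" for n
      unfolding nome_mult_nat[symmetric] nome_add[symmetric]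
      by (rule arg_cong[of _ _ nome]) (simp add: field_simps)
    have "(2 * nome (\<tau> / 8) * nome \<tau> ^ ?J) * (hecke_coeff l invtheta2_coeff (?h n) * nome (of_int (?h n) * (\<tau> / 8)))
       = 2 * hecke_coeff l invtheta2_coeff (?h n) * nome \<tau> ^ n" for n
      unfolding eq[of n, symmetric] by (simp only: mult_ac)
    ultimately show ?thesis by (simp only:)
  qed
  show "fps_conv_radius (cusp_fps l) \<ge> 1"
    unfolding cusp_fps_def by (rule has_sum_imp_eval_fps(1)[OF *])
  show "2 * nome (\<sigma> / 4) * nome (2 * \<sigma>) ^ ?J * hecke l invtheta2 (\<sigma> / 4) = eval_fps (cusp_fps l) (nome (2 * \<sigma>))"
    if "Im \<sigma> > 0"
    unfolding cusp_fps_def using has_sum_imp_eval_fps(2)[OF *, of "2 * \<sigma>"] that by simp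
qed

text \<open>The factor 2 \<open>nome (\<sigma> / 4)\<close> that normalises the expansion of the
  Hecke image is the one that \<open>theta2\<close> has in front of psi. In the local parameter
  \<open>nome (2 * \<sigma>)\<close> the pole order is thus at most
  \<open>cusp_order l\<close>.\<close>

lemma theta2_mult_hecke:
  assumes l: "prime l" "odd l" and \<sigma>: "Im \<sigma> > 0"
  shows "nome (2 * \<sigma>) ^ cusp_order l * (theta2 \<sigma> * hecke l invtheta2 (\<sigma> / 4))
     = eval_fps (psi_fps * cusp_fps l) (nome (2 * \<sigma>))"
proof -
  have "norm (nome (2 * \<sigma>)) < 1" using \<sigma> by (intro norm_nome_less_1) simp
  then have "eval_fps (psi_fps * cusp_fps l) (nome (2 * \<sigma>))
      = eval_fps psi_fps (nome (2 * \<sigma>)) * eval_fps (cusp_fps l) (nome (2 * \<sigma>))"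
    using psi_fps_conv_radius cusp_fps_conv_radius[OF l] by (intro eval_fps_mult) (auto simp: less_conv_radius)
  then show ?thesis
    unfolding hecke_invtheta2_eq_eval_fps[OF l \<sigma>, symmetric] theta2_eq_eval_fps[OF \<sigma>] by (simp add: mult_ac)
qed

lemma int_fps_cusp: "int_fps (cusp_fps l)"
proof -
  have "int_fps (inverse psi_fps)" by (intro int_fps_inverse int_fps_psi psi_fps_0)
  then have c: "2 * invtheta2_coeff m \<in> \<int>" for m
    by (auto simp: invtheta2_coeff_def int_fps_def)
  have "2 * hecke_coeff l invtheta2_coeff m
    = of_nat (l ^ 3) * (2 * invtheta2_coeff (int (l\<^sup>2) * m)) + of_int (Legendre (- m) (int l) * int l) * (2 * invtheta2_coeff m)
     + (if int (l\<^sup>2) dvd m then 2 * invtheta2_coeff (m div int (l\<^sup>2)) else 0)" for m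
    unfolding hecke_coeff_def by (simp add: algebra_simps)
  also have "\<dots> m \<in> \<int>" for m
    by (intro Ints_add Ints_mult[OF _ c]) (simp_all add: c)
  finally show ?thesis by (simp add: int_fps_def cusp_fps_def)
qed

section \<open>The maximum principle for the theta group\<close>

text \<open>A fundamental domain of the theta group; it runs out to infinity and to the real points
  1 and -1, which translation by 2 identifies.\<close>

definition fund_dom :: "complex set" where
  "fund_dom = {\<tau>. Im \<tau> > 0 \<and> \<bar>Re \<tau>\<bar> \<le> 1 \<and> norm \<tau> \<ge> 1}"

text \<open>With the cusp moved to 0, the corner of the domain lies between a vertical line and a
  circle tangent to it. There \<bar>Re z\<bar> \<le> Im z, so the squared modulus of z is at most 2
  (Im z)^2.\<close>

lemma Im_minus_inverse_ge:
  assumes z: "Im z > 0" "\<bar>Re z\<bar> \<le> 1" "1 \<le> (1 - \<bar>Re z\<bar>)\<^sup>2 + (Im z)\<^sup>2" "Im z \<le> y"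
  shows "Im (- 1 / z) \<ge> 1 / (2 * y)"
proof -
  let ?x = "\<bar>Re z\<bar>" and ?y = "Im z"
  have x2: "?x\<^sup>2 \<le> ?x" using z(2) unfolding power2_eq_square by (intro mult_left_le) auto
  moreover have "(1 - ?x)\<^sup>2 = 1 - 2 * ?x + ?x\<^sup>2" by (simp add: power2_eq_square algebra_simps)
  ultimately have le: "?x\<^sup>2 + ?y\<^sup>2 \<le> 2 * ?y\<^sup>2" using z(3) by linarith
  have "Im (- 1 / z) = ?y / (?x\<^sup>2 + ?y\<^sup>2)"
    by (simp add: Im_divide)
  moreover have "?y / (?x\<^sup>2 + ?y\<^sup>2) \<ge> ?y / (2 * ?y\<^sup>2)"
    using z(1) le by (intro divide_left_mono) (auto simp: add_nonneg_pos)
  moreover have "?y / (2 * ?y\<^sup>2) = 1 / (2 * ?y)" using z(1) by (simp add: power2_eq_square)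
  moreover have "1 / (2 * y) \<le> 1 / (2 * ?y)" using z by (intro divide_left_mono) auto
  ultimately show ?thesis by linarith
qed

lemma nome_add_2: "nome (\<tau> + 2) = nome \<tau>" and nome_diff_2: "nome (\<tau> - 2) = nome \<tau>"
proof -
  have "nome 2 = 1" by (simp add: nome_def exp_eq_1)
  then show "nome (\<tau> + 2) = nome \<tau>" for \<tau> by (simp add: nome_add)
  from this[of "\<tau> - 2"] show "nome (\<tau> - 2) = nome \<tau>" by simp
qed

lemma nome_surj_strip:
  assumes "q \<noteq> 0" "norm q < 1"
  obtains \<tau> where "\<bar>Re \<tau>\<bar> \<le> 1" "Im \<tau> > 0" "nome \<tau> = q"
proof
  let ?t = "Ln q / (pi * \<i>)"
  have eq: "?t = Complex (Im (Ln q) / pi) (- Re (Ln q) / pi)"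
    by (simp add: complex_eq_iff Re_divide Im_divide power2_eq_square)
  show "nome ?t = q" using assms by (simp add: nome_def)
  have "ln (norm q) < 0" using assms by simp
  then show "Im ?t > 0" unfolding eq using assms by (simp add: Re_Ln divide_neg_pos)
  show "\<bar>Re ?t\<bar> \<le> 1"
    unfolding eq using mpi_less_Im_Ln[OF assms(1)] Im_Ln_le_pi[OF assms(1)] by (simp add: abs_le_iff field_simps)
qed

text \<open>The factor \<open>nome (2 * \<sigma>)\<close> makes f tend to 0 at the cusp 1, and
  \<Phi> extends f over infinity. So a nonzero value in \<open>fund_dom\<close> forces the modulus
  of f to attain its supremum there, at a point of the domain or at q = 0. Maximum modulus makes f
  constant, and the behaviour at the cusp makes the constant 0.\<close>

theorem theta_group_max_principle:
  fixes f :: "complex \<Rightarrow> complex" and \<Phi> R :: "complex fps"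
  assumes \<Phi>: "fps_conv_radius \<Phi> \<ge> 1" and f: "\<And>\<tau>. Im \<tau> > 0 \<Longrightarrow> f \<tau> = eval_fps \<Phi> (nome \<tau>)"
    and S: "\<And>\<tau>. Im \<tau> > 0 \<Longrightarrow> f (- 1 / \<tau>) = f \<tau>"
    and R: "fps_conv_radius R \<ge> 1"
    and cusp: "\<And>\<sigma>. Im \<sigma> > 0 \<Longrightarrow> f (1 - 1 / \<sigma>) = nome (2 * \<sigma>) * eval_fps R (nome (2 * \<sigma>))"
    and \<tau>: "Im \<tau> > 0"
  shows "f \<tau> = 0"
proof -
  let ?H = "{\<tau>. Im \<tau> > 0}"
  let ?D = fund_dom
  have opH: "open ?H" and conH: "connected ?H"
    by (auto intro: open_halfspace_Im_gt convex_connected convex_halfspace_Im_gt)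
  have per: "f (\<tau> + 2) = f \<tau>" "f (\<tau> - 2) = f \<tau>" if "Im \<tau> > 0" for \<tau>
    using that by (simp_all add: f nome_add_2 nome_diff_2)
  have DH: "?D \<subseteq> ?H" by (auto simp: fund_dom_def)
  have hol\<Phi>: "eval_fps \<Phi> holomorphic_on ball 0 1"
    using \<Phi> by (intro holomorphic_intros) (auto simp: less_conv_radius)
  have "(eval_fps \<Phi> \<circ> nome) holomorphic_on ?H"
  proof (rule holomorphic_on_compose_gen[OF _ hol\<Phi>])
    show "nome holomorphic_on ?H" unfolding nome_def by (intro holomorphic_intros)
    show "nome ` ?H \<subseteq> ball 0 1" by (auto simp: norm_nome_less_1)
  qed
  then have hol: "f holomorphic_on ?H"
    by (rule holomorphic_transform) (auto simp: f)
  have near: "\<exists>y0>0. y0 < 1 \<and> (\<forall>\<tau>\<in>?D. Im \<tau> \<le> y0 \<longrightarrow> norm (f \<tau>) \<le> e)" if e: "e > 0" for e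
  proof -
    let ?h = "\<lambda>p. p * eval_fps R p"
    have "ereal (norm (0::complex)) < fps_conv_radius R" using R by (intro less_conv_radius) auto
    then have "isCont ?h 0"
      using R by (intro continuous_intros) (auto simp: less_conv_radius)
    then obtain d where d: "d > 0" "\<And>p. norm p < d \<Longrightarrow> norm (?h p) < e"
      using e unfolding continuous_at_eps_delta by (auto simp: dist_norm)
    \<comment> \<open>Below, exp (-1 / y0) < y0 \<le> d bounds the local parameter;
      \<open>y0 < 1\<close> keeps \<i> in the truncated domain \<open>D2\<close>.\<close>
    define y0 where "y0 = min (1 / 2) d"
    have y0: "y0 > 0" "y0 < 1" "y0 \<le> d" using d by (auto simp: y0_def)
    have small: "norm (f (1 + z)) \<le> e"
      if z: "Im z > 0" "\<bar>Re z\<bar> \<le> 1" "1 \<le> (1 - \<bar>Re z\<bar>)\<^sup>2 + (Im z)\<^sup>2" "Im z \<le> y0" for z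
    proof -
      define \<sigma> where "\<sigma> = - 1 / z"
      have \<sigma>: "Im \<sigma> \<ge> 1 / (2 * y0)" unfolding \<sigma>_def by (rule Im_minus_inverse_ge[OF z])
      have "z \<noteq> 0" using z(1) by auto
      then have z\<sigma>: "1 + z = 1 - 1 / \<sigma>" by (simp add: \<sigma>_def)
      have "0 < 1 / (2 * y0)" using y0 by simp
      then have \<sigma>0: "Im \<sigma> > 0" using \<sigma> by linarith
      have "1 < pi" using pi_gt3 by linarith
      have "1 / y0 \<le> 2 * Im \<sigma>" using \<sigma> y0 by (simp add: field_simps)
      also have "\<dots> \<le> pi * (2 * Im \<sigma>)" using \<open>1 < pi\<close> \<sigma>0 by simp
      finally have a: "1 / y0 \<le> pi * (2 * Im \<sigma>)" .
      have "exp (- (pi * (2 * Im \<sigma>))) \<le> exp (- (1 / y0))" using a by simp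
      also have "\<dots> = 1 / exp (1 / y0)" by (simp add: exp_minus field_simps)
      also have "\<dots> < 1 / (1 / y0)"
      proof (rule divide_strict_left_mono)
        show "1 / y0 < exp (1 / y0)" using exp_ge_add_one_self[of "1 / y0"] by linarith
      qed (use y0 in auto)
      finally have "norm (nome (2 * \<sigma>)) < d" using y0 by (simp add: norm_nome)
      then have "norm (nome (2 * \<sigma>) * eval_fps R (nome (2 * \<sigma>))) < e" by (rule d(2))
      then show ?thesis unfolding z\<sigma> cusp[OF \<sigma>0] by simp
    qed
    \<comment> \<open>The low parts of the domain are the corners at 1 and -1; the period 2 moves
      the second to the first.\<close>
    have "norm (f \<tau>) \<le> e" if \<tau>: "\<tau> \<in> ?D" "Im \<tau> \<le> y0" for \<tau>
    proof -
      have "1 \<le> (norm \<tau>)\<^sup>2" using \<tau> by (simp add: fund_dom_def one_le_power)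
      then have n: "1 \<le> (Re \<tau>)\<^sup>2 + (Im \<tau>)\<^sup>2" by (simp add: cmod_power2)
      have t: "Im \<tau> > 0" "\<bar>Re \<tau>\<bar> \<le> 1" using \<tau> by (auto simp: fund_dom_def)
      show ?thesis
      proof (cases "Re \<tau> \<ge> 0")
        case True
        have "1 - \<bar>Re (\<tau> - 1)\<bar> = Re \<tau>" using True t by auto
        then show ?thesis using small[of "\<tau> - 1"] t n \<tau>(2) True by simp
      next
        case False
        have "1 - \<bar>Re (\<tau> + 1)\<bar> = - Re \<tau>" using False t by auto
        then have "norm (f (1 + (\<tau> + 1))) \<le> e" using t n \<tau>(2) False by (intro small) auto
        moreover have "1 + (\<tau> + 1) = \<tau> + 2" by simp
        ultimately show ?thesis using per(1)[OF t(1)] by (simp only:)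
      qed
    qed
    then show ?thesis using y0 by blast
  qed
  \<comment> \<open>Points close to the fundamental domain are at most one generator away from it.\<close>
  have local_max: "\<exists>U. open U \<and> z \<in> U \<and> U \<subseteq> ?H \<and> (\<forall>w\<in>U. norm (f w) \<le> M)"
    if z: "z \<in> ?D" and M: "\<And>w. w \<in> ?D \<Longrightarrow> norm (f w) \<le> M" for z M
  proof (cases "norm z = 1")
    case True
    \<comment> \<open>The last condition says that -1 / w stays in the strip, so inversion takes the
      points of \<open>?U\<close> inside the unit circle to the domain.\<close>
    let ?U = "{w. Im w > 0} \<inter> {w. \<bar>Re w\<bar> < 1} \<inter> {w. \<bar>Re w\<bar> < (norm w)\<^sup>2}"
    have "open ?U"
      by (intro open_Int open_halfspace_Im_gt open_Collect_less continuous_intros)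
    moreover have "\<bar>Re z\<bar> < 1"
    proof -
      have "(Re z)\<^sup>2 + (Im z)\<^sup>2 = 1" using True cmod_power2[of z] by simp
      moreover have "(Im z)\<^sup>2 > 0" using z by (simp add: fund_dom_def)
      ultimately have "(Re z)\<^sup>2 < 1" by linarith
      then show ?thesis by (simp add: abs_square_less_1)
    qed
    then have "z \<in> ?U" using z True by (auto simp: fund_dom_def)
    moreover have "norm (f w) \<le> M" if w: "w \<in> ?U" for w
    proof (cases "norm w \<ge> 1")
      case True
      then have "w \<in> ?D" using w by (auto simp: fund_dom_def)
      then show ?thesis by (rule M)
    next
      case False
      have w0: "Im w > 0" using w by simp
      have "w \<noteq> 0" using w0 by auto
      have "Re (- 1 / w) = - Re w / (norm w)\<^sup>2"
        by (simp add: Re_divide cmod_power2)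
      then have "\<bar>Re (- 1 / w)\<bar> = \<bar>Re w\<bar> / (norm w)\<^sup>2" by simp
      also have "\<dots> \<le> 1" using w \<open>w \<noteq> 0\<close> by (simp add: divide_le_eq)
      finally have "\<bar>Re (- 1 / w)\<bar> \<le> 1" .
      moreover have "norm (- 1 / w) \<ge> 1" using False \<open>w \<noteq> 0\<close> by (simp add: norm_divide field_simps)
      ultimately have "- 1 / w \<in> ?D" using Im_minus_inverse_pos[OF w0] by (simp add: fund_dom_def)
      then have "norm (f (- 1 / w)) \<le> M" by (rule M)
      then show ?thesis using S[OF w0] by simp
    qed
    ultimately show ?thesis by (intro exI[of _ ?U]) auto
  next
    case False
    then have z1: "norm z > 1" "Im z > 0" "\<bar>Re z\<bar> \<le> 1" using z by (auto simp: fund_dom_def)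
    \<comment> \<open>Staying outside the unit circles about 0, 2 and -2 makes the translates by 2
      avoid the unit disc, and \<bar>Re w\<bar> < 3 makes a single translation enough.\<close>
    let ?U = "{w. Im w > 0} \<inter> {w. \<bar>Re w\<bar> < 3} \<inter> {w. 1 < norm w} \<inter> {w. 1 < norm (w - 2)} \<inter> {w. 1 < norm (w + 2)}"
    have "open ?U"
      by (intro open_Int open_halfspace_Im_gt open_Collect_less continuous_intros)
    moreover have "z \<in> ?U"
    proof -
      have "(norm z)\<^sup>2 \<le> (norm (z - 2))\<^sup>2" "(norm z)\<^sup>2 \<le> (norm (z + 2))\<^sup>2"
        unfolding cmod_power2 using z1(3) by (auto simp: power2_eq_square algebra_simps abs_le_iff)
      then have "norm z \<le> norm (z - 2)" "norm z \<le> norm (z + 2)"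
        by (metis norm_ge_zero power2_le_imp_le)+
      then show ?thesis using z1 by auto
    qed
    moreover have "norm (f w) \<le> M" if w: "w \<in> ?U" for w
    proof -
      have w0: "Im w > 0" using w by simp
      consider "\<bar>Re w\<bar> \<le> 1" | "Re w > 1" | "Re w < -1" by linarith
      then show ?thesis
      proof cases
        case 1
        then have "w \<in> ?D" using w by (auto simp: fund_dom_def)
        then show ?thesis by (rule M)
      next
        case 2
        then have "w - 2 \<in> ?D" using w by (auto simp: fund_dom_def)
        then have "norm (f (w - 2)) \<le> M" by (rule M)
        then show ?thesis using per(2)[OF w0] by simp
      next
        case 3
        then have "w + 2 \<in> ?D" using w by (auto simp: fund_dom_def)
        then have "norm (f (w + 2)) \<le> M" by (rule M)
        then show ?thesis using per(1)[OF w0] by simp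
      qed
    qed
    ultimately show ?thesis by (intro exI[of _ ?U]) auto
  qed
  \<comment> \<open>The points of the domain with real part 1 come arbitrarily close to the cusp,
    where f is small.\<close>
  have const_zero: "f w = 0" if c: "\<And>w. Im w > 0 \<Longrightarrow> f w = c" and w: "Im w > 0" for w c
  proof (rule ccontr)
    assume "f w \<noteq> 0"
    then have "norm c / 2 > 0" using c[OF w] by simp
    from near[OF this] obtain y0 where y0: "y0 > 0" "y0 < 1" "\<And>\<tau>. \<tau> \<in> ?D \<Longrightarrow> Im \<tau> \<le> y0 \<Longrightarrow> norm (f \<tau>) \<le> norm c / 2"
      by blast
    have "norm (Complex 1 y0) \<ge> 1" by (simp add: cmod_def)
    then have "norm (f (Complex 1 y0)) \<le> norm c / 2" using y0 by (intro y0(3)) (auto simp: fund_dom_def)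
    then show False using c[of "Complex 1 y0"] y0 \<open>norm c / 2 > 0\<close> by simp
  qed
  have D0: "f z = 0" if z: "z \<in> ?D" for z
  proof (rule ccontr)
    assume fz: "f z \<noteq> 0"
    then have e: "norm (f z) / 2 > 0" by simp
    obtain y0 where y0: "y0 > 0" "y0 < 1" "\<And>\<tau>. \<tau> \<in> ?D \<Longrightarrow> Im \<tau> \<le> y0 \<Longrightarrow> norm (f \<tau>) \<le> norm (f z) / 2"
      using near[OF e] by blast
    define D2 where "D2 = {w. \<bar>Re w\<bar> \<le> 1} \<inter> {w. 1 \<le> norm w} \<inter> {w. y0 \<le> Im w} \<inter> {w. Im w \<le> 1}"
    have D2: "D2 \<subseteq> ?D" using y0 by (auto simp: D2_def fund_dom_def)
    have "closed D2" unfolding D2_def by (intro closed_Int closed_Collect_le continuous_intros)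
    moreover have "bounded D2"
      unfolding bounded_iff
    proof (intro exI ballI)
      fix w assume "w \<in> D2"
      then have "\<bar>Re w\<bar> \<le> 1" "\<bar>Im w\<bar> \<le> 1" using y0 by (auto simp: D2_def)
      then show "norm w \<le> 2" using cmod_le[of w] by linarith
    qed
    ultimately have "compact D2" by (simp add: compact_eq_bounded_closed)
    moreover have "\<i> \<in> D2" using y0 by (simp add: D2_def)
    moreover have "continuous_on D2 (\<lambda>w. norm (f w))"
      using D2 DH by (intro continuous_intros holomorphic_on_imp_continuous_on holomorphic_on_subset[OF hol]) auto
    ultimately obtain t2 where t2: "t2 \<in> D2" "\<And>w. w \<in> D2 \<Longrightarrow> norm (f w) \<le> norm (f t2)"
      using continuous_attains_sup[of D2 "\<lambda>w. norm (f w)"] by blast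
    \<comment> \<open>The part Im w \<ge> 1 corresponds to nomes of modulus at most exp (-pi).
      Adding q = 0 as the point at infinity gives a compact disc in place of the unbounded part of
      the domain.\<close>
    let ?r = "exp (- pi)"
    have r1: "?r < 1" by simp
    then have "cball (0::complex) ?r \<subseteq> ball 0 1" by (simp add: cball_subset_ball_iff)
    then have "continuous_on (cball 0 ?r) (\<lambda>q. norm (eval_fps \<Phi> q))"
      by (intro continuous_intros holomorphic_on_imp_continuous_on holomorphic_on_subset[OF hol\<Phi>])
    then obtain q1 where q1: "q1 \<in> cball 0 ?r" "\<And>q. q \<in> cball 0 ?r \<Longrightarrow> norm (eval_fps \<Phi> q) \<le> norm (eval_fps \<Phi> q1)"
      using continuous_attains_sup[of "cball 0 ?r" "\<lambda>q. norm (eval_fps \<Phi> q)"] by fastforce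
    define M where "M = max (norm (f t2)) (norm (eval_fps \<Phi> q1))"
    have M': "norm (f w) \<le> M" if w: "w \<in> ?D" "Im w > y0" for w
    proof (cases "Im w \<le> 1")
      case True
      then have "w \<in> D2" using w by (auto simp: D2_def fund_dom_def)
      then show ?thesis unfolding M_def by (intro max.coboundedI1 t2(2))
    next
      case False
      then have "nome w \<in> cball 0 ?r" by (simp add: norm_nome)
      then have "norm (eval_fps \<Phi> (nome w)) \<le> norm (eval_fps \<Phi> q1)" by (rule q1(2))
      then show ?thesis unfolding M_def using f[of w] w y0 by (intro max.coboundedI2) simp
    qed
    have "Im z > y0"
    proof (rule ccontr)
      assume "\<not> Im z > y0"
      then have "norm (f z) \<le> norm (f z) / 2" using y0(3)[OF z] by simp
      then show False using e by linarith
    qed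
    then have zM: "norm (f z) \<le> M" using M' z by blast
    have M: "norm (f w) \<le> M" if w: "w \<in> ?D" for w
    proof (cases "Im w > y0")
      case True
      then show ?thesis using M' w by blast
    next
      case False
      then have "norm (f w) \<le> norm (f z) / 2" using y0(3)[OF w] by simp
      then show ?thesis using zM e by linarith
    qed
    have attained: "f w = 0" if tw: "t \<in> ?D" "norm (f t) = M" "Im w > 0" for t w
    proof -
      obtain U where U: "open U" "t \<in> U" "U \<subseteq> ?H" "\<And>w. w \<in> U \<Longrightarrow> norm (f w) \<le> M"
        using local_max[OF tw(1) M] by blast
      have "f constant_on ?H"
        using U tw(2) by (intro maximum_modulus_principle[OF hol opH conH, of U t]) auto
      then obtain c where "\<And>w. Im w > 0 \<Longrightarrow> f w = c" by (auto simp: constant_on_def)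
      then show ?thesis using const_zero tw(3) by blast
    qed
    have z0: "Im z > 0" using z DH by auto
    show False
    proof (cases "norm (f t2) = M")
      case True
      then show False using attained[of t2 z] t2(1) D2 z0 fz by blast
    next
      case False
      then have q1M: "norm (eval_fps \<Phi> q1) = M" by (auto simp: M_def max_def split: if_splits)
      show False
      proof (cases "q1 = 0")
        case False
        have "norm q1 < 1" using q1(1) r1 by (simp del: exp_less_one_iff)
        then obtain t where t: "\<bar>Re t\<bar> \<le> 1" "Im t > 0" "nome t = q1" using nome_surj_strip[OF False] by blast
        have "exp (- pi * Im t) \<le> exp (- pi)" using q1(1) t(3) norm_nome[of t] by simp
        then have "Im t \<ge> 1" by simp
        then have "norm t \<ge> 1" using abs_Im_le_cmod[of t] by linarith
        then have "t \<in> ?D" using t by (simp add: fund_dom_def)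
        moreover have "norm (f t) = M" using f[OF t(2)] t(3) q1M by simp
        ultimately show False using attained[of t z] z0 fz by blast
      next
        case True
        \<comment> \<open>As q = 0 comes from no point of the half-plane, the maximum principle is
          applied to \<Phi> in the disc instead.\<close>
        have "eval_fps \<Phi> constant_on ball 0 1"
        proof (rule maximum_modulus_principle[OF hol\<Phi> _ _, of "ball 0 ?r" 0])
          show "norm (eval_fps \<Phi> q) \<le> norm (eval_fps \<Phi> 0)" if "q \<in> ball 0 ?r" for q
            using q1(2)[of q] that True by auto
          show "ball 0 ?r \<subseteq> ball (0::complex) 1" using r1 by (intro subset_ball) simp
        qed auto
        then obtain c where "\<And>q. norm q < 1 \<Longrightarrow> eval_fps \<Phi> q = c" by (auto simp: constant_on_def)
        then have "f w = c" if "Im w > 0" for w using f[OF that] norm_nome_less_1[OF that] by simp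
        then show False using const_zero z0 fz by blast
      qed
    qed
  qed
  have "f \<tau> = 0" if "Im \<tau> > 0" for \<tau>
  proof (rule analytic_continuation_open[of "{w. Im w > 1} \<inter> {w. \<bar>Re w\<bar> < 1}" ?H f "\<lambda>_. 0"])
    show "open ({w. Im w > 1} \<inter> {w. \<bar>Re w\<bar> < 1})"
      by (intro open_Int open_halfspace_Im_gt open_Collect_less continuous_intros)
    show "{w. Im w > 1} \<inter> {w. \<bar>Re w\<bar> < 1} \<noteq> {}"
    proof -
      have "Complex 0 2 \<in> {w. Im w > 1} \<inter> {w. \<bar>Re w\<bar> < 1}" by simp
      then show ?thesis by blast
    qed
    show "f w = 0" if "w \<in> {w. Im w > 1} \<inter> {w. \<bar>Re w\<bar> < 1}" for w
    proof (rule D0)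
      have "norm w \<ge> 1" using that abs_Im_le_cmod[of w] by auto
      then show "w \<in> ?D" using that by (auto simp: fund_dom_def)
    qed
  qed (use that opH conH hol in auto)
  then show ?thesis using \<tau> by blast
qed

section \<open>The Hauptmodul and the congruence\<close>

lemma eval_fps_mult_disc:
  fixes f g :: "complex fps"
  assumes "fps_conv_radius f \<ge> 1" "fps_conv_radius g \<ge> 1" "norm q < 1"
  shows "eval_fps (f * g) q = eval_fps f q * eval_fps g q"
  using assms by (intro eval_fps_mult) (auto simp: less_conv_radius)

lemma fps_conv_radius_mult_disc:
  fixes f g :: "complex fps"
  assumes "fps_conv_radius f \<ge> 1" "fps_conv_radius g \<ge> 1"
  shows "fps_conv_radius (f * g) \<ge> 1"
  using fps_conv_radius_mult[of f g] assms by (metis min_def order_trans)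

lemma fps_conv_radius_power_disc:
  fixes f :: "complex fps"
  assumes "fps_conv_radius f \<ge> 1"
  shows "fps_conv_radius (f ^ n) \<ge> 1"
  using fps_conv_radius_power[of f n] assms by (rule order_trans[rotated])

lemma eval_fps_power_disc:
  fixes f :: "complex fps"
  assumes "fps_conv_radius f \<ge> 1" "norm q < 1"
  shows "eval_fps (f ^ n) q = eval_fps f q ^ n"
  using assms by (intro eval_fps_power) (auto simp: less_conv_radius)

lemma fps_conv_radius_diff_disc:
  fixes f g :: "complex fps"
  assumes "fps_conv_radius f \<ge> 1" "fps_conv_radius g \<ge> 1"
  shows "fps_conv_radius (f - g) \<ge> 1"
  using fps_conv_radius_diff[of f g] assms by (metis min_def order_trans)

lemma fps_sum_disc:
  fixes f :: "'a \<Rightarrow> complex fps"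
  assumes "finite A" "\<And>i. i \<in> A \<Longrightarrow> fps_conv_radius (f i) \<ge> 1"
  shows "fps_conv_radius (\<Sum>i\<in>A. f i) \<ge> 1" "norm q < 1 \<Longrightarrow> eval_fps (\<Sum>i\<in>A. f i) q = (\<Sum>i\<in>A. eval_fps (f i) q)"
proof -
  have "fps_conv_radius (\<Sum>i\<in>A. f i) \<ge> 1 \<and> (norm q < 1 \<longrightarrow> eval_fps (\<Sum>i\<in>A. f i) q = (\<Sum>i\<in>A. eval_fps (f i) q))"
    using assms
  proof (induction A rule: finite_induct)
    case (insert i A)
    then have r: "fps_conv_radius (f i) \<ge> 1" "fps_conv_radius (\<Sum>i\<in>A. f i) \<ge> 1" by auto
    have "fps_conv_radius (f i + (\<Sum>i\<in>A. f i)) \<ge> 1"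
      using fps_conv_radius_add[of "f i" "\<Sum>i\<in>A. f i"] r by (metis min_def order_trans)
    moreover have "eval_fps (f i + (\<Sum>i\<in>A. f i)) q = eval_fps (f i) q + eval_fps (\<Sum>i\<in>A. f i) q" if "norm q < 1"
      using that r by (intro eval_fps_add) (auto simp: less_conv_radius)
    ultimately show ?case using insert by auto
  qed simp
  then show "fps_conv_radius (\<Sum>i\<in>A. f i) \<ge> 1" "norm q < 1 \<Longrightarrow> eval_fps (\<Sum>i\<in>A. f i) q = (\<Sum>i\<in>A. eval_fps (f i) q)"
    by auto
qed

lemma fps_conv_radius_X_power_ge: "fps_conv_radius (fps_X ^ n :: complex fps) \<ge> 1"
  by simp

lemma fps_conv_radius_const_ge: "fps_conv_radius (fps_const c :: complex fps) \<ge> 1"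
  by simp

lemma int_fps_diff: "int_fps f \<Longrightarrow> int_fps g \<Longrightarrow> int_fps (f - g)"
  by (simp add: int_fps_def)

lemma int_fps_sum: "(\<And>i. i \<in> A \<Longrightarrow> int_fps (f i)) \<Longrightarrow> int_fps (\<Sum>i\<in>A. f i)"
  by (auto simp: int_fps_def fps_sum_nth)

lemma int_fps_const: "c \<in> \<int> \<Longrightarrow> int_fps (fps_const c)"
  by (simp add: int_fps_def)

lemma int_fps_X: "int_fps fps_X"
  by (simp add: int_fps_def)

section \<open>Expansions of the Hauptmodul at both cusps\<close>

definition fps_double :: "complex fps \<Rightarrow> complex fps" where
  "fps_double f = Abs_fps (\<lambda>n. if even n then fps_nth f (n div 2) else 0)"

lemma has_sum_even_iff:
  fixes g :: "nat \<Rightarrow> complex"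
  assumes "\<And>n. odd n \<Longrightarrow> g n = 0"
  shows "(g has_sum S) UNIV \<longleftrightarrow> ((\<lambda>n. g (2 * n)) has_sum S) UNIV"
proof -
  have "(g has_sum S) UNIV \<longleftrightarrow> (g has_sum S) (range ((*) 2))"
    using assms by (intro has_sum_cong_neutral) (auto elim!: evenE)
  also have "\<dots> \<longleftrightarrow> ((\<lambda>n. g (2 * n)) has_sum S) UNIV"
    by (subst has_sum_reindex) (auto simp: inj_on_def o_def)
  finally show ?thesis .
qed

lemma nome_double: "nome (2 * \<tau>) = nome \<tau> ^ 2"
  using nome_mult_nat[of 2 \<tau>] by simp

lemma fps_double_conv_radius: "fps_conv_radius f \<ge> 1 \<Longrightarrow> fps_conv_radius (fps_double f) \<ge> 1"
  and eval_fps_double: "fps_conv_radius f \<ge> 1 \<Longrightarrow> Im \<tau> > 0 \<Longrightarrow> eval_fps (fps_double f) (nome \<tau>) = eval_fps f (nome (2 * \<tau>))"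
proof -
  assume f: "fps_conv_radius f \<ge> 1"
  have *: "((\<lambda>n. (if even n then fps_nth f (n div 2) else 0) * nome \<tau> ^ n) has_sum eval_fps f (nome (2 * \<tau>))) UNIV"
    if "Im \<tau> > 0" for \<tau>
  proof (subst has_sum_even_iff)
    have "norm (nome (2 * \<tau>)) < 1" using that by (intro norm_nome_less_1) simp
    from eval_fps_has_sum[OF f this]
    show "((\<lambda>n. (if even (2 * n) then fps_nth f (2 * n div 2) else 0) * nome \<tau> ^ (2 * n)) has_sum eval_fps f (nome (2 * \<tau>))) UNIV"
      by (simp add: nome_double power_mult)
  qed auto
  show "fps_conv_radius (fps_double f) \<ge> 1"
    unfolding fps_double_def by (rule has_sum_imp_eval_fps(1)[OF *])
  show "eval_fps (fps_double f) (nome \<tau>) = eval_fps f (nome (2 * \<tau>))" if "Im \<tau> > 0"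
    unfolding fps_double_def by (rule has_sum_imp_eval_fps(2)[OF * that, symmetric])
qed

lemma int_fps_double: "int_fps f \<Longrightarrow> int_fps (fps_double f)"
  by (simp add: int_fps_def fps_double_def)

lemma nome_1: "nome 1 = -1"
  by (simp add: nome_def exp_pi_i')

lemma nome_add_1: "nome (\<tau> + 1) = - nome \<tau>"
  by (simp add: nome_add nome_1)

lemma theta_add_1_eq_eval_fps: "Im \<tau> > 0 \<Longrightarrow> theta (\<tau> + 1) = eval_fps (fps_twist theta_fps) (nome \<tau>)"
  by (simp add: theta_eq_eval_fps nome_add_1 eval_fps_twist)

text \<open>Replacing q by -q exchanges the two factors, so the product is even in q. Halving the
  indices expresses it in \<open>nome (2 * \<sigma>)\<close>, the local parameter at the cusp
  1.\<close>

definition theta34_fps :: "complex fps" where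
  "theta34_fps = Abs_fps (\<lambda>n. fps_nth (theta_fps * fps_twist theta_fps) (2 * n))"

lemma theta34_fps_conv_radius: "fps_conv_radius theta34_fps \<ge> 1"
  and theta_mult_theta_add_1:
    "Im \<sigma> > 0 \<Longrightarrow> theta \<sigma> * theta (\<sigma> + 1) = eval_fps theta34_fps (nome (2 * \<sigma>))"
proof -
  let ?A = "theta_fps * fps_twist theta_fps"
  have tt: "fps_twist (fps_twist f) = f" for f
    by (rule fps_ext) (simp add: fps_twist_def flip: power_mult_distrib mult.assoc)
  have "fps_twist ?A = ?A"
    unfolding fps_twist_mult tt by (rule mult.commute)
  then have tw: "fps_nth ?A n = fps_nth (fps_twist ?A) n" for n by (simp only:)
  have odd: "fps_nth ?A n = 0" if "odd n" for n
  proof -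
    have "fps_nth (fps_twist ?A) n = - fps_nth ?A n"
      unfolding fps_twist_def[of ?A] using that by simp
    then have "fps_nth ?A n = - fps_nth ?A n" using tw[of n] by (simp only:)
    then have "2 * fps_nth ?A n = 0" unfolding mult_2 by (rule iffD1[OF eq_neg_iff_add_eq_0])
    then show ?thesis by simp
  qed
  have radt: "fps_conv_radius (fps_twist theta_fps) \<ge> 1"
    unfolding fps_conv_radius_twist by (rule theta_fps_conv_radius)
  have rad: "fps_conv_radius ?A \<ge> 1"
    by (rule fps_conv_radius_mult_disc[OF theta_fps_conv_radius radt])
  have *: "((\<lambda>n. fps_nth ?A (2 * n) * nome \<tau> ^ n) has_sum eval_fps ?A (nome (\<tau> / 2))) UNIV"
    if "Im \<tau> > 0" for \<tau>
  proof -
    have "norm (nome (\<tau> / 2)) < 1" using that by (intro norm_nome_less_1) simp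
    from eval_fps_has_sum[OF rad this]
    have "((\<lambda>n. fps_nth ?A (2 * n) * nome (\<tau> / 2) ^ (2 * n)) has_sum eval_fps ?A (nome (\<tau> / 2))) UNIV"
      by (subst (asm) has_sum_even_iff) (auto simp: odd)
    moreover have "nome (\<tau> / 2) ^ (2 * n) = nome \<tau> ^ n" for n
      using nome_double[of "\<tau> / 2"] by (simp add: power_mult)
    ultimately show ?thesis by simp
  qed
  show "fps_conv_radius theta34_fps \<ge> 1"
    unfolding theta34_fps_def by (rule has_sum_imp_eval_fps(1)[OF *])
  show "theta \<sigma> * theta (\<sigma> + 1) = eval_fps theta34_fps (nome (2 * \<sigma>))" if \<sigma>: "Im \<sigma> > 0"
  proof -
    have "theta \<sigma> * theta (\<sigma> + 1) = eval_fps ?A (nome \<sigma>)"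
      unfolding theta_eq_eval_fps[OF \<sigma>] theta_add_1_eq_eval_fps[OF \<sigma>]
      by (rule eval_fps_mult_disc[OF theta_fps_conv_radius radt norm_nome_less_1[OF \<sigma>], symmetric])
    also have "\<dots> = eval_fps theta34_fps (nome (2 * \<sigma>))"
      unfolding theta34_fps_def using has_sum_imp_eval_fps(2)[OF *, of "2 * \<sigma>"] \<sigma> by simp
    finally show ?thesis .
  qed
qed

lemma int_fps_twist: "int_fps f \<Longrightarrow> int_fps (fps_twist f)"
  by (auto simp: int_fps_def fps_twist_def)

lemma int_fps_theta34: "int_fps theta34_fps"
  using int_fps_mult[OF int_fps_theta int_fps_twist[OF int_fps_theta]] by (simp add: int_fps_def theta34_fps_def)

text \<open>Here \<open>theta (\<tau> + 1)\<close> is the classical \<open>\<theta>\<^sub>4\<close>.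
  Inversion exchanges it with \<open>theta2\<close> and fixes theta, each time up to the factor
  \<open>csq \<tau>\<close>, whose powers cancel in this quotient of weight 0.\<close>

definition hauptmodul :: "complex \<Rightarrow> complex" where
  "hauptmodul \<tau> = 2 ^ 8 * theta2 \<tau> ^ 4 * theta (\<tau> + 1) ^ 4 / theta \<tau> ^ 8"

lemma theta_minus_inverse: "Im \<sigma> > 0 \<Longrightarrow> theta (- 1 / \<sigma>) = csq \<sigma> * theta \<sigma>"
  using theta_inversion[of 1 0 0 \<sigma>] by simp

text \<open>This is \<open>theta_one_minus_inverse\<close> at -1 / \<sigma>, because 1 - 1 / (-1 /
  \<sigma>) = 1 + \<sigma>.\<close>

lemma theta2_minus_inverse:
  assumes "Im \<sigma> > 0"
  shows "theta2 (- 1 / \<sigma>) = csq \<sigma> * theta (\<sigma> + 1)"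
proof -
  have "\<sigma> \<noteq> 0" using assms by auto
  then have "theta (\<sigma> + 1) = csq (- 1 / \<sigma>) * theta2 (- 1 / \<sigma>)"
    using theta_one_minus_inverse[OF Im_minus_inverse_pos[OF assms]] by (simp add: add.commute)
  then have "csq \<sigma> * theta (\<sigma> + 1) = (csq \<sigma> * csq (- 1 / \<sigma>)) * theta2 (- 1 / \<sigma>)" by (simp add: mult.assoc)
  also have "csq \<sigma> * csq (- 1 / \<sigma>) = 1" using csq_inverse[OF assms, of 1] by simp
  finally show ?thesis by simp
qed

text \<open>Only the factor q^(1/4) changes, by an eighth root of unity with fourth power -1. This
  sign becomes the leading coefficient -1 at the cusp 1.\<close>

lemma theta2_add_1_power4:
  assumes "Im \<sigma> > 0"
  shows "theta2 (\<sigma> + 1) ^ 4 = - (theta2 \<sigma> ^ 4)"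
proof -
  have "nome (2 * (\<sigma> + 1)) = nome (2 * \<sigma>)" using nome_add_2[of "2 * \<sigma>"] by (simp add: ring_distribs)
  moreover have "nome ((\<sigma> + 1) / 4) = nome (\<sigma> / 4) * nome (1 / 4)" by (simp add: add_divide_distrib nome_add)
  moreover have "nome (1 / 4) ^ 4 = -1" using nome_mult_nat[of 4 "1 / 4"] nome_1 by simp
  ultimately show ?thesis
    using assms by (simp add: theta2_eq_eval_fps power_mult_distrib)
qed

lemma hauptmodul_minus_inverse:
  assumes "Im \<tau> > 0"
  shows "hauptmodul (- 1 / \<tau>) = hauptmodul \<tau>"
  using theta_one_minus_inverse[OF assms] csq_nonzero[OF assms] theta_nonzero[OF assms]
  unfolding hauptmodul_def theta_minus_inverse[OF assms] theta2_minus_inverse[OF assms]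
  by (simp add: power_mult_distrib field_simps flip: power_add)

definition hauptmodul_fps :: "complex fps" where
  "hauptmodul_fps = fps_X * (fps_double psi_fps ^ 4 * fps_twist theta_fps ^ 4 * invtheta_fps ^ 8)"

lemmas disc_intros = fps_conv_radius_mult_disc fps_conv_radius_power_disc fps_double_conv_radius
  psi_fps_conv_radius theta_fps_conv_radius invtheta_fps_conv_radius inverse_psi_fps_conv_radius
  theta34_fps_conv_radius

lemma twist_theta_conv_radius: "fps_conv_radius (fps_twist theta_fps) \<ge> 1"
  by (simp add: fps_conv_radius_twist theta_fps_conv_radius)

lemma hauptmodul_fps_conv_radius: "fps_conv_radius hauptmodul_fps \<ge> 1"
  unfolding hauptmodul_fps_def by (intro disc_intros twist_theta_conv_radius) simp

lemma hauptmodul_eq_eval_fps: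
  assumes "Im \<tau> > 0"
  shows "hauptmodul \<tau> = 2 ^ 12 * eval_fps hauptmodul_fps (nome \<tau>)"
proof -
  note q = norm_nome_less_1[OF assms]
  have "eval_fps hauptmodul_fps (nome \<tau>)
     = nome \<tau> * (eval_fps psi_fps (nome (2 * \<tau>)) ^ 4 * theta (\<tau> + 1) ^ 4 * inverse (theta \<tau>) ^ 8)"
    unfolding hauptmodul_fps_def theta_add_1_eq_eval_fps[OF assms] inverse_theta_eq_eval_fps[OF assms]
      eval_fps_double[OF psi_fps_conv_radius assms, symmetric]
    using q by (simp add: eval_fps_mult_disc eval_fps_power_disc disc_intros twist_theta_conv_radius)
  moreover have "theta2 \<tau> ^ 4 = 2 ^ 4 * nome \<tau> * eval_fps psi_fps (nome (2 * \<tau>)) ^ 4"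
    using nome_mult_nat[of 4 "\<tau> / 4"] by (simp add: theta2_eq_eval_fps[OF assms] power_mult_distrib)
  ultimately show ?thesis
    by (simp add: hauptmodul_def field_simps)
qed

lemma int_fps_hauptmodul: "int_fps hauptmodul_fps"
  unfolding hauptmodul_fps_def
  by (intro int_fps_mult int_fps_power int_fps_X int_fps_double int_fps_twist int_fps_psi int_fps_theta int_fps_invtheta)

text \<open>The normalising 2^8 has cancelled the one in \<open>theta2 \<sigma> ^ 8\<close>; what
  remains of that denominator is the power of psi and one factor \<open>nome (2 * \<sigma>)\<close>,
  the simple pole.\<close>

definition hauptmodul_cusp_fps :: "complex fps" where
  "hauptmodul_cusp_fps = fps_const (-1) * (theta34_fps ^ 4 * inverse psi_fps ^ 8)"

lemma hauptmodul_cusp_fps_conv_radius: "fps_conv_radius hauptmodul_cusp_fps \<ge> 1"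
  unfolding hauptmodul_cusp_fps_def by (intro disc_intros) simp

lemma int_fps_hauptmodul_cusp: "int_fps hauptmodul_cusp_fps"
  unfolding hauptmodul_cusp_fps_def
  by (intro int_fps_mult int_fps_power int_fps_theta34 int_fps_inverse int_fps_psi psi_fps_0 int_fps_const) auto

lemma hauptmodul_cusp_fps_0: "fps_nth hauptmodul_cusp_fps 0 = -1"
  by (simp add: hauptmodul_cusp_fps_def theta34_fps_def psi_fps_0 fps_power_zeroth theta_fps_def
      fps_twist_def square_coeff_def)

lemma hauptmodul_cusp:
  assumes "Im \<sigma> > 0"
  shows "nome (2 * \<sigma>) * hauptmodul (1 - 1 / \<sigma>) = eval_fps hauptmodul_cusp_fps (nome (2 * \<sigma>))"
proof -
  have q: "norm (nome (2 * \<sigma>)) < 1" using assms by (intro norm_nome_less_1) simp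
  have "theta2 (1 - 1 / \<sigma>) ^ 4 = - (theta2 (- 1 / \<sigma>) ^ 4)"
    using theta2_add_1_power4[OF Im_minus_inverse_pos[OF assms]] by (simp add: add.commute)
  moreover have "theta (1 - 1 / \<sigma> + 1) = csq \<sigma> * theta \<sigma>"
    using theta_add_2[of "- 1 / \<sigma>"] theta_minus_inverse[OF assms] by (simp add: algebra_simps)
  ultimately have "hauptmodul (1 - 1 / \<sigma>) = - (2 ^ 8) * (csq \<sigma> * theta (\<sigma> + 1)) ^ 4 * (csq \<sigma> * theta \<sigma>) ^ 4 / (csq \<sigma> * theta2 \<sigma>) ^ 8"
    unfolding hauptmodul_def theta2_minus_inverse[OF assms] theta_one_minus_inverse[OF assms] by simp
  also have "\<dots> = - (2 ^ 8) * (theta \<sigma> * theta (\<sigma> + 1)) ^ 4 / theta2 \<sigma> ^ 8"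
    using csq_nonzero[OF assms] theta2_nonzero[OF assms]
    by (simp add: power_mult_distrib field_simps flip: power_add)
  also have "theta2 \<sigma> ^ 8 = 2 ^ 8 * nome (2 * \<sigma>) * eval_fps psi_fps (nome (2 * \<sigma>)) ^ 8"
    using nome_mult_nat[of 8 "\<sigma> / 4"] by (simp add: theta2_eq_eval_fps[OF assms] power_mult_distrib)
  also have "theta \<sigma> * theta (\<sigma> + 1) = eval_fps theta34_fps (nome (2 * \<sigma>))"
    by (rule theta_mult_theta_add_1[OF assms])
  finally have "nome (2 * \<sigma>) * hauptmodul (1 - 1 / \<sigma>)
      = - (eval_fps theta34_fps (nome (2 * \<sigma>)) ^ 4 * inverse (eval_fps psi_fps (nome (2 * \<sigma>))) ^ 8)"
    by (simp add: field_simps)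
  also have "\<dots> = eval_fps hauptmodul_cusp_fps (nome (2 * \<sigma>))"
    unfolding hauptmodul_cusp_fps_def eval_inverse_psi_fps[OF q, symmetric]
    using q by (simp add: eval_fps_mult_disc eval_fps_power_disc disc_intros)
  finally show ?thesis .
qed

text \<open>After division by X^J, k / X stands for the Hauptmodul at the cusp 1 and the sum for Q
  evaluated there. As k starts with -1, a unit in the integers, an integer multiple of k^J removes
  the lowest coefficient; then divide by X and induct. The case J = 0 removes the constant term,
  which is why the remainder has X^(J+1).\<close>

lemma eliminate_polar_part:
  fixes k :: "complex fps"
  assumes k: "int_fps k" "fps_nth k 0 = -1" and K: "int_fps K"
  shows "\<exists>Q R. (\<forall>i. Q i \<in> \<int>) \<and>
     K = (\<Sum>i\<le>J. fps_const (Q i) * (fps_X ^ (J - i) * k ^ i)) + fps_X ^ Suc J * R"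
  using K
proof (induction J arbitrary: K)
  case 0
  have "K = fps_const (fps_nth K 0) + fps_X * fps_shift 1 K"
    by (rule fps_ext) (simp add: fps_X_mult_nth)
  then show ?case using 0 by (intro exI[of _ "\<lambda>_. fps_nth K 0"] exI[of _ "fps_shift 1 K"]) (auto simp: int_fps_def)
next
  case (Suc J)
  \<comment> \<open>The constant coefficient of \<open>k ^ Suc J\<close> is
    \<open>(-1) ^ Suc J\<close>, its own inverse.\<close>
  define c where "c = fps_nth K 0 * (-1) ^ Suc J"
  define K' where "K' = fps_shift 1 (K - fps_const c * k ^ Suc J)"
  have c: "c \<in> \<int>" using Suc.prems by (auto simp: c_def int_fps_def)
  have "int_fps (K - fps_const c * k ^ Suc J)"
    by (intro int_fps_diff int_fps_mult int_fps_power int_fps_const k c Suc.prems)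
  then have "int_fps K'" by (simp add: int_fps_def K'_def)
  from Suc.IH[OF this] obtain Q R where QR: "\<forall>i. Q i \<in> \<int>"
    "K' = (\<Sum>i\<le>J. fps_const (Q i) * (fps_X ^ (J - i) * k ^ i)) + fps_X ^ Suc J * R" by blast
  have "fps_nth (K - fps_const c * k ^ Suc J) 0 = 0"
    using k(2) by (simp add: c_def fps_power_zeroth flip: power_mult_distrib del: power_Suc)
  then have "K - fps_const c * k ^ Suc J = fps_X * K'"
    unfolding K'_def by (intro fps_ext) (simp add: fps_X_mult_nth)
  then have "K = fps_const c * k ^ Suc J + fps_X * K'" by (simp add: algebra_simps)
  also have "fps_X * K' = (\<Sum>i\<le>J. fps_const (Q i) * (fps_X ^ (Suc J - i) * k ^ i)) + fps_X ^ Suc (Suc J) * R"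
    unfolding QR(2) ring_distribs sum_distrib_left
    by (intro arg_cong2[of _ _ _ _ "(+)"] sum.cong refl) (simp_all add: Suc_diff_le mult_ac)
  finally have "K = (\<Sum>i\<le>Suc J. fps_const ((Q(Suc J := c)) i) * (fps_X ^ (Suc J - i) * k ^ i)) + fps_X ^ Suc (Suc J) * R"
    by (simp add: algebra_simps)
  then show ?case using QR(1) c by (intro exI[of _ "Q(Suc J := c)"] exI[of _ R]) simp
qed

text \<open>Divided by the X^J of the pole, the remainder X^(J+1) R of the elimination leaves a
  function that vanishes at the cusp 1, as \<open>theta_group_max_principle\<close> demands.\<close>

theorem theta_hecke_eq_polynomial:
  assumes l: "prime l" "odd l"
  obtains Q J where "\<And>i. Q i \<in> \<int>"
    "theta_fps * hecke_fps l = (\<Sum>i\<le>J. fps_const (Q i) * (fps_const (2 ^ 12) * hauptmodul_fps) ^ i)"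
proof -
  define J where "J = cusp_order l"
  define g where "g = fps_const (2 ^ 12 :: complex) * hauptmodul_fps"
  let ?K = "psi_fps * cusp_fps l" and ?k = hauptmodul_cusp_fps
  have "int_fps ?K" by (intro int_fps_mult int_fps_psi int_fps_cusp)
  from eliminate_polar_part[OF int_fps_hauptmodul_cusp hauptmodul_cusp_fps_0 this, of J]
  obtain Q R where Q: "\<And>i. Q i \<in> \<int>"
    and K: "?K = (\<Sum>i\<le>J. fps_const (Q i) * (fps_X ^ (J - i) * ?k ^ i)) + fps_X ^ Suc J * R" by blast
  define \<Phi> where "\<Phi> = theta_fps * hecke_fps l - (\<Sum>i\<le>J. fps_const (Q i) * g ^ i)"
  define f where "f = (\<lambda>\<tau>. theta \<tau> * hecke l invtheta \<tau> - (\<Sum>i\<le>J. Q i * hauptmodul \<tau> ^ i))"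
  have radK: "fps_conv_radius ?K \<ge> 1"
    by (intro disc_intros cusp_fps_conv_radius l)
  have radS: "fps_conv_radius (fps_const (Q i) * (fps_X ^ (J - i) * ?k ^ i)) \<ge> 1" for i
    by (intro disc_intros hauptmodul_cusp_fps_conv_radius fps_conv_radius_const_ge fps_conv_radius_X_power_ge)
  have radg: "fps_conv_radius g \<ge> 1"
    unfolding g_def by (intro disc_intros hauptmodul_fps_conv_radius fps_conv_radius_const_ge)
  have radH: "fps_conv_radius (fps_const (Q i) * g ^ i) \<ge> 1" for i
    by (intro disc_intros radg fps_conv_radius_const_ge)
  have evg: "eval_fps g (nome \<tau>) = hauptmodul \<tau>" if "Im \<tau> > 0" for \<tau>
    unfolding g_def hauptmodul_eq_eval_fps[OF that]
    by (subst eval_fps_mult_disc[OF fps_conv_radius_const_ge hauptmodul_fps_conv_radius norm_nome_less_1[OF that]]) simp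
  have radT: "fps_conv_radius (theta_fps * hecke_fps l) \<ge> 1"
    by (intro disc_intros hecke_fps_conv_radius l)
  have rad\<Phi>: "fps_conv_radius \<Phi> \<ge> 1"
    unfolding \<Phi>_def by (intro fps_conv_radius_diff_disc radT fps_sum_disc(1) radH) auto
  \<comment> \<open>X^(J+1) R is a difference of series that converge in the disc, and shifting the
    index does not change the radius.\<close>
  have radR: "fps_conv_radius R \<ge> 1"
  proof -
    have "fps_X ^ Suc J * R = ?K - (\<Sum>i\<le>J. fps_const (Q i) * (fps_X ^ (J - i) * ?k ^ i))"
      using K by (simp add: algebra_simps)
    moreover have "fps_conv_radius (?K - (\<Sum>i\<le>J. fps_const (Q i) * (fps_X ^ (J - i) * ?k ^ i))) \<ge> 1"
      by (intro fps_conv_radius_diff_disc radK fps_sum_disc(1) radS) auto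
    ultimately have "fps_conv_radius (fps_shift (Suc J) (fps_X ^ Suc J * R)) \<ge> 1"
      by (simp only: fps_conv_radius_shift)
    moreover have "fps_shift (Suc J) (fps_X ^ Suc J * R) = R"
      by (rule fps_ext) (simp add: fps_X_power_mult_nth del: power_Suc)
    ultimately show ?thesis by (simp only:)
  qed
  have f\<Phi>: "f \<tau> = eval_fps \<Phi> (nome \<tau>)" if "Im \<tau> > 0" for \<tau>
  proof -
    note q = norm_nome_less_1[OF that]
    have "eval_fps \<Phi> (nome \<tau>) = eval_fps (theta_fps * hecke_fps l) (nome \<tau>)
       - eval_fps (\<Sum>i\<le>J. fps_const (Q i) * g ^ i) (nome \<tau>)"
      unfolding \<Phi>_def using q radT
      by (intro eval_fps_diff) (auto intro!: less_conv_radius fps_sum_disc(1) radH)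
    also have "eval_fps (theta_fps * hecke_fps l) (nome \<tau>) = theta \<tau> * hecke l invtheta \<tau>"
      unfolding theta_eq_eval_fps[OF that] hecke_invtheta_eq_eval_fps[OF l that]
      by (intro eval_fps_mult_disc theta_fps_conv_radius hecke_fps_conv_radius l q)
    also have "eval_fps (\<Sum>i\<le>J. fps_const (Q i) * g ^ i) (nome \<tau>)
        = (\<Sum>i\<le>J. Q i * hauptmodul \<tau> ^ i)"
    proof (subst fps_sum_disc(2))
      show "(\<Sum>i\<le>J. eval_fps (fps_const (Q i) * g ^ i) (nome \<tau>)) = (\<Sum>i\<le>J. Q i * hauptmodul \<tau> ^ i)"
        using q by (simp add: eval_fps_mult_disc eval_fps_power_disc radg evg[OF that] fps_conv_radius_power_disc)
    qed (auto intro!: radH q)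
    finally show ?thesis by (simp add: f_def)
  qed
  have f0: "f \<tau> = 0" if "Im \<tau> > 0" for \<tau>
  proof (rule theta_group_max_principle[OF rad\<Phi> f\<Phi> _ radR _ that])
    fix \<tau> :: complex assume \<tau>: "Im \<tau> > 0"
    have "theta (- 1 / \<tau>) * hecke l invtheta (- 1 / \<tau>) = theta \<tau> * (hecke l invtheta (- 1 / \<tau>) * csq \<tau>)"
      unfolding theta_minus_inverse[OF \<tau>] by (simp add: mult_ac)
    also have "\<dots> = theta \<tau> * hecke l invtheta \<tau>"
      unfolding hecke_invtheta_inversion[OF l \<tau>] ..
    finally show "f (- 1 / \<tau>) = f \<tau>" unfolding f_def hauptmodul_minus_inverse[OF \<tau>] by simp
  next
    fix \<sigma> :: complex assume \<sigma>: "Im \<sigma> > 0"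
    let ?p = "nome (2 * \<sigma>)"
    have q: "norm ?p < 1" using \<sigma> by (intro norm_nome_less_1) simp
    have "theta (1 - 1 / \<sigma>) * hecke l invtheta (1 - 1 / \<sigma>) = theta2 \<sigma> * (hecke l invtheta (1 - 1 / \<sigma>) * csq \<sigma>)"
      unfolding theta_one_minus_inverse[OF \<sigma>] by (simp add: mult_ac)
    also have "\<dots> = theta2 \<sigma> * hecke l invtheta2 (\<sigma> / 4)"
      unfolding hecke_invtheta_cusp[OF l \<sigma>] ..
    \<comment> \<open>The factor \<open>?p ^ J\<close> clears the pole, so that power series can be
      evaluated on both sides.\<close>
    finally have "?p ^ J * f (1 - 1 / \<sigma>) = ?p ^ J * (theta2 \<sigma> * hecke l invtheta2 (\<sigma> / 4))
        - (\<Sum>i\<le>J. Q i * (?p ^ J * hauptmodul (1 - 1 / \<sigma>) ^ i))"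
      by (simp add: f_def algebra_simps sum_distrib_left)
    also have "?p ^ J * (theta2 \<sigma> * hecke l invtheta2 (\<sigma> / 4)) = eval_fps ?K ?p"
      unfolding J_def by (rule theta2_mult_hecke[OF l \<sigma>])
    also have "\<dots> = (\<Sum>i\<le>J. Q i * (?p ^ (J - i) * eval_fps ?k ?p ^ i)) + ?p ^ Suc J * eval_fps R ?p"
    proof -
      have "eval_fps ?K ?p = eval_fps (\<Sum>i\<le>J. fps_const (Q i) * (fps_X ^ (J - i) * ?k ^ i)) ?p + eval_fps (fps_X ^ Suc J * R) ?p"
        unfolding K using q
        by (intro eval_fps_add) (auto intro!: less_conv_radius fps_sum_disc(1) radS fps_conv_radius_mult_disc radR simp del: power_Suc)
      also have "eval_fps (fps_X ^ Suc J * R) ?p = ?p ^ Suc J * eval_fps R ?p"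
        using q radR by (simp add: eval_fps_mult_disc del: power_Suc)
      also have "eval_fps (\<Sum>i\<le>J. fps_const (Q i) * (fps_X ^ (J - i) * ?k ^ i)) ?p = (\<Sum>i\<le>J. Q i * (?p ^ (J - i) * eval_fps ?k ?p ^ i))"
      proof (subst fps_sum_disc(2))
        show "(\<Sum>i\<le>J. eval_fps (fps_const (Q i) * (fps_X ^ (J - i) * ?k ^ i)) ?p) = (\<Sum>i\<le>J. Q i * (?p ^ (J - i) * eval_fps ?k ?p ^ i))"
          using q by (simp add: eval_fps_mult_disc eval_fps_power_disc hauptmodul_cusp_fps_conv_radius
            fps_conv_radius_power_disc fps_conv_radius_mult_disc)
      qed (auto intro!: radS q)
      finally show ?thesis .
    qed
    also have "(\<Sum>i\<le>J. Q i * (?p ^ (J - i) * eval_fps ?k ?p ^ i)) = (\<Sum>i\<le>J. Q i * (?p ^ J * hauptmodul (1 - 1 / \<sigma>) ^ i))"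
    proof (intro sum.cong refl)
      fix i assume "i \<in> {..J}"
      then have "?p ^ J = ?p ^ (J - i) * ?p ^ i" by (simp flip: power_add)
      then show "Q i * (?p ^ (J - i) * eval_fps ?k ?p ^ i) = Q i * (?p ^ J * hauptmodul (1 - 1 / \<sigma>) ^ i)"
        unfolding hauptmodul_cusp[OF \<sigma>, symmetric] by (simp add: power_mult_distrib)
    qed
    finally have "?p ^ J * f (1 - 1 / \<sigma>) = ?p ^ J * (?p * eval_fps R ?p)" by simp
    then show "f (1 - 1 / \<sigma>) = ?p * eval_fps R ?p" by simp
  qed
  \<comment> \<open>The nome covers the punctured disc; the value at 0 will follow by
    continuity.\<close>
  have ev0: "eval_fps \<Phi> q = 0" if "norm q < 1" "q \<noteq> 0" for q
    using nome_surj[OF that(2,1)] f\<Phi> f0 by metis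
  have "\<Phi> = 0"
  proof (rule eval_fps_eqD)
    show "fps_conv_radius \<Phi> > 0" using rad\<Phi> by (auto intro: less_le_trans[of _ 1])
    have "ereal (norm (0::complex)) < fps_conv_radius \<Phi>" using rad\<Phi> by (intro less_conv_radius) auto
    then have "isCont (eval_fps \<Phi>) 0" by (intro continuous_intros) simp
    then have "(eval_fps \<Phi> \<longlongrightarrow> eval_fps \<Phi> 0) (at 0)" by (simp add: isCont_def)
    moreover have "eventually (\<lambda>q. eval_fps \<Phi> q = 0) (at 0)"
      unfolding eventually_at by (intro exI[of _ 1]) (auto intro: ev0)
    then have "(eval_fps \<Phi> \<longlongrightarrow> 0) (at 0)" by (rule tendsto_eventually)
    ultimately have "eval_fps \<Phi> 0 = 0" using tendsto_unique[of "at (0::complex)"] by auto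
    then have "eval_fps \<Phi> q = eval_fps 0 q" if "q \<in> ball 0 1" for q
      using ev0[of q] that by (cases "q = 0") auto
    then show "eventually (\<lambda>q. eval_fps \<Phi> q = eval_fps 0 q) (nhds 0)"
      by (intro eventually_nhds_in_open[THEN eventually_mono, of "ball 0 1"]) auto
  qed auto
  then show ?thesis using that[of Q J] Q by (simp add: \<Phi>_def g_def)
qed

text \<open>The Legendre symbol of 0 is 0, and the other two terms both involve the constant
  coefficient 1 of 1 / theta.\<close>

lemma hecke_coeff_0: "hecke_coeff l invtheta_coeff 0 = of_nat (l ^ 3) + 1"
proof -
  have "fps_nth (theta_fps * invtheta_fps) 0 = 1" unfolding theta_mult_invtheta_fps by simp
  then have "fps_nth invtheta_fps 0 = 1" by (simp add: theta_fps_def square_coeff_def)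
  then show ?thesis by (simp add: hecke_coeff_def invtheta_coeff_def Legendre_def)
qed

text \<open>Comparing constant terms determines Q(0), since the Hauptmodul has none at infinity.
  Multiplying by the integral series 1 / theta then turns the congruence for theta H into one for
  the coefficients of H.\<close>

theorem hecke_coeff_congruence:
  assumes l: "prime l" "odd l"
  obtains z where "z \<in> \<int>"
    "hecke_coeff l invtheta_coeff (int n) = (of_nat (l ^ 3) + 1) * invtheta_coeff (int n) + 2 ^ 12 * z"
proof -
  obtain Q J where Q: "\<And>i. Q i \<in> \<int>"
    and eq: "theta_fps * hecke_fps l = (\<Sum>i\<le>J. fps_const (Q i) * (fps_const (2 ^ 12) * hauptmodul_fps) ^ i)"
    using theta_hecke_eq_polynomial[OF l] by blast
  define c :: complex where "c = 2 ^ 12"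
  have c: "c \<in> \<int>" by (simp add: c_def)
  \<comment> \<open>One factor \<open>c\<close> is split off each positive power, hence the exponent
    \<open>i - 1\<close>.\<close>
  define T where "T = (\<Sum>i\<in>{1..J}. fps_const (Q i) * (fps_const (c ^ (i - 1)) * hauptmodul_fps ^ i))"
  have intT: "int_fps T"
    unfolding T_def using Q c by (intro int_fps_sum int_fps_mult int_fps_const int_fps_power int_fps_hauptmodul) auto
  have "fps_nth hauptmodul_fps 0 = 0" by (simp add: hauptmodul_fps_def)
  then have T0: "fps_nth T 0 = 0" by (auto simp: T_def fps_sum_nth fps_power_zeroth intro!: sum.neutral)
  have "{..J} = insert 0 {1..J}" by auto
  then have "theta_fps * hecke_fps l
     = fps_const (Q 0) + (\<Sum>i\<in>{1..J}. fps_const (Q i) * (fps_const c * hauptmodul_fps) ^ i)"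
    unfolding eq c_def[symmetric] by simp
  also have "(\<Sum>i\<in>{1..J}. fps_const (Q i) * (fps_const c * hauptmodul_fps) ^ i) = fps_const c * T"
    unfolding T_def sum_distrib_left
  proof (intro sum.cong refl)
    fix i assume "i \<in> {1..J}"
    then obtain j where j: "i = Suc j" by (cases i) auto
    have "(fps_const c * hauptmodul_fps) ^ i = fps_const c * (fps_const (c ^ j) * hauptmodul_fps ^ i)"
      unfolding power_mult_distrib fps_const_power j by (simp add: mult.assoc flip: fps_const_mult)
    then show "fps_const (Q i) * (fps_const c * hauptmodul_fps) ^ i
       = fps_const c * (fps_const (Q i) * (fps_const (c ^ (i - 1)) * hauptmodul_fps ^ i))"
      unfolding j by (simp only: diff_Suc_1 mult_ac)
  qed
  finally have th: "theta_fps * hecke_fps l = fps_const (Q 0) + fps_const c * T" .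
  have "hecke_coeff l invtheta_coeff 0 = Q 0"
    using arg_cong[OF th, of "\<lambda>f. fps_nth f 0"] T0
    by (simp add: theta_fps_def square_coeff_def hecke_fps_def)
  then have Q0: "Q 0 = of_nat (l ^ 3) + 1" unfolding hecke_coeff_0 by simp
  have "hecke_fps l = invtheta_fps * (theta_fps * hecke_fps l)"
    using theta_mult_invtheta_fps by (metis mult.assoc mult.commute mult_1)
  also have "\<dots> = fps_const (Q 0) * invtheta_fps + fps_const c * (invtheta_fps * T)"
    unfolding th by (simp add: algebra_simps)
  finally have "fps_nth (hecke_fps l) n = Q 0 * fps_nth invtheta_fps n + c * fps_nth (invtheta_fps * T) n"
    by simp
  moreover have "fps_nth (invtheta_fps * T) n \<in> \<int>"
    using int_fps_mult[OF int_fps_invtheta intT] by (simp add: int_fps_def)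
  ultimately show ?thesis
    using that[of "fps_nth (invtheta_fps * T) n"] by (simp add: hecke_fps_def invtheta_coeff_def Q0 c_def)
qed

section \<open>Back to overpartition numbers\<close>

lemma pbar_divide:
  assumes "m > 0"
  shows "pbar (of_nat n / of_nat m) = (if m dvd n then card (overpartitions (n div m)) else 0)"
proof (cases "m dvd n")
  case True
  then obtain k where "n = m * k" ..
  then show ?thesis using assms pbar_of_nat[of k] by simp
next
  case False
  have "(of_nat n / of_nat m :: rat) \<notin> \<nat>"
  proof
    assume "(of_nat n / of_nat m :: rat) \<in> \<nat>"
    then obtain k where "(of_nat n / of_nat m :: rat) = of_nat k" by (elim Nats_cases)
    then have "(of_nat n :: rat) = of_nat (k * m)" using assms by (simp add: field_simps)
    then have "n = k * m" by (simp only: of_nat_eq_iff)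
    then show False using False by simp
  qed
  then show ?thesis using False by (simp add: pbar_def)
qed

theorem theorem5p1:
  fixes l n :: nat
  assumes "prime l" and "odd l"
  shows "[int l ^ 3 * int (pbar (of_nat (l ^ 2 * n)))
            + Legendre (- int n) (int l) * int l * int (pbar (of_nat n))
            + int (pbar (of_nat n / of_nat (l ^ 2)))
          = (int l ^ 3 + 1) * int (pbar (of_nat n))] (mod 2 ^ 12)"
proof -
  let ?P = "\<lambda>n. int (card (overpartitions n))"
  let ?L = "int l ^ 3 * ?P (l\<^sup>2 * n) + Legendre (- int n) (int l) * int l * ?P n
     + (if l\<^sup>2 dvd n then ?P (n div l\<^sup>2) else 0)"
  have l2: "l\<^sup>2 > 0" using prime_gt_0_nat[OF assms(1)] by simp
  have a: "invtheta_coeff (int m) = (-1) ^ m * of_int (?P m)" for m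
    by (simp add: invtheta_coeff_def invtheta_fps_def fps_twist_def overpartition_fps_def)
  \<comment> \<open>As l^2 is odd, all terms on the left carry the common sign (-1)^n, which is
    cancelled at the end.\<close>
  have sign: "(-1 :: complex) ^ (l\<^sup>2 * m) = (-1) ^ m" for m
    using assms(2) by (simp add: minus_one_power_iff)
  have L: "hecke_coeff l invtheta_coeff (int n) = (-1) ^ n * of_int ?L"
  proof -
    have m1: "invtheta_coeff (int (l\<^sup>2) * int n) = (-1) ^ n * of_int (?P (l\<^sup>2 * n))"
      using a[of "l\<^sup>2 * n"] sign[of n] by simp
    have m2: "(if int (l\<^sup>2) dvd int n then invtheta_coeff (int n div int (l\<^sup>2)) else 0)
       = (-1) ^ n * of_int (if l\<^sup>2 dvd n then ?P (n div l\<^sup>2) else 0)"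
    proof (cases "l\<^sup>2 dvd n")
      case True
      then have "(-1 :: complex) ^ (n div l\<^sup>2) = (-1) ^ n" using sign[of "n div l\<^sup>2"] by simp
      moreover have "int n div int (l\<^sup>2) = int (n div l\<^sup>2)" by (simp only: zdiv_int)
      moreover have "int (l\<^sup>2) dvd int n" using True by (simp only: of_nat_dvd_iff)
      ultimately show ?thesis using True a[of "n div l\<^sup>2"] by (simp only: if_True)
    next
      case False
      then have "\<not> int (l\<^sup>2) dvd int n" by (simp only: of_nat_dvd_iff not_False_eq_True)
      then show ?thesis using False by (simp only: if_False of_int_0 mult_zero_right)
    qed
    show ?thesis unfolding hecke_coeff_def m1 m2 a by (simp add: algebra_simps)
  qed
  obtain z where z: "z \<in> \<int>"
    "hecke_coeff l invtheta_coeff (int n) = (of_nat (l ^ 3) + 1) * invtheta_coeff (int n) + 2 ^ 12 * z"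
    using hecke_coeff_congruence[OF assms] .
  obtain w where w: "z = of_int w" using z(1) by (elim Ints_cases)
  have "(-1) ^ n * (-1) ^ n = (1 :: complex)" by (simp flip: power_mult_distrib)
  then have "of_int ?L = (-1) ^ n * ((-1) ^ n * of_int ?L :: complex)" by (simp only: mult.assoc[symmetric] mult_1)
  also have "\<dots> = ((-1) ^ n * (-1) ^ n) * of_int ((int l ^ 3 + 1) * ?P n) + of_int (2 ^ 12 * ((-1) ^ n * w))"
    unfolding L[symmetric] z(2) a w by (simp add: algebra_simps)
  also have "\<dots> = of_int ((int l ^ 3 + 1) * ?P n + 2 ^ 12 * ((-1) ^ n * w))"
    using \<open>(-1) ^ n * (-1) ^ n = (1 :: complex)\<close> by (simp only: mult_1 of_int_add)
  finally have "?L = (int l ^ 3 + 1) * ?P n + 2 ^ 12 * ((-1) ^ n * w)" by (simp only: of_int_eq_iff)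
  then have "?L - (int l ^ 3 + 1) * ?P n = 2 ^ 12 * ((-1) ^ n * w)" by (simp only: add_diff_cancel_left')
  then have "[?L = (int l ^ 3 + 1) * ?P n] (mod 2 ^ 12)"
    unfolding cong_iff_dvd_diff by (simp only: dvd_triv_left)
  moreover have "int (pbar (of_nat n / of_nat (l ^ 2))) = (if l\<^sup>2 dvd n then ?P (n div l\<^sup>2) else 0)"
    unfolding pbar_divide[OF l2] by simp
  ultimately show ?thesis unfolding pbar_of_nat by (simp only:)
qed

end
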